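(* Let $1\leq p_0,q_0\leq\infty$ and set $$A(p_0,q_0)=\left\{(p,q)\in(0,+\infty]\times(0,+\infty]:\ \frac1p+\frac1q\geq\frac1{p_0}+\frac1{q_0},\ \ p_0\geq p\right\}.$$ Let $(p,q)\in(0,+\infty]\times(0,+\infty]$. (1) If $p_0,q_0<+\infty$, then $RM(p_0,q_0)\subset RM(p,q)$ if and only if $(p,q)\in A(p_0,q_0)\setminus\{(\beta,\infty)\}$, where $\beta=\frac{p_0q_0}{p_0+q_0}$. (2) If either $p_0$ or $q_0$ is $+\infty$, then $RM(p_0,q_0)\subset RM(p,q)$ if and only if $(p,q)\in A(p_0,q_0)$.
   Context: $\mathbb{D}$ is the open unit disc of $\mathbb{C}$ and $\mathcal{H}(\mathbb{D})$ is the space of holomorphic functions on $\mathbb{D}$. For $0<p,q\leq+\infty$, $RM(p,q)=\{f\in\mathcal{H}(\mathbb{D}):\rho_{p,q}(f)<+\infty\}$, where $$\rho_{p,q}(f)=\left(\frac{1}{2\pi}\int_0^{2\pi}\left(\int_0^1|f(re^{it})|^p\,dr\right)^{q/p}dt\right)^{1/q}\ (p,q<\infty),$$ $$\rho_{p,\infty}(f)=\operatorname{ess\,sup}_{t\in[0,2\pi)}\left(\int_0^1|f(re^{it})|^p\,dr\right)^{1/p}\ (p<\infty),$$ $$\rho_{\infty,q}(f)=\left(\frac{1}{2\pi}\int_0^{2\pi}\left(\sup_{r\in[0,1)}|f(re^{it})|\right)^{q}dt\right)^{1/q}\ (q<\infty),\qquad \rho_{\infty,\infty}(f)=\sup_{z\in\mathbb{D}}|f(z)|.$$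 Convention: $1/\infty=0$. *)

theory Defs
  imports "HOL-Complex_Analysis.Complex_Analysis" "HOL-Probability.Essential_Supremum"
begin

text \<open>Powers of a value in \<open>[0,\<infinity>]\<close>. Only positive real exponents \<open>a\<close> are used, so \<open>\<infinity>\<close> is
  sent to \<open>\<infinity>\<close>; \<open>powr\<close> gives \<open>0\<close> at base \<open>0\<close>.\<close>

definition epowr :: "ennreal \<Rightarrow> real \<Rightarrow> ennreal"  (infixr "epowr" 80) where
  "x epowr a = (if x = \<infinity> then \<infinity> else ennreal (enn2real x powr a))"

text \<open>Exponents range over \<open>(0,\<infinity>]\<close>, represented by the positive elements of \<^typ>\<open>ennreal\<close>,
  where \<open>1 / \<infinity> = 0\<close>. All quantities take values in \<open>[0,\<infinity>]\<close>, and \<open>f\<close> is only evaluated in the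
  open unit disc: the factor \<open>indicator {0..<1}\<close> inside the radial integral annihilates
  the other values.\<close>

definition radial_int :: "real \<Rightarrow> (complex \<Rightarrow> complex) \<Rightarrow> real \<Rightarrow> ennreal" where
  "radial_int p f t =
     (\<integral>\<^sup>+ r\<in>{0..<1}. ennreal (norm (f (of_real r * exp (\<i> * of_real t))) powr p) \<partial>lborel)"

definition radial_sup :: "(complex \<Rightarrow> complex) \<Rightarrow> real \<Rightarrow> ennreal" where
  "radial_sup f t = (SUP r\<in>{0..<1::real}. ennreal (norm (f (of_real r * exp (\<i> * of_real t)))))"

definition circle_mean :: "(real \<Rightarrow> ennreal) \<Rightarrow> ennreal" where
  "circle_mean g = ennreal (1 / (2 * pi)) * (\<integral>\<^sup>+ t\<in>{0..<2 * pi}. g t \<partial>lborel)"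

definition rho :: "ennreal \<Rightarrow> ennreal \<Rightarrow> (complex \<Rightarrow> complex) \<Rightarrow> ennreal" where
  "rho p q f =
    (if p < \<infinity> \<and> q < \<infinity> then
       circle_mean (\<lambda>t. radial_int (enn2real p) f t epowr (enn2real q / enn2real p))
         epowr (1 / enn2real q)
     else if p < \<infinity> then
       esssup (restrict_space lborel {0..<2 * pi})
         (\<lambda>t. radial_int (enn2real p) f t epowr (1 / enn2real p))
     else if q < \<infinity> then
       circle_mean (\<lambda>t. radial_sup f t epowr enn2real q) epowr (1 / enn2real q)
     else (SUP z\<in>ball 0 1. ennreal (norm (f z))))"

text \<open>Holomorphic functions on the disc are represented by total functions; their values outside
  the disc are arbitrary and do not affect membership.\<close>

definition RM :: "ennreal \<Rightarrow> ennreal \<Rightarrow> (complex \<Rightarrow> complex) set" where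
  "RM p q = {f. f holomorphic_on ball 0 1 \<and> rho p q f < \<infinity>}"

definition A :: "ennreal \<Rightarrow> ennreal \<Rightarrow> (ennreal \<times> ennreal) set" where
  "A p0 q0 = {(p, q). 0 < p \<and> 0 < q \<and> 1 / p + 1 / q \<ge> 1 / p0 + 1 / q0 \<and> p0 \<ge> p}"

text \<open>\<^const>\<open>esssup\<close> returns \<open>\<infinity>\<close> on functions that are not measurable. This convention is never
  triggered for the functions considered here.\<close>

lemma radial_int_measurable:
  assumes "f holomorphic_on ball 0 1"
  shows "radial_int p f \<in> borel_measurable lborel"
proof -
  define g where "g z = indicator (ball 0 1) z *\<^sub>R f z" for z :: complex
  have g[measurable]: "g \<in> borel_measurable borel"
    unfolding g_def
    by (rule borel_measurable_continuous_on_indicator)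
       (auto intro: holomorphic_on_imp_continuous_on assms)
  have "radial_int p f = (\<lambda>t. \<integral>\<^sup>+ r. ennreal (norm (g (of_real r * exp (\<i> * of_real t))) powr p)
      * indicator {0..<1} r \<partial>lborel)"
    unfolding radial_int_def
    by (intro ext nn_integral_cong) (auto simp: g_def indicator_def norm_mult)
  also have "\<dots> \<in> borel_measurable lborel"
  proof -
    have "(\<lambda>x. of_real (snd x) * exp (\<i> * of_real (fst x)) :: complex)
        \<in> borel_measurable (borel :: (real \<times> real) measure)"
      by (intro borel_measurable_continuous_onI continuous_intros)
    then have [measurable]: "(\<lambda>x. of_real (snd x) * exp (\<i> * of_real (fst x)) :: complex)
        \<in> borel_measurable (lborel \<Otimes>\<^sub>M (lborel :: real measure))"
      by (simp add: lborel_prod)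
    show ?thesis
      by (rule lborel.borel_measurable_nn_integral) (simp add: split_beta', measurable)
  qed
  finally show ?thesis .
qed

lemma rho_inner_measurable:
  assumes "f holomorphic_on ball 0 1"
  shows "(\<lambda>t. radial_int p f t epowr a) \<in> borel_measurable (restrict_space lborel {0..<2 * pi})"
proof -
  note [measurable] = radial_int_measurable[OF assms, of p]
  show ?thesis
    unfolding epowr_def by (rule measurable_restrict_space1) measurable
qed

end

(* Inclusions. On Whitney boxes the subharmonicity of |f|^(1/2) bounds |f(r e^(it))| by
   (1-r)^(-1/p0) times a power of the average, over |theta - t| < 1-r, of a function H in L^2 built
   from the radial norms of f. Estimating this average by the maximal function of H and by the norm of
   H, and balancing the two bounds as in Hedberg's proof of Sobolev's inequality, gives the critical
   line 1/p + 1/q = 1/p0 + 1/q0 for q < oo. For q = oo and p0 = oo, Hardy's inequality takes the place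
   of the maximal function, which is the Fejer-Riesz inequality. Everything else is Jensen.

   Failures. A lacunary series has infinite radial p-norm along every radius although it lies in
   RM(p0,oo), if p > p0. The functions (1-z)^(-g) rule out 1/p + 1/q < 1/p0 + 1/q0, and
   ((1-z) log(C/(1-z)))^(-1/beta) rules out the endpoint (beta,oo). *)

theory Submission
  imports Defs
begin

section \<open>Mean values over squares\<close>

text \<open>The obstacle is \<open>q0 = 1\<close>, where the maximal operator is not bounded on L^1.
  Working with |f|^(1/2) lowers the exponent to be averaged to 1/2, so the average can be passed on
  to H = n^(q0/2), with n the radial norm (plus 1). This H lies in L^2 for every q0 >= 1, and an L^2
  maximal inequality is enough.

  Why q = oo is special: with x = 1 - r, the P-th power of |f| is bounded, up to constants, by
  x^(-a) W(t)^(P/q0) (maximal function) and by x^(-b) (norm of H), where a = P/p0 and, on the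
  critical line, b = 1 + P/q. For q0 < q < oo one has a < 1 < b, and the two bounds balance to a
  power of W whose (q/P)-th power is W itself. For q = oo, b = 1 and the integral diverges
  logarithmically. If p0 = oo the loss disappears, since |f|^q0 is then dominated by squared
  averages of H, which Hardy's inequality integrates in x uniformly in t. If p0 < oo the loss is
  real, and the logarithmic example realizes it.\<close>

lemma borel_measurable_ennreal_indicator:
  fixes g :: "'a::topological_space \<Rightarrow> real"
  assumes "continuous_on S g" "S \<in> sets borel"
  shows "(\<lambda>x. ennreal (g x) * indicator S x) \<in> borel_measurable borel"
proof -
  have "(\<lambda>x. indicator S x *\<^sub>R g x) \<in> borel_measurable borel"
    using assms by (intro borel_measurable_continuous_on_indicator)
  then have "(\<lambda>x. ennreal (indicator S x *\<^sub>R g x)) \<in> borel_measurable borel" by measurable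
  also have "(\<lambda>x. ennreal (indicator S x *\<^sub>R g x)) = (\<lambda>x. ennreal (g x) * indicator S x)"
    by (auto simp: indicator_def)
  finally show ?thesis .
qed

text \<open>Extended nonnegative integrals are used so that the later averaging over squares is
  plain Tonelli. \<open>\<phi>\<close> parametrizes the side by arclength in one coordinate.\<close>

lemma norm_contour_integral_linepath_le:
  fixes F :: "complex \<Rightarrow> complex" and \<phi> :: "real \<Rightarrow> complex"
  assumes cont: "continuous_on {a..a+L} (\<lambda>x. F (\<phi> x))" and "0 < L" "norm (q - p) = L"
    and \<phi>: "\<And>t. linepath p q t = \<phi> (a + L * t)"
  shows "ennreal (norm (contour_integral (linepath p q) F)) \<le> (\<integral>\<^sup>+x\<in>{a..a+L}. ennreal (norm (F (\<phi> x))) \<partial>lborel)"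
proof -
  define g where "g = (\<lambda>t. F (linepath p q t) * (q - p))"
  have sub: "(\<lambda>t. a + L * t) ` {0..1} \<subseteq> {a..a+L}" using \<open>0 < L\<close> by (auto simp: mult_left_le)
  have cg: "continuous_on {0..1} (\<lambda>t. F (\<phi> (a + L * t)))"
    by (rule continuous_on_compose2[OF cont _ sub]) (intro continuous_intros)
  then have gc: "continuous_on {0..1} g" unfolding g_def \<phi> by (intro continuous_intros)
  have gi: "g integrable_on {0..1}" by (rule integrable_continuous_real[OF gc])
  have ngi: "(\<lambda>t. norm (g t)) integrable_on {0..1}"
    by (intro integrable_continuous_real continuous_intros gc)
  have "contour_integral (linepath p q) F = integral {0..1} g"
    unfolding contour_integral_integral g_def by (simp add: vector_derivative_linepath_at)
  also have "norm \<dots> \<le> integral {0..1} (\<lambda>t. norm (g t))"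
    by (rule integral_norm_bound_integral[OF gi ngi]) auto
  finally have "ennreal (norm (contour_integral (linepath p q) F)) \<le> ennreal (integral {0..1} (\<lambda>t. norm (g t)))"
    by (rule ennreal_leI)
  also have "\<dots> = (\<integral>\<^sup>+t\<in>{0..1}. ennreal (norm (g t)) \<partial>lborel)"
  proof -
    have "set_integrable lborel {0..1} (\<lambda>t. norm (g t))"
      by (intro borel_integrable_atLeastAtMost' continuous_intros gc)
    then show ?thesis
      by (subst set_borel_integral_eq_integral(2)[symmetric])
         (auto simp: set_lebesgue_integral_def set_integrable_def nn_integral_eq_integral[symmetric] indicator_def
           intro!: nn_integral_cong)
  qed
  also have "\<dots> = ennreal L * (\<integral>\<^sup>+t. ennreal (norm (F (\<phi> (a + L * t)))) * indicator {a..a+L} (a + L * t) \<partial>lborel)"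
  proof (subst nn_integral_cmult[symmetric])
    have ind: "indicator {a..a+L} (a + L * t) = (indicator {0..1} t :: ennreal)" for t
      using \<open>0 < L\<close> by (auto simp: indicator_def mult_le_cancel_left1 zero_le_mult_iff)
    show "(\<lambda>t. ennreal (norm (F (\<phi> (a + L * t)))) * indicator {a..a+L} (a + L * t)) \<in> borel_measurable lborel"
      unfolding ind measurable_lborel2
      by (intro borel_measurable_ennreal_indicator continuous_intros cg) auto
    show "(\<integral>\<^sup>+t\<in>{0..1}. ennreal (norm (g t)) \<partial>lborel) =
      (\<integral>\<^sup>+t. ennreal L * (ennreal (norm (F (\<phi> (a + L * t)))) * indicator {a..a+L} (a + L * t)) \<partial>lborel)"
      unfolding ind g_def \<phi> using assms(3) \<open>0 < L\<close>
      by (intro nn_integral_cong) (auto simp: indicator_def norm_mult ennreal_mult mult.commute)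
  qed
  also have "\<dots> = (\<integral>\<^sup>+x\<in>{a..a+L}. ennreal (norm (F (\<phi> x))) \<partial>lborel)"
  proof -
    have m: "(\<lambda>t. ennreal (norm (F (\<phi> t))) * indicator {a..a+L} t) \<in> borel_measurable borel"
      by (intro borel_measurable_ennreal_indicator continuous_intros cont) auto
    show ?thesis
      using \<open>0 < L\<close> by (subst nn_integral_real_affine[OF m, of L a]) auto
  qed
  finally show ?thesis .
qed

lemma norm_rectpath_integral_le:
  fixes F :: "complex \<Rightarrow> complex"
  assumes I: "(F has_contour_integral I) (rectpath (Complex a c) (Complex b e))"
    and "a < b" "c < e"
    and cont: "continuous_on (path_image (rectpath (Complex a c) (Complex b e))) F"
  shows "ennreal (norm I) \<le>
      (\<integral>\<^sup>+x\<in>{a..b}. ennreal (norm (F (Complex x c))) \<partial>lborel) + (\<integral>\<^sup>+x\<in>{a..b}. ennreal (norm (F (Complex x e))) \<partial>lborel)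
    + ((\<integral>\<^sup>+y\<in>{c..e}. ennreal (norm (F (Complex a y))) \<partial>lborel) + (\<integral>\<^sup>+y\<in>{c..e}. ennreal (norm (F (Complex b y))) \<partial>lborel))"
proof -
  let ?P = "path_image (rectpath (Complex a c) (Complex b e))"
  define p1 p2 p3 p4 where "p1 = Complex a c" and "p2 = Complex b c" and "p3 = Complex b e" and "p4 = Complex a e"
  have P: "?P = closed_segment p1 p2 \<union> (closed_segment p2 p3 \<union> (closed_segment p3 p4 \<union> closed_segment p4 p1))"
    unfolding rectpath_def Let_def p1_def p2_def p3_def p4_def by (simp add: path_image_join)
  have P': "?P = {z. Re z \<in> {a, b} \<and> Im z \<in> {c..e}} \<union> {z. Im z \<in> {c, e} \<and> Re z \<in> {a..b}}"
    using assms by (simp add: path_image_rectpath)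
  have int: "F contour_integrable_on linepath p1 p2" "F contour_integrable_on linepath p2 p3"
     "F contour_integrable_on linepath p3 p4" "F contour_integrable_on linepath p4 p1"
    by (rule contour_integrable_continuous_linepath, rule continuous_on_subset[OF cont], (unfold P, blast))+
  have "I = contour_integral (rectpath (Complex a c) (Complex b e)) F"
    using I by (simp add: contour_integral_unique)
  also have "\<dots> = contour_integral (linepath p1 p2) F + (contour_integral (linepath p2 p3) F
      + (contour_integral (linepath p3 p4) F + contour_integral (linepath p4 p1) F))"
  proof -
    have "Complex (Re p3) (Im p1) = p2" "Complex (Re p1) (Im p3) = p4"
      by (simp_all add: p1_def p2_def p3_def p4_def)
    then show ?thesis
      unfolding rectpath_def Let_def p1_def[symmetric] p3_def[symmetric]
      using int by (simp add: contour_integrable_joinI)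
  qed
  \<comment> \<open>The top and left sides are traversed backwards by \<open>rectpath\<close>;
    reversing them makes all four integrals run over increasing coordinates.\<close>
  also have "\<dots> = contour_integral (linepath p1 p2) F + (contour_integral (linepath p2 p3) F
      + (- contour_integral (linepath p4 p3) F - contour_integral (linepath p1 p4) F))"
  proof -
    have "continuous_on (closed_segment p3 p4) F" "continuous_on (closed_segment p4 p1) F"
      by (rule continuous_on_subset[OF cont], (unfold P, blast))+
    then show ?thesis
      using contour_integral_reverse_linepath[of p3 p4 F] contour_integral_reverse_linepath[of p4 p1 F] by simp
  qed
  finally have Ieq: "I = contour_integral (linepath p1 p2) F + (contour_integral (linepath p2 p3) F
      + (- contour_integral (linepath p4 p3) F - contour_integral (linepath p1 p4) F))" .
  have "norm I \<le> norm (contour_integral (linepath p1 p2) F) + norm (contour_integral (linepath p4 p3) F)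
     + (norm (contour_integral (linepath p1 p4) F) + norm (contour_integral (linepath p2 p3) F))"
  proof -
    have "norm (A + (B + (- C - D))) \<le> norm A + norm C + (norm D + norm B)" for A B C D :: complex
      by norm
    then show ?thesis unfolding Ieq .
  qed
  then have "ennreal (norm I) \<le> ennreal (norm (contour_integral (linepath p1 p2) F)) + ennreal (norm (contour_integral (linepath p4 p3) F))
     + (ennreal (norm (contour_integral (linepath p1 p4) F)) + ennreal (norm (contour_integral (linepath p2 p3) F)))"
    by (simp flip: ennreal_plus)
  also have "\<dots> \<le> (\<integral>\<^sup>+x\<in>{a..a+(b-a)}. ennreal (norm (F (Complex x c))) \<partial>lborel) + (\<integral>\<^sup>+x\<in>{a..a+(b-a)}. ennreal (norm (F (Complex x e))) \<partial>lborel)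
    + ((\<integral>\<^sup>+y\<in>{c..c+(e-c)}. ennreal (norm (F (Complex a y))) \<partial>lborel) + (\<integral>\<^sup>+y\<in>{c..c+(e-c)}. ennreal (norm (F (Complex b y))) \<partial>lborel))"
  proof (intro add_mono norm_contour_integral_linepath_le)
    have cc: "continuous_on {s..t} (\<lambda>x. F (Complex x y))" if "\<And>x. x \<in> {s..t} \<Longrightarrow> Complex x y \<in> ?P" for s t y
      using that by (intro continuous_on_compose2[OF cont]) (auto simp: Complex_eq intro!: continuous_intros)
    have cc': "continuous_on {s..t} (\<lambda>x. F (Complex y x))" if "\<And>x. x \<in> {s..t} \<Longrightarrow> Complex y x \<in> ?P" for s t y
      using that by (intro continuous_on_compose2[OF cont]) (auto simp: Complex_eq intro!: continuous_intros)
    show "continuous_on {a..a + (b - a)} (\<lambda>x. F (Complex x c))" "continuous_on {a..a + (b - a)} (\<lambda>x. F (Complex x e))"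
      using assms by (auto intro!: cc simp: P')
    show "continuous_on {c..c + (e - c)} (\<lambda>x. F (Complex a x))" "continuous_on {c..c + (e - c)} (\<lambda>x. F (Complex b x))"
      using assms by (auto intro!: cc' simp: P')
  qed (use assms in \<open>auto simp: p1_def p2_def p3_def p4_def cmod_def linepath_def complex_eq_iff algebra_simps\<close>)
  finally show ?thesis by simp
qed

lemma cbox_indicator_measurable:
  fixes h :: "complex \<Rightarrow> complex"
  assumes "continuous_on (cbox (Complex a c) (Complex b e)) h"
  shows "(\<lambda>z::real\<times>real. indicator ({a..b} \<times> {c..e}) z *\<^sub>R h (Complex (fst z) (snd z))) \<in> borel_measurable (lborel \<Otimes>\<^sub>M lborel)"
  unfolding lborel_prod measurable_lborel2
proof (rule borel_measurable_continuous_on_indicator)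
  show "continuous_on ({a..b} \<times> {c..e}) (\<lambda>z. h (Complex (fst z) (snd z)))"
  proof (rule continuous_on_compose2[OF assms])
    show "continuous_on ({a..b} \<times> {c..e}) (\<lambda>z. Complex (fst z) (snd z))"
      unfolding Complex_eq by (intro continuous_intros)
  qed (auto simp: in_cbox_complex_iff)
qed (auto intro!: borel_closed closed_Times)

text \<open>Cauchy's formula on the squares of half side \<open>\<eta>\<close>, averaged over \<open>\<eta> \<in> {d/2..d}\<close>.\<close>

lemma square_mean_value:
  fixes h :: "complex \<Rightarrow> complex"
  assumes hol: "h holomorphic_on cbox (Complex (a-d) (b-d)) (Complex (a+d) (b+d))" and "0 < d"
  shows "ennreal (d^2 * norm (h (Complex a b))) \<le>
    3 * (\<integral>\<^sup>+y\<in>{b-d..b+d}. (\<integral>\<^sup>+x\<in>{a-d..a+d}. ennreal (norm (h (Complex x y))) \<partial>lborel) \<partial>lborel)"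
proof -
  define u where "u = Complex a b"
  let ?C = "cbox (Complex (a-d) (b-d)) (Complex (a+d) (b+d))"
  have C: "z \<in> ?C \<longleftrightarrow> Re z \<in> {a-d..a+d} \<and> Im z \<in> {b-d..b+d}" for z
    by (auto simp: in_cbox_complex_iff)
  have hc: "continuous_on ?C h" using hol by (rule holomorphic_on_imp_continuous_on)
  define G where "G = (\<lambda>z::real\<times>real. indicator ({a-d..a+d} \<times> {b-d..b+d}) z *\<^sub>R h (Complex (fst z) (snd z)))"
  have [measurable]: "G \<in> borel_measurable (lborel \<Otimes>\<^sub>M lborel)"
    unfolding G_def by (rule cbox_indicator_measurable[OF hc])
  define J where "J = (\<integral>\<^sup>+y. (\<integral>\<^sup>+x. ennreal (norm (G (x, y))) \<partial>lborel) \<partial>lborel)"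
  have J': "J = (\<integral>\<^sup>+x. (\<integral>\<^sup>+y. ennreal (norm (G (x, y))) \<partial>lborel) \<partial>lborel)"
    unfolding J_def by (rule lborel_pair.Fubini') measurable
  have Jeq: "J = (\<integral>\<^sup>+y\<in>{b-d..b+d}. (\<integral>\<^sup>+x\<in>{a-d..a+d}. ennreal (norm (h (Complex x y))) \<partial>lborel) \<partial>lborel)"
  proof -
    have "(\<integral>\<^sup>+x. ennreal (norm (G (x, y))) \<partial>lborel) = (\<integral>\<^sup>+x\<in>{a-d..a+d}. ennreal (norm (h (Complex x y))) \<partial>lborel) * indicator {b-d..b+d} y" for y
      by (cases "y \<in> {b-d..b+d}") (auto simp: G_def indicator_def intro!: nn_integral_cong)
    then show ?thesis by (simp add: J_def)
  qed
  \<comment> \<open>Integrals over full rows and columns of the large square dominate those over the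
    sides of each smaller square. As \<open>\<eta>\<close> varies, each of the four sides sweeps a
    part of the square, so each contributes at most \<open>J\<close>.\<close>
  define R where "R y = (\<integral>\<^sup>+x. ennreal (norm (G (x, y))) \<partial>lborel)" for y
  define S where "S x = (\<integral>\<^sup>+y. ennreal (norm (G (x, y))) \<partial>lborel)" for x
  have [measurable]: "R \<in> borel_measurable borel" "S \<in> borel_measurable borel"
    unfolding R_def S_def by measurable
  have shift: "(\<integral>\<^sup>+\<eta>. R (b - \<eta>) \<partial>lborel) = J" "(\<integral>\<^sup>+\<eta>. R (b + \<eta>) \<partial>lborel) = J"
       "(\<integral>\<^sup>+\<eta>. S (a - \<eta>) \<partial>lborel) = J" "(\<integral>\<^sup>+\<eta>. S (a + \<eta>) \<partial>lborel) = J"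
    using nn_integral_real_affine[of R "-1" b] nn_integral_real_affine[of R 1 b]
       nn_integral_real_affine[of S "-1" a] nn_integral_real_affine[of S 1 a]
       J_def[folded R_def] J'[folded S_def]
    by simp_all
  have each: "ennreal (2 * pi * norm (h u)) \<le> ennreal (2/d) * (R (b - \<eta>) + R (b + \<eta>) + (S (a - \<eta>) + S (a + \<eta>)))"
    if \<eta>: "\<eta> \<in> {d/2..d}" for \<eta>
  proof -
    have "0 < \<eta>" using \<eta> \<open>0 < d\<close> by auto
    let ?P = "rectpath (Complex (a-\<eta>) (b-\<eta>)) (Complex (a+\<eta>) (b+\<eta>))"
    have Pi: "path_image ?P = {z. Re z \<in> {a-\<eta>, a+\<eta>} \<and> Im z \<in> {b-\<eta>..b+\<eta>}} \<union> {z. Im z \<in> {b-\<eta>, b+\<eta>} \<and> Re z \<in> {a-\<eta>..a+\<eta>}}"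
      using \<open>0 < \<eta>\<close> by (simp add: path_image_rectpath)
    have sub: "path_image ?P \<subseteq> ?C - {u}" using \<eta> \<open>0 < \<eta>\<close> by (auto simp: Pi C u_def)
    have "((\<lambda>w. h w / (w - u)) has_contour_integral of_real (2 * pi) * \<i> * winding_number ?P u * h u) ?P"
    proof (rule Cauchy_integral_formula_convex_simple[OF _ hol])
      show "u \<in> interior ?C" using \<open>0 < d\<close> by (auto simp: u_def in_box_complex_iff)
    qed (use sub in auto)
    moreover have "winding_number ?P u = 1"
      by (rule winding_number_rectpath) (use \<open>0 < \<eta>\<close> in \<open>auto simp: u_def in_box_complex_iff\<close>)
    ultimately have I: "((\<lambda>w. h w / (w - u)) has_contour_integral of_real (2 * pi) * \<i> * h u) ?P" by simp
    have far: "\<eta> \<le> norm (w - u)" if "w \<in> path_image ?P" for w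
    proof -
      have "\<eta> \<le> \<bar>Re (w - u)\<bar> \<or> \<eta> \<le> \<bar>Im (w - u)\<bar>"
        using that \<open>0 < \<eta>\<close> by (auto simp: Pi u_def)
      then show ?thesis using abs_Re_le_cmod[of "w-u"] abs_Im_le_cmod[of "w-u"] by linarith
    qed
    have bd: "norm (h w / (w - u)) \<le> 2/d * norm (h w)" if "w \<in> path_image ?P" for w
    proof -
      have "d/2 \<le> norm (w - u)" using far[OF that] \<eta> by auto
      moreover from this have "0 < norm (w - u)" using \<open>0 < d\<close> by linarith
      ultimately have "norm (h w) / norm (w - u) \<le> norm (h w) / (d/2)"
        using \<open>0 < d\<close> by (intro divide_left_mono mult_pos_pos) auto
      then show ?thesis by (simp add: norm_divide mult.commute)
    qed
    have "ennreal (norm (of_real (2 * pi) * \<i> * h u)) \<le>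
      (\<integral>\<^sup>+x\<in>{a-\<eta>..a+\<eta>}. ennreal (norm (h (Complex x (b-\<eta>)) / (Complex x (b-\<eta>) - u))) \<partial>lborel)
     + (\<integral>\<^sup>+x\<in>{a-\<eta>..a+\<eta>}. ennreal (norm (h (Complex x (b+\<eta>)) / (Complex x (b+\<eta>) - u))) \<partial>lborel)
     + ((\<integral>\<^sup>+y\<in>{b-\<eta>..b+\<eta>}. ennreal (norm (h (Complex (a-\<eta>) y) / (Complex (a-\<eta>) y - u))) \<partial>lborel)
     + (\<integral>\<^sup>+y\<in>{b-\<eta>..b+\<eta>}. ennreal (norm (h (Complex (a+\<eta>) y) / (Complex (a+\<eta>) y - u))) \<partial>lborel))"
      by (rule norm_rectpath_integral_le[OF I])
         (use \<open>0 < \<eta>\<close> sub in \<open>auto intro!: continuous_intros continuous_on_subset[OF hc]\<close>)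
    also have "\<dots> \<le> ennreal (2/d) * R (b-\<eta>) + ennreal (2/d) * R (b+\<eta>) + (ennreal (2/d) * S (a-\<eta>) + ennreal (2/d) * S (a+\<eta>))"
    proof (intro add_mono)
      have 1: "(\<integral>\<^sup>+x\<in>{a-\<eta>..a+\<eta>}. ennreal (norm (h (Complex x y) / (Complex x y - u))) \<partial>lborel) \<le> ennreal (2/d) * R y"
        if y: "y \<in> {b-\<eta>, b+\<eta>}" for y
        unfolding R_def
      proof (subst nn_integral_cmult[symmetric], measurable, rule nn_integral_mono)
        fix x
        show "ennreal (norm (h (Complex x y) / (Complex x y - u))) * indicator {a - \<eta>..a + \<eta>} x \<le> ennreal (2 / d) * ennreal (norm (G (x, y)))"
        proof (cases "x \<in> {a - \<eta>..a + \<eta>}")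
          case True
          then have "Complex x y \<in> path_image ?P" using y by (auto simp: Pi)
          from bd[OF this] have "ennreal (norm (h (Complex x y) / (Complex x y - u))) \<le> ennreal (2/d * norm (h (Complex x y)))"
            by (rule ennreal_leI)
          moreover have "norm (G (x, y)) = norm (h (Complex x y))"
            using True y \<eta> \<open>0 < \<eta>\<close> by (auto simp: G_def indicator_def)
          ultimately show ?thesis using True \<open>0 < d\<close> by (simp add: ennreal_mult'[symmetric])
        qed auto
      qed
      have 2: "(\<integral>\<^sup>+y\<in>{b-\<eta>..b+\<eta>}. ennreal (norm (h (Complex x y) / (Complex x y - u))) \<partial>lborel) \<le> ennreal (2/d) * S x"
        if x: "x \<in> {a-\<eta>, a+\<eta>}" for x
        unfolding S_def
      proof (subst nn_integral_cmult[symmetric], measurable, rule nn_integral_mono)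
        fix y
        show "ennreal (norm (h (Complex x y) / (Complex x y - u))) * indicator {b - \<eta>..b + \<eta>} y \<le> ennreal (2 / d) * ennreal (norm (G (x, y)))"
        proof (cases "y \<in> {b - \<eta>..b + \<eta>}")
          case True
          then have "Complex x y \<in> path_image ?P" using x by (auto simp: Pi)
          from bd[OF this] have "ennreal (norm (h (Complex x y) / (Complex x y - u))) \<le> ennreal (2/d * norm (h (Complex x y)))"
            by (rule ennreal_leI)
          moreover have "norm (G (x, y)) = norm (h (Complex x y))"
            using True x \<eta> \<open>0 < \<eta>\<close> by (auto simp: G_def indicator_def)
          ultimately show ?thesis using True \<open>0 < d\<close> by (simp add: ennreal_mult'[symmetric])
        qed auto
      qed
      show "(\<integral>\<^sup>+x\<in>{a-\<eta>..a+\<eta>}. ennreal (norm (h (Complex x (b-\<eta>)) / (Complex x (b-\<eta>) - u))) \<partial>lborel) \<le> ennreal (2/d) * R (b-\<eta>)"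
        "(\<integral>\<^sup>+x\<in>{a-\<eta>..a+\<eta>}. ennreal (norm (h (Complex x (b+\<eta>)) / (Complex x (b+\<eta>) - u))) \<partial>lborel) \<le> ennreal (2/d) * R (b+\<eta>)"
        "(\<integral>\<^sup>+y\<in>{b-\<eta>..b+\<eta>}. ennreal (norm (h (Complex (a-\<eta>) y) / (Complex (a-\<eta>) y - u))) \<partial>lborel) \<le> ennreal (2/d) * S (a-\<eta>)"
        "(\<integral>\<^sup>+y\<in>{b-\<eta>..b+\<eta>}. ennreal (norm (h (Complex (a+\<eta>) y) / (Complex (a+\<eta>) y - u))) \<partial>lborel) \<le> ennreal (2/d) * S (a+\<eta>)"
        by (rule 1 2, simp)+
    qed
    also have "norm (of_real (2 * pi) * \<i> * h u) = 2 * pi * norm (h u)" by (simp add: norm_mult)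
    finally show ?thesis by (simp add: distrib_left)
  qed
  have "ennreal (d/2 * (2 * pi * norm (h u))) = (\<integral>\<^sup>+\<eta>\<in>{d/2..d}. ennreal (2 * pi * norm (h u)) \<partial>lborel)"
    using \<open>0 < d\<close> by (subst nn_integral_cmult_indicator) (simp_all add: ennreal_mult'[symmetric] mult.commute)
  also have "\<dots> \<le> (\<integral>\<^sup>+\<eta>. ennreal (2/d) * (R (b - \<eta>) + R (b + \<eta>) + (S (a - \<eta>) + S (a + \<eta>))) \<partial>lborel)"
    by (rule nn_integral_mono) (use each in \<open>auto simp: indicator_def\<close>)
  also have "\<dots> = ennreal (2/d) * (4 * J)"
  proof -
    have "(2 + 2) * J = J + J + (J + J)" by (simp only: distrib_right mult_2)
    then show ?thesis by (simp add: nn_integral_cmult nn_integral_add shift)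
  qed
  \<comment> \<open>The kernel is at most \<open>2/d\<close> because the sides stay at distance at
    least \<open>d/2\<close> from the centre; four sides then give the constant 8/pi < 3.\<close>
  finally have "ennreal (d / pi) * ennreal (d/2 * (2 * pi * norm (h u))) \<le> ennreal (d/pi) * (ennreal (2/d) * (4 * J))"
    by (rule mult_left_mono) simp
  also have "\<dots> = ennreal (8 / pi) * J"
    using \<open>0 < d\<close> by (simp add: mult.assoc[symmetric] ennreal_mult'[symmetric] ennreal_numeral[symmetric] del: ennreal_numeral)
  also have "\<dots> \<le> 3 * J"
    using pi_gt3 by (intro mult_right_mono) (auto simp: ennreal_numeral[symmetric] field_simps simp del: ennreal_numeral)
  also have "ennreal (d / pi) * ennreal (d/2 * (2 * pi * norm (h u))) = ennreal (d^2 * norm (h u))"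
    using \<open>0 < d\<close> by (simp add: ennreal_mult'[symmetric] power2_eq_square)
  finally show ?thesis by (simp add: Jeq u_def)
qed

text \<open>Apply the mean value property at a point \<open>w\<close> where \<open>\<delta> w ^ 4 * norm (h w)\<close> is maximal, \<open>\<delta>\<close> being the
  distance to the boundary; one factor \<open>sqrt (norm h)\<close> is then absorbed by the maximum.\<close>

lemma square_mean_value_sqrt:
  fixes h :: "complex \<Rightarrow> complex"
  assumes hol: "h holomorphic_on cbox (Complex (a-d) (b-d)) (Complex (a+d) (b+d))" and "0 < d"
  shows "ennreal (d^2 * sqrt (norm (h (Complex a b)))) \<le>
    48 * (\<integral>\<^sup>+y\<in>{b-d..b+d}. (\<integral>\<^sup>+x\<in>{a-d..a+d}. ennreal (sqrt (norm (h (Complex x y)))) \<partial>lborel) \<partial>lborel)"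
proof -
  define u where "u = Complex a b"
  let ?C = "cbox (Complex (a-d) (b-d)) (Complex (a+d) (b+d))"
  have C: "z \<in> ?C \<longleftrightarrow> Re z \<in> {a-d..a+d} \<and> Im z \<in> {b-d..b+d}" for z
    by (auto simp: in_cbox_complex_iff)
  have hc: "continuous_on ?C h" using hol by (rule holomorphic_on_imp_continuous_on)
  \<comment> \<open>Distance to the boundary of the square in the sup norm. The fourth power below
    is dictated by scaling: its square root is the area scale \<open>\<delta> w ^ 2\<close>.\<close>
  define \<delta> where "\<delta> w = d - max \<bar>Re w - a\<bar> \<bar>Im w - b\<bar>" for w
  define I where "I = (\<integral>\<^sup>+y\<in>{b-d..b+d}. (\<integral>\<^sup>+x\<in>{a-d..a+d}. ennreal (sqrt (norm (h (Complex x y)))) \<partial>lborel) \<partial>lborel)"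
  have "\<exists>w\<in>?C. \<forall>z\<in>?C. \<delta> z ^ 4 * norm (h z) \<le> \<delta> w ^ 4 * norm (h w)"
  proof (rule continuous_attains_sup)
    have "u \<in> ?C" using \<open>0 < d\<close> by (simp add: C u_def)
    then show "?C \<noteq> {}" by blast
  qed (auto simp: \<delta>_def intro!: continuous_intros hc)
  then obtain w where w: "w \<in> ?C" and wmax: "\<And>z. z \<in> ?C \<Longrightarrow> \<delta> z ^ 4 * norm (h z) \<le> \<delta> w ^ 4 * norm (h w)" by blast
  define K where "K = \<delta> w ^ 4 * norm (h w)"
  have u: "d ^ 4 * norm (h u) \<le> K"
    using wmax[of u] \<open>0 < d\<close> by (simp add: C u_def \<delta>_def K_def)
  have "ennreal (sqrt K) \<le> 48 * I"
  proof (cases "K = 0")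
    case False
    have "0 \<le> \<delta> w" using w by (auto simp: C \<delta>_def abs_le_iff)
    with False have \<delta>: "0 < \<delta> w" by (cases "\<delta> w = 0") (auto simp: K_def)
    have K: "0 < K" using False \<delta> by (simp add: K_def zero_less_mult_iff)
    \<comment> \<open>On the square of half side \<open>e\<close> around \<open>w\<close> the
      distance to the boundary is still at least \<open>e\<close>, so maximality gives
      \<open>e^4 * norm (h z) \<le> K\<close>. This trades one factor
      \<open>sqrt (norm (h z))\<close> for \<open>sqrt K / e^2\<close>.\<close>
    define e where "e = \<delta> w / 2"
    have e: "0 < e" using \<delta> by (simp add: e_def)
    let ?D = "cbox (Complex (Re w-e) (Im w-e)) (Complex (Re w+e) (Im w+e))"
    have D: "z \<in> ?D \<longleftrightarrow> Re z \<in> {Re w-e..Re w+e} \<and> Im z \<in> {Im w-e..Im w+e}" for z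
      by (auto simp: in_cbox_complex_iff)
    have De: "z \<in> ?C" "e \<le> \<delta> z" if "z \<in> ?D" for z
    proof -
      have "\<bar>Re z - Re w\<bar> \<le> e" "\<bar>Im z - Im w\<bar> \<le> e" using that unfolding D by auto
      moreover have "max \<bar>Re w - a\<bar> \<bar>Im w - b\<bar> = d - 2 * e" by (simp add: e_def \<delta>_def field_simps)
      ultimately have *: "max \<bar>Re z - a\<bar> \<bar>Im z - b\<bar> \<le> d - e" by linarith
      then show "e \<le> \<delta> z" unfolding \<delta>_def by linarith
      from * e have "\<bar>Re z - a\<bar> \<le> d" "\<bar>Im z - b\<bar> \<le> d" by auto
      then show "z \<in> ?C" unfolding C by auto
    qed
    have bd: "norm (h z) \<le> sqrt K / e^2 * sqrt (norm (h z))" if "z \<in> ?D" for z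
    proof -
      have "e^4 * norm (h z) \<le> \<delta> z ^ 4 * norm (h z)"
        using De(2)[OF that] e by (intro mult_right_mono power_mono) auto
      also have "\<dots> \<le> K" unfolding K_def by (rule wmax) (rule De(1)[OF that])
      finally have "sqrt (e^4 * norm (h z)) \<le> sqrt K" by simp
      moreover have "sqrt (e^4) = e^2" using e by (metis abs_of_nonneg less_imp_le power2_eq_square power4_eq_xxxx real_sqrt_abs2 mult.assoc zero_le_power2)
      ultimately have "e^2 * sqrt (norm (h z)) \<le> sqrt K" by (simp add: real_sqrt_mult)
      then have "sqrt (norm (h z)) \<le> sqrt K / e^2" using e by (simp add: field_simps)
      then have "sqrt (norm (h z)) * sqrt (norm (h z)) \<le> sqrt K / e^2 * sqrt (norm (h z))"
        by (rule mult_right_mono) simp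
      then show ?thesis by simp
    qed
    have "ennreal (e^2 * norm (h w)) \<le>
      3 * (\<integral>\<^sup>+y\<in>{Im w-e..Im w+e}. (\<integral>\<^sup>+x\<in>{Re w-e..Re w+e}. ennreal (norm (h (Complex x y))) \<partial>lborel) \<partial>lborel)"
      using square_mean_value[of h "Re w" e "Im w"] holomorphic_on_subset[OF hol, of ?D] De e by auto
    also have "\<dots> \<le> 3 * (\<integral>\<^sup>+y\<in>{b-d..b+d}. ennreal (sqrt K / e^2) * (\<integral>\<^sup>+x\<in>{a-d..a+d}. ennreal (sqrt (norm (h (Complex x y)))) \<partial>lborel) \<partial>lborel)"
    proof (intro mult_left_mono nn_integral_mono)
      fix y
      show "(\<integral>\<^sup>+x\<in>{Re w-e..Re w+e}. ennreal (norm (h (Complex x y))) \<partial>lborel) * indicator {Im w-e..Im w+e} y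
        \<le> ennreal (sqrt K / e^2) * (\<integral>\<^sup>+x\<in>{a-d..a+d}. ennreal (sqrt (norm (h (Complex x y)))) \<partial>lborel) * indicator {b-d..b+d} y"
      proof (cases "y \<in> {Im w-e..Im w+e}")
        case True
        have "Complex (Re w) y \<in> ?D" using True e by (auto simp: D)
        from De(1)[OF this] have yb: "y \<in> {b-d..b+d}" by (auto simp: C)
        have m: "(\<lambda>x. ennreal (sqrt (norm (h (Complex x y)))) * indicator {a-d..a+d} x) \<in> borel_measurable lborel"
        proof -
          have "continuous_on {a-d..a+d} (\<lambda>x. h (Complex x y))"
          proof (rule continuous_on_compose2[OF hc])
            show "continuous_on {a-d..a+d} (\<lambda>x. Complex x y)" unfolding Complex_eq by (intro continuous_intros)
          qed (use yb in \<open>auto simp: C\<close>)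
          then have "(\<lambda>x. ennreal (sqrt (norm (h (Complex x y)))) * indicator {a-d..a+d} x) \<in> borel_measurable borel"
            by (intro borel_measurable_ennreal_indicator continuous_intros) auto
          then show ?thesis by simp
        qed
        have "(\<integral>\<^sup>+x\<in>{Re w-e..Re w+e}. ennreal (norm (h (Complex x y))) \<partial>lborel)
           \<le> (\<integral>\<^sup>+x. ennreal (sqrt K / e^2) * (ennreal (sqrt (norm (h (Complex x y)))) * indicator {a-d..a+d} x) \<partial>lborel)"
        proof (rule nn_integral_mono)
          fix x
          show "ennreal (norm (h (Complex x y))) * indicator {Re w-e..Re w+e} x
            \<le> ennreal (sqrt K / e^2) * (ennreal (sqrt (norm (h (Complex x y)))) * indicator {a-d..a+d} x)"
          proof (cases "x \<in> {Re w-e..Re w+e}")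
            case x: True
            then have z: "Complex x y \<in> ?D" using True by (auto simp: D)
            have "ennreal (norm (h (Complex x y))) \<le> ennreal (sqrt K / e^2 * sqrt (norm (h (Complex x y))))"
              using bd[OF z] by (rule ennreal_leI)
            also have "\<dots> = ennreal (sqrt K / e^2) * ennreal (sqrt (norm (h (Complex x y))))"
              using K by (intro ennreal_mult) auto
            finally show ?thesis using x De(1)[OF z] by (auto simp: C)
          qed simp
        qed
        also have "\<dots> = ennreal (sqrt K / e^2) * (\<integral>\<^sup>+x\<in>{a-d..a+d}. ennreal (sqrt (norm (h (Complex x y)))) \<partial>lborel)"
          by (rule nn_integral_cmult[OF m])
        finally show ?thesis using True yb by simp
      qed simp
    qed simp
    also have "\<dots> = 3 * (ennreal (sqrt K / e^2) * I)"
    proof -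
      define G where "G = (\<lambda>z::real\<times>real. indicator ({a-d..a+d} \<times> {b-d..b+d}) z *\<^sub>R h (Complex (fst z) (snd z)))"
      have [measurable]: "G \<in> borel_measurable (lborel \<Otimes>\<^sub>M lborel)"
        unfolding G_def by (rule cbox_indicator_measurable[OF hc])
      have "(\<lambda>y. \<integral>\<^sup>+x. ennreal (sqrt (norm (G (x, y)))) \<partial>lborel) \<in> borel_measurable borel" by measurable
      moreover have "(\<lambda>y. \<integral>\<^sup>+x. ennreal (sqrt (norm (G (x, y)))) \<partial>lborel) =
        (\<lambda>y. (\<integral>\<^sup>+x\<in>{a-d..a+d}. ennreal (sqrt (norm (h (Complex x y)))) \<partial>lborel) * indicator {b-d..b+d} y)"
      proof
        fix y
        show "(\<integral>\<^sup>+x. ennreal (sqrt (norm (G (x, y)))) \<partial>lborel) =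
           (\<integral>\<^sup>+x\<in>{a-d..a+d}. ennreal (sqrt (norm (h (Complex x y)))) \<partial>lborel) * indicator {b-d..b+d} y"
          by (cases "y \<in> {b-d..b+d}") (auto simp: G_def indicator_def intro!: nn_integral_cong)
      qed
      ultimately have m: "(\<lambda>y. (\<integral>\<^sup>+x\<in>{a-d..a+d}. ennreal (sqrt (norm (h (Complex x y)))) \<partial>lborel) * indicator {b-d..b+d} y) \<in> borel_measurable lborel"
        by (simp only: measurable_lborel2)
      show ?thesis unfolding I_def mult.assoc[of "ennreal (sqrt K / e^2)"] by (subst nn_integral_cmult[OF m]) simp
    qed
    finally have *: "ennreal (e^2 * norm (h w)) \<le> 3 * (ennreal (sqrt K / e^2) * I)" .
    \<comment> \<open>Inserted in the mean value inequality this reads K/16 <= 3 sqrt(K) I;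
      cancelling \<open>sqrt K\<close> leaves 48 = 3 * 16. The cancellation requires
      \<open>I\<close> to be finite, hence the case split.\<close>
    have nw: "norm (h w) = K / (2 * e)^4" using \<delta> by (simp add: K_def e_def)
    show ?thesis
    proof (cases I)
      case (real i)
      have "e^2 * (K / (2 * e)^4) \<le> 3 * (sqrt K / e^2 * i)"
      proof -
        have "ennreal (e^2 * (K / (2 * e)^4)) \<le> ennreal (3 * (sqrt K / e^2 * i))"
        proof -
          have "3 * (ennreal (sqrt K / e^2) * ennreal i) = ennreal (3 * (sqrt K / e^2 * i))"
            using real K by (subst ennreal_mult[symmetric], simp, simp, subst ennreal_mult'[of 3]) auto
          then show ?thesis using * unfolding nw real(2) by simp
        qed
        then show ?thesis using real K by (subst (asm) ennreal_le_iff) auto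
      qed
      then have "e^2 * (e^2 * (K / (2 * e)^4)) \<le> e^2 * (3 * (sqrt K / e^2 * i))" by (rule mult_left_mono) simp
      moreover have "e^2 * (e^2 * (K / (2 * e)^4)) = K / 16" using e by (simp add: power2_eq_square power4_eq_xxxx field_simps)
      moreover have "e^2 * (3 * (sqrt K / e^2 * i)) = 3 * sqrt K * i" using e by simp
      ultimately have "sqrt K * sqrt K \<le> sqrt K * (48 * i)" using K by simp
      then have "sqrt K \<le> 48 * i" using K by (subst (asm) mult_le_cancel_left_pos) auto
      then have "ennreal (sqrt K) \<le> ennreal (48 * i)" by (rule ennreal_leI)
      then show ?thesis using real by (simp add: ennreal_mult')
    qed (simp add: ennreal_mult_top)
  qed simp
  moreover have "d^2 * sqrt (norm (h u)) \<le> sqrt K"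
  proof -
    have "sqrt (d^4) = d^2" using \<open>0 < d\<close> by (metis abs_of_nonneg less_imp_le power2_eq_square power4_eq_xxxx real_sqrt_abs2 mult.assoc zero_le_power2)
    then show ?thesis using real_sqrt_le_mono[OF u] by (simp add: real_sqrt_mult)
  qed
  ultimately show ?thesis unfolding u_def[symmetric] I_def[symmetric]
    using ennreal_leI order_trans by blast
qed

section \<open>The dyadic maximal function\<close>

definition avg :: "(real \<Rightarrow> real) \<Rightarrow> real \<Rightarrow> real \<Rightarrow> real" where
  "avg H a l = (LINT x:{a..<a+l}|lborel. H x) / l"

text \<open>The dyadic maximal function truncated at generation \<open>k\<close>. The accumulator
  \<open>m\<close> is the running maximum over the ancestors of the current cell; carrying it as an
  argument lets the Bellman induction restart on each half from an arbitrary value.\<close>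

fun dyadic_max :: "nat \<Rightarrow> (real \<Rightarrow> real) \<Rightarrow> real \<Rightarrow> real \<Rightarrow> real \<Rightarrow> real \<Rightarrow> real" where
  "dyadic_max 0 H a l m t = max m (avg H a l)"
| "dyadic_max (Suc k) H a l m t =
     (if t < a + l/2 then dyadic_max k H a (l/2) (max m (avg H a l)) t
      else dyadic_max k H (a + l/2) (l/2) (max m (avg H a l)) t)"

lemma dyadic_max_measurable[measurable]: "dyadic_max k H a l m \<in> borel_measurable borel"
proof (induction k arbitrary: a l m)
  case (Suc k)
  have "dyadic_max (Suc k) H a l m = (\<lambda>t. if t < a + l/2 then dyadic_max k H a (l/2) (max m (avg H a l)) t
      else dyadic_max k H (a + l/2) (l/2) (max m (avg H a l)) t)" by auto
  moreover note Suc.IH[of a "l/2" "max m (avg H a l)", measurable] Suc.IH[of "a+l/2" "l/2" "max m (avg H a l)", measurable]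
  ultimately show ?case by simp
next
  case 0
  have "dyadic_max 0 H a l m = (\<lambda>t. max m (avg H a l))" by auto
  then show ?case by simp
qed

lemma dyadic_max_ge: "m \<le> dyadic_max k H a l m t"
proof (induction k arbitrary: a l m)
  case (Suc k)
  from Suc.IH[of "max m (avg H a l)" a "l/2"] Suc.IH[of "max m (avg H a l)" "a+l/2" "l/2"]
  show ?case by auto
qed simp

lemma dyadic_max_Suc: "dyadic_max k H a l m t \<le> dyadic_max (Suc k) H a l m t"
proof (induction k arbitrary: a l m)
  case 0
  show ?case by (auto simp del: max.bounded_iff)
next
  case (Suc k)
  from Suc.IH[of a "l/2" "max m (avg H a l)"] Suc.IH[of "a+l/2" "l/2" "max m (avg H a l)"]
  show ?case by auto
qed

text \<open>Descend to the half that contains the cell; in the right half the cells of the left one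
  are skipped, hence the shift of the index by \<open>2^k\<close>.\<close>

lemma dyadic_max_ge_avg:
  assumes "j < 2^k" "a + real j * l / 2^k \<le> t" "t < a + real (Suc j) * l / 2^k" "0 < l"
  shows "avg H (a + real j * l / 2^k) (l / 2^k) \<le> dyadic_max k H a l m t"
  using assms
proof (induction k arbitrary: a l m j)
  case 0
  then show ?case by simp
next
  case (Suc k)
  show ?case
  proof (cases "j < 2^k")
    case True
    have "real (Suc j) * l \<le> 2^k * l"
      using True \<open>0 < l\<close> by (intro mult_right_mono) (simp_all flip: of_nat_Suc)
    then have "real (Suc j) * l / 2^Suc k \<le> l / 2"
      by (simp add: field_simps)
    then have "t < a + l/2" using Suc.prems(3) by linarith
    moreover have "avg H (a + real j * (l/2) / 2^k) (l/2/2^k) \<le> dyadic_max k H a (l/2) (max m (avg H a l)) t"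
      by (rule Suc.IH) (use Suc.prems True in auto)
    ultimately show ?thesis by simp
  next
    case False
    define i where "i = j - 2^k"
    have j: "j = i + 2^k" using False by (simp add: i_def)
    have e: "a + real j * l / 2^Suc k = a + l/2 + real i * (l/2) / 2^k"
      "a + real (Suc j) * l / 2^Suc k = a + l/2 + real (Suc i) * (l/2) / 2^k"
      by (simp_all add: j field_simps)
    have "a + l/2 \<le> t" 
      using Suc.prems(2) \<open>0 < l\<close> unfolding e(1) by (smt (verit) divide_nonneg_nonneg mult_nonneg_nonneg of_nat_0_le_iff zero_le_power)
    moreover have "avg H (a + l/2 + real i * (l/2) / 2^k) (l/2/2^k) \<le> dyadic_max k H (a+l/2) (l/2) (max m (avg H a l)) t"
      by (rule Suc.IH) (use Suc.prems(1) Suc.prems(2,3)[unfolded e] \<open>0 < l\<close> j in auto)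
    ultimately show ?thesis unfolding e(1) by (simp del: of_nat_Suc)
  qed
qed

lemma set_integrable_const_bounded:
  fixes c :: real
  shows "emeasure M S < \<infinity> \<Longrightarrow> S \<in> sets M \<Longrightarrow> set_integrable M S (\<lambda>x. c)"
  unfolding set_integrable_def by (simp add: integrable_real_indicator)

lemma set_nn_integral_eq_ennreal:
  fixes g :: "real \<Rightarrow> real"
  assumes "set_integrable M S g" "\<And>x. 0 \<le> g x"
  shows "(\<integral>\<^sup>+x\<in>S. ennreal (g x) \<partial>M) = ennreal (LINT x:S|M. g x)"
proof -
  have "(\<integral>\<^sup>+x\<in>S. ennreal (g x) \<partial>M) = (\<integral>\<^sup>+x. ennreal (indicator S x *\<^sub>R g x) \<partial>M)"
    by (intro nn_integral_cong) (auto simp: indicator_def)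
  also have "\<dots> = ennreal (LINT x:S|M. g x)"
    unfolding set_lebesgue_integral_def
    by (rule nn_integral_eq_integral) (use assms in \<open>auto simp: set_integrable_def\<close>)
  finally show ?thesis .
qed

text \<open>Cauchy-Schwarz on an interval, read off from the nonnegativity of the variance of
  \<open>H\<close>.\<close>

lemma set_integral_power2_ge:
  fixes H :: "real \<Rightarrow> real"
  assumes I: "set_integrable lborel {a..<a+l} H" "set_integrable lborel {a..<a+l} (\<lambda>x. (H x)^2)" and "0 < l"
  shows "(LINT x:{a..<a+l}|lborel. H x)^2 \<le> l * (LINT x:{a..<a+l}|lborel. (H x)^2)"
proof -
  define X where "X = (LINT x:{a..<a+l}|lborel. H x)"
  have c: "set_integrable lborel {a..<a+l} (\<lambda>x. c)" for c :: real by (rule set_integrable_const_bounded) (use \<open>0 < l\<close> in auto)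
  have "0 \<le> (LINT x:{a..<a+l}|lborel. (H x - X/l)^2)"
    unfolding set_lebesgue_integral_def by (rule Bochner_Integration.integral_nonneg) auto
  also have "\<dots> = (LINT x:{a..<a+l}|lborel. (H x)^2 - (2*X/l) * H x + (X/l)^2)"
    by (simp add: power2_diff algebra_simps)
  also have "\<dots> = (LINT x:{a..<a+l}|lborel. (H x)^2) - (2*X/l) * X + l * (X/l)^2"
    using assms by (simp add: set_integral_add set_integral_diff c X_def set_integral_const)
  finally have "0 \<le> l * ((LINT x:{a..<a+l}|lborel. (H x)^2) - (2*X/l) * X + l * (X/l)^2)"
    using \<open>0 < l\<close> by simp
  also have "\<dots> = l * (LINT x:{a..<a+l}|lborel. (H x)^2) - X^2"
    using \<open>0 < l\<close> by (simp add: field_simps power2_eq_square)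
  finally show ?thesis by (simp add: X_def)
qed

text \<open>\<open>4 y - 4 m x + 2 m\<^sup>2\<close> is a Bellman function for the maximal inequality: \<open>x\<close> and \<open>y\<close> are
  the averages of \<open>H\<close> and \<open>H\<^sup>2\<close> over the current interval and \<open>m\<close> is the running maximum.\<close>

lemma dyadic_max_bellman:
  assumes "set_integrable lborel {a..<a+l} H" "set_integrable lborel {a..<a+l} (\<lambda>x. (H x)^2)"
    and "0 < l" "0 \<le> m"
  shows "set_integrable lborel {a..<a+l} (\<lambda>t. (dyadic_max k H a l m t)^2) \<and>
    (LINT t:{a..<a+l}|lborel. (dyadic_max k H a l m t)^2)
     \<le> 4 * (LINT x:{a..<a+l}|lborel. (H x)^2) + 2 * l * m^2 - 4 * m * (LINT x:{a..<a+l}|lborel. H x)"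
  using assms
proof (induction k arbitrary: a l m)
  case (0 a l m)
  define X where "X = (LINT x:{a..<a+l}|lborel. H x)"
  define Y where "Y = (LINT x:{a..<a+l}|lborel. (H x)^2)"
  define c where "c = max m (X/l)"
  have XY: "X^2 \<le> l * Y" unfolding X_def Y_def by (rule set_integral_power2_ge) fact+
  \<comment> \<open>At a leaf the maximal function is the constant \<open>c\<close>, and the Bellman
    function dominates \<open>l * c^2\<close> because the difference is this square divided by
    \<open>l\<close>, once \<open>X^2 \<le> l * Y\<close> is used.\<close>
  have "0 \<le> (l * c - 2 * X)^2" by simp
  then have "l * (4 * c * X - l*c^2) \<le> l * (4 * Y)" using XY by (simp add: power2_eq_square algebra_simps)
  then have 1: "4 * c * X - l*c^2 \<le> 4 * Y" using \<open>0 < l\<close> by simp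
  \<comment> \<open>Raising the running maximum from \<open>m\<close> to the current average does
    not increase the Bellman function: it drops by exactly \<open>2 * l * (m - c)^2\<close>.\<close>
  have 2: "2 * l * c^2 - 4 * c * X \<le> 2 * l * m^2 - 4 * m * X"
  proof (cases "X/l \<le> m")
    case False
    then have c: "c = X/l" by (simp add: c_def)
    have X: "X = c * l" using \<open>0 < l\<close> c by simp
    have "0 \<le> 2 * l * (m - c)^2" using \<open>0 < l\<close> by simp
    then show ?thesis unfolding X by (simp add: power2_eq_square algebra_simps)
  qed (simp add: c_def)
  have "(LINT t:{a..<a+l}|lborel. (dyadic_max 0 H a l m t)^2) = l * c^2"
    using \<open>0 < l\<close> by (simp add: avg_def c_def X_def set_integral_const)
  moreover have "set_integrable lborel {a..<a+l} (\<lambda>t. (dyadic_max 0 H a l m t)^2)"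
    unfolding dyadic_max.simps by (rule set_integrable_const_bounded) (use \<open>0 < l\<close> in auto)
  ultimately show ?case using 1 2 by (simp add: X_def Y_def)
next
  case (Suc k a l m)
  define X where "X = (LINT x:{a..<a+l}|lborel. H x)"
  define c where "c = max m (avg H a l)"
  have sp: "{a..<a+l} = {a..<a+l/2} \<union> {a+l/2..<a+l/2+l/2}" and dj: "{a..<a+l/2} \<inter> {a+l/2..<a+l/2+l/2} = {}"
    using \<open>0 < l\<close> by auto
  have i1: "set_integrable lborel {a..<a+l/2} g" "set_integrable lborel {a+l/2..<a+l/2+l/2} g" 
    if "set_integrable lborel {a..<a+l} g" for g :: "real \<Rightarrow> real"
    by (rule set_integrable_subset[OF that]; use \<open>0 < l\<close> in auto)+
  have i2: "(LINT x:{a..<a+l}|lborel. g x) = (LINT x:{a..<a+l/2}|lborel. g x) + (LINT x:{a+l/2..<a+l/2+l/2}|lborel. g x)"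
    if "set_integrable lborel {a..<a+l} g" for g :: "real \<Rightarrow> real"
    unfolding sp by (rule set_integral_Un[OF dj]) (use i1[OF that] in auto)
  have c: "0 \<le> c" using Suc.prems by (simp add: c_def)
  \<comment> \<open>Both halves start from the same running maximum \<open>c\<close>. For fixed
    \<open>c\<close> the bound is linear in the length and in the integrals of \<open>H\<close> and
    its square, so the two inductive estimates add up to the one for the whole interval.\<close>
  note ih1 = Suc.IH[OF i1(1)[OF Suc.prems(1)] i1(1)[OF Suc.prems(2)] _ c]
  note ih2 = Suc.IH[OF i1(2)[OF Suc.prems(1)] i1(2)[OF Suc.prems(2)] _ c]
  define g where "g = (\<lambda>t. (dyadic_max (Suc k) H a l m t)^2)"
  have g1: "\<And>t. t \<in> {a..<a+l/2} \<Longrightarrow> g t = (dyadic_max k H a (l/2) c t)^2"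
    by (auto simp: g_def c_def)
  have g2: "\<And>t. t \<in> {a+l/2..<a+l/2+l/2} \<Longrightarrow> g t = (dyadic_max k H (a+l/2) (l/2) c t)^2"
    by (auto simp: g_def c_def)
  have s1: "set_integrable lborel {a..<a+l/2} g"
    using ih1 \<open>0 < l\<close> by (subst set_integrable_cong[OF refl refl g1]) auto
  have s2: "set_integrable lborel {a+l/2..<a+l/2+l/2} g"
    using ih2 \<open>0 < l\<close> by (subst set_integrable_cong[OF refl refl g2]) auto
  have s: "set_integrable lborel {a..<a+l} g"
    unfolding sp by (rule set_integrable_Un[OF s1 s2]) auto
  have 2: "2 * l * c^2 - 4 * c * X \<le> 2 * l * m^2 - 4 * m * X"
  proof (cases "X/l \<le> m")
    case False
    then have c: "c = X/l" by (simp add: c_def avg_def X_def)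
    have X: "X = c * l" using \<open>0 < l\<close> c by simp
    have "0 \<le> 2 * l * (m - c)^2" using \<open>0 < l\<close> by simp
    then show ?thesis unfolding X by (simp add: power2_eq_square algebra_simps)
  qed (simp add: c_def avg_def X_def)
  have "(LINT t:{a..<a+l}|lborel. g t) = (LINT t:{a..<a+l/2}|lborel. (dyadic_max k H a (l/2) c t)^2)
     + (LINT t:{a+l/2..<a+l/2+l/2}|lborel. (dyadic_max k H (a+l/2) (l/2) c t)^2)"
    unfolding i2[OF s] using g1 g2 by (intro arg_cong2[where f="(+)"] set_lebesgue_integral_cong) auto
  also have "\<dots> \<le> 4 * (LINT x:{a..<a+l}|lborel. (H x)^2) + 2 * l * c^2 - 4 * c * X"
    using ih1 ih2 \<open>0 < l\<close> unfolding X_def i2[OF Suc.prems(1)] i2[OF Suc.prems(2)]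
    by (simp add: algebra_simps)
  finally show ?case using s 2 unfolding g_def X_def by linarith
qed


text \<open>With the running maximum started at \<open>0\<close>, only the \<open>H^2\<close> term
  of the Bellman bound survives. It does not depend on \<open>k\<close>, so monotone convergence in
  the depth applies.\<close>

lemma dyadic_max_norm:
  assumes H: "set_integrable lborel {a..<a+l} H" "set_integrable lborel {a..<a+l} (\<lambda>x. (H x)^2)" and "0 < l"
  shows "(\<integral>\<^sup>+t\<in>{a..<a+l}. (SUP k. ennreal ((dyadic_max k H a l 0 t)^2)) \<partial>lborel) \<le> 4 * (\<integral>\<^sup>+x\<in>{a..<a+l}. ennreal ((H x)^2) \<partial>lborel)"
proof -
  have le: "(\<integral>\<^sup>+t\<in>{a..<a+l}. ennreal ((dyadic_max k H a l 0 t)^2) \<partial>lborel) \<le> 4 * (\<integral>\<^sup>+x\<in>{a..<a+l}. ennreal ((H x)^2) \<partial>lborel)" for k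
  proof -
    note b = dyadic_max_bellman[OF H \<open>0 < l\<close> order_refl, of k]
    have "(\<integral>\<^sup>+t\<in>{a..<a+l}. ennreal ((dyadic_max k H a l 0 t)^2) \<partial>lborel) = ennreal (LINT t:{a..<a+l}|lborel. (dyadic_max k H a l 0 t)^2)"
      by (rule set_nn_integral_eq_ennreal) (use b in auto)
    also have "\<dots> \<le> ennreal (4 * (LINT x:{a..<a+l}|lborel. (H x)^2))"
      using b by (intro ennreal_leI) auto
    also have "\<dots> = 4 * ennreal (LINT x:{a..<a+l}|lborel. (H x)^2)"
      by (simp add: ennreal_mult' )
    also have "ennreal (LINT x:{a..<a+l}|lborel. (H x)^2) = (\<integral>\<^sup>+x\<in>{a..<a+l}. ennreal ((H x)^2) \<partial>lborel)"
      by (rule set_nn_integral_eq_ennreal[symmetric]) (use H in auto)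
    finally show ?thesis .
  qed
  have "(\<integral>\<^sup>+t\<in>{a..<a+l}. (SUP k. ennreal ((dyadic_max k H a l 0 t)^2)) \<partial>lborel)
    = (\<integral>\<^sup>+t. (SUP k. ennreal ((dyadic_max k H a l 0 t)^2) * indicator {a..<a+l} t) \<partial>lborel)"
    by (simp add: SUP_mult_right_ennreal)
  also have "\<dots> = (SUP k. (\<integral>\<^sup>+t\<in>{a..<a+l}. ennreal ((dyadic_max k H a l 0 t)^2) \<partial>lborel))"
  proof (rule nn_integral_monotone_convergence_SUP)
    show "incseq (\<lambda>k t. ennreal ((dyadic_max k H a l 0 t)\<^sup>2) * indicator {a..<a + l} t)"
      by (intro incseq_SucI le_funI mult_right_mono ennreal_leI power_mono dyadic_max_Suc dyadic_max_ge) auto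
  qed measurable
  also have "\<dots> \<le> 4 * (\<integral>\<^sup>+x\<in>{a..<a+l}. ennreal ((H x)^2) \<partial>lborel)"
    by (rule SUP_least) (rule le)
  finally show ?thesis .
qed

section \<open>From dyadic cells to arbitrary intervals\<close>

text \<open>At every scale the endpoints of the two grids are at least a third of an interval apart,
  since \<open>3\<close> does not divide \<open>2 ^ n\<close>.\<close>

lemma dyadic_third_trick:
  assumes "-8 \<le> u" "u < v" "v \<le> 8" "v - u \<le> 8 / 2^n"
  obtains j where "j < 2^n" "-16 + real j * 24 / 2^n \<le> u" "v \<le> -16 + real (Suc j) * 24 / 2^n"
  | j where "j < 2^n" "-8 + real j * 24 / 2^n \<le> u" "v \<le> -8 + real (Suc j) * 24 / 2^n"
proof -
  define d :: real where "d = 24 / 2^n"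
  have d: "d > 0" by (simp add: d_def)
  have vu: "v - u \<le> d / 3" using assms(4) by (simp add: d_def)
  \<comment> \<open>The grids live on [-16, 8] and [-8, 16]; both contain [-8, 8], and the offset 8
    is a third of the length 24.\<close>
  define j1 where "j1 = \<lfloor>(u + 16) / d\<rfloor>"
  define j2 where "j2 = \<lfloor>(u + 8) / d\<rfloor>"
  have b1: "of_int j1 * d \<le> u + 16" "u + 16 < (of_int j1 + 1) * d"
    using d floor_divide_lower[of d "u+16"] floor_divide_upper[of d "u+16"] by (simp_all add: j1_def)
  have b2: "of_int j2 * d \<le> u + 8" "u + 8 < (of_int j2 + 1) * d"
    using d floor_divide_lower[of d "u+8"] floor_divide_upper[of d "u+8"] by (simp_all add: j2_def)
  have p: "0 \<le> j1" "0 \<le> j2" using assms d by (auto simp: j1_def j2_def)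
  have nd: "2^n * d = 24" by (simp add: d_def)
  have lt: "j1 < 2^n" "j2 < 2^n"
  proof -
    have "of_int j1 * d < 2^n * d" "of_int j2 * d < 2^n * d"
      using b1 b2 assms nd by linarith+
    then have "real_of_int j1 < real_of_int (2^n)" "real_of_int j2 < real_of_int (2^n)" using d by auto
    then show "j1 < 2^n" "j2 < 2^n" by linarith+
  qed
  have "v \<le> -16 + (of_int j1 + 1) * d \<or> v \<le> -8 + (of_int j2 + 1) * d"
  \<comment> \<open>If both cells failed to reach \<open>v\<close>, their right endpoints would both
    lie between \<open>u\<close> and \<open>v\<close>, at distance less than \<open>d/3\<close>.
    That distance is an integer multiple of \<open>d/3\<close>, so the integer \<open>Z\<close>
    vanishes and 3 divides a power of 2.\<close>
  proof (rule ccontr)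
    assume "\<not> ?thesis"
    moreover define E1 where "E1 = (of_int j1 + 1) * d"
    moreover define E2 where "E2 = (of_int j2 + 1) * d"
    ultimately have "-16 + E1 < v" "-8 + E2 < v" "u + 16 < E1" "u + 8 < E2" using b1 b2 by auto
    with vu have 1: "\<bar>(-16 + E1) - (-8 + E2)\<bar> < d / 3"
      by linarith
    define Z where "Z = 3 * (j1 - j2) - 2^n"
    have eq: "(-16 + E1) - (-8 + E2) = of_int Z * (d/3)"
      by (simp add: Z_def d_def E1_def E2_def field_simps)
    have "\<bar>real_of_int Z\<bar> * (d/3) < 1 * (d/3)"
      using 1 d unfolding eq abs_mult by simp
    then have "\<bar>real_of_int Z\<bar> < 1" using d by (simp only: mult_less_cancel_right_disj) auto
    then have "3 * (j1 - j2) - 2^n = 0" unfolding Z_def by linarith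
    then have "3 dvd (2::int)^n" by (metis dvd_triv_left eq_iff_diff_eq_0)
    moreover have "coprime (3::int) (2^n)" by simp
    ultimately have "is_unit (3::int)" using coprime_common_divisor[of "3::int" "2^n" 3] by simp
    then show False by simp
  qed
  then show ?thesis
  proof
    assume *: "v \<le> -16 + (of_int j1 + 1) * d"
    show ?thesis
    proof (rule that(1)[of "nat j1"])
      have e: "real (nat j1) = of_int j1" using p by simp
      show "nat j1 < 2^n" using lt p by (simp add: nat_less_iff)
      show "- 16 + real (nat j1) * 24 / 2 ^ n \<le> u" "v \<le> - 16 + real (Suc (nat j1)) * 24 / 2 ^ n"
        using b1 * by (simp_all add: e of_nat_Suc d_def add.commute)
    qed
  next
    assume *: "v \<le> -8 + (of_int j2 + 1) * d"
    show ?thesis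
    proof (rule that(2)[of "nat j2"])
      have e: "real (nat j2) = of_int j2" using p by simp
      show "nat j2 < 2^n" using lt p by (simp add: nat_less_iff)
      show "- 8 + real (nat j2) * 24 / 2 ^ n \<le> u" "v \<le> - 8 + real (Suc (nat j2)) * 24 / 2 ^ n"
        using b2 * by (simp_all add: e of_nat_Suc d_def add.commute)
    qed
  qed
qed

lemma ex_dyadic_scale:
  fixes y :: real assumes "0 < y" "y \<le> 4"
  obtains n where "y \<le> 8 / 2^n" "4 / 2^n < y"
proof -
  define P where "P = (\<lambda>n::nat. 4 / 2^n < y)"
  obtain n0 where "(1/2)^n0 < y / 4" using assms real_arch_pow_inv[of "y/4" "1/2"] by auto
  then have ex: "P n0" by (simp add: P_def power_one_over field_simps)
  define n where "n = (LEAST n. P n)"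
  have 1: "P n" unfolding n_def by (rule LeastI) (rule ex)
  have "n \<noteq> 0"
  proof
    assume "n = 0"
    with 1 assms show False by (simp add: P_def)
  qed
  then have "\<not> P (n - 1)" unfolding n_def by (intro not_less_Least) (use \<open>n \<noteq> 0\<close> in \<open>simp add: n_def[symmetric]\<close>)
  then have "y \<le> 8 / 2^n" using \<open>n \<noteq> 0\<close> by (cases n) (auto simp: P_def field_simps)
  then show ?thesis using 1 that by (auto simp: P_def)
qed

text \<open>An interval of length \<open>2 * x\<close> fits in a cell of one of the two grids of
  length at most \<open>12 * x\<close>, so its integral over \<open>x\<close> is at most 12 times a
  dyadic average. \<open>W\<close> adds the squares for both grids: 144 = 12^2 and 1152 = 144 * (4 +
  4). A single measurable majorant replaces the supremum over all intervals. The window [-8, 8)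
  contains [0, 2 pi] with a margin larger than 1/2, the largest \<open>x\<close> that will be
  used.\<close>

theorem maximal_function_L2:
  fixes H :: "real \<Rightarrow> real"
  assumes nn: "\<And>x. 0 \<le> H x" and H: "integrable lborel H" "integrable lborel (\<lambda>x. (H x)^2)"
  obtains W :: "real \<Rightarrow> ennreal" where "W \<in> borel_measurable borel"
    "(\<integral>\<^sup>+t\<in>{-8..<8}. W t \<partial>lborel) \<le> 1152 * (\<integral>\<^sup>+x. ennreal ((H x)^2) \<partial>lborel)"
    "\<And>t x. 0 < x \<Longrightarrow> x \<le> 2 \<Longrightarrow> -8 \<le> t - x \<Longrightarrow> t + x \<le> 8 \<Longrightarrow>
       ennreal (((LINT \<theta>:{t-x..<t+x}|lborel. H \<theta>) / x)^2) \<le> W t"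
proof -
  define V where "V a t = (SUP k. ennreal ((dyadic_max k H a 24 0 t)^2))" for a t
  have Vm[measurable]: "V a \<in> borel_measurable borel" for a unfolding V_def by measurable
  have si: "set_integrable lborel S H" "set_integrable lborel S (\<lambda>x. (H x)^2)" if "S \<in> sets lborel" for S
    using H that by (auto simp: set_integrable_def integrable_mult_indicator simp del: real_scaleR_def)
  define Y where "Y = (\<integral>\<^sup>+x. ennreal ((H x)^2) \<partial>lborel)"
  have Vi: "(\<integral>\<^sup>+t\<in>{a..<a+24}. V a t \<partial>lborel) \<le> 4 * Y" for a
  proof -
    have "(\<integral>\<^sup>+t\<in>{a..<a+24}. V a t \<partial>lborel) \<le> 4 * (\<integral>\<^sup>+x\<in>{a..<a+24}. ennreal ((H x)^2) \<partial>lborel)"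
      unfolding V_def by (rule dyadic_max_norm) (auto intro: si)
    also have "(\<integral>\<^sup>+x\<in>{a..<a+24}. ennreal ((H x)^2) \<partial>lborel) \<le> Y"
      unfolding Y_def by (intro nn_integral_mono) (auto simp: indicator_def)
    finally show ?thesis by (simp add: mult_left_mono)
  qed
  define W where "W t = 144 * (V (-16) t + V (-8) t)" for t
  show ?thesis
  proof (rule that[of W])
    show "W \<in> borel_measurable borel" unfolding W_def by measurable
    have "(\<integral>\<^sup>+t\<in>{-8..<8}. W t \<partial>lborel) \<le> (\<integral>\<^sup>+t. 144 * (V (-16) t * indicator {-16..<-16+24} t + V (-8) t * indicator {-8..<-8+24} t) \<partial>lborel)"
      unfolding W_def by (intro nn_integral_mono) (auto simp: indicator_def)
    also have "\<dots> = 144 * ((\<integral>\<^sup>+t\<in>{-16..<-16+24}. V (-16) t \<partial>lborel) + (\<integral>\<^sup>+t\<in>{-8..<-8+24}. V (-8) t \<partial>lborel))"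
      by (subst nn_integral_cmult, measurable, subst nn_integral_add) measurable
    also have "\<dots> \<le> 144 * (4 * Y + 4 * Y)" by (intro mult_left_mono add_mono Vi) auto
    also have "\<dots> = 1152 * Y" by (simp add: distrib_right[symmetric] mult.assoc[symmetric])
    finally show "(\<integral>\<^sup>+t\<in>{-8..<8}. W t \<partial>lborel) \<le> 1152 * (\<integral>\<^sup>+x. ennreal ((H x)^2) \<partial>lborel)"
      by (simp add: Y_def)
  next
    fix t x :: real assume x: "0 < x" "x \<le> 2" "-8 \<le> t - x" "t + x \<le> 8"
    define X where "X = (LINT \<theta>:{t-x..<t+x}|lborel. H \<theta>)"
    have X0: "0 \<le> X" unfolding X_def set_lebesgue_integral_def by (rule Bochner_Integration.integral_nonneg) (auto simp: nn)
    obtain n where n: "2 * x \<le> 8 / 2^n" "4 / 2^n < 2 * x" using ex_dyadic_scale[of "2*x"] x by auto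
    have key: "ennreal ((X / x)^2) \<le> 144 * V a t"
      if j: "j < 2^n" "a + real j * 24 / 2^n \<le> t - x" "t + x \<le> a + real (Suc j) * 24 / 2^n" for a j
    proof -
      define J where "J = {a + real j * 24 / 2^n..<a + real j * 24 / 2^n + 24 / 2^n}"
      have "real (Suc j) * 24 / 2^n = real j * 24 / 2^n + 24 / 2^n"
        by (simp add: add_divide_distrib distrib_right)
      then have sub: "{t-x..<t+x} \<subseteq> J" using j by (auto simp: J_def)
      have "X \<le> (LINT \<theta>:J|lborel. H \<theta>)"
        unfolding X_def set_lebesgue_integral_def
      proof (rule integral_mono)
        show "indicator {t-x..<t+x} y *\<^sub>R H y \<le> indicator J y *\<^sub>R H y" for y
          using sub nn by (auto simp: indicator_def)
      qed (use si in \<open>auto simp: set_integrable_def J_def\<close>)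
      also have "\<dots> = avg H (a + real j * 24 / 2^n) (24 / 2^n) * (24 / 2^n)"
        by (simp add: avg_def J_def)
      finally have X: "X \<le> avg H (a + real j * 24 / 2^n) (24 / 2^n) * (24 / 2^n)" .
      with X0 have "0 \<le> avg H (a + real j * 24 / 2^n) (24 / 2^n)"
        by (smt (verit) divide_pos_pos mult_less_0_iff zero_less_power)
      then have "avg H (a + real j * 24 / 2^n) (24 / 2^n) * (24 / 2^n) \<le> avg H (a + real j * 24 / 2^n) (24 / 2^n) * (12 * x)"
        using n by (intro mult_left_mono) auto
      with X have "X \<le> avg H (a + real j * 24 / 2^n) (24 / 2^n) * (12 * x)" by (rule order_trans)
      then have "X / x \<le> 12 * avg H (a + real j * 24 / 2^n) (24 / 2^n)"
        using x by (simp add: pos_divide_le_eq mult_ac)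
      also have "avg H (a + real j * 24 / 2^n) (24 / 2^n) \<le> dyadic_max n H a 24 0 t"
        by (rule dyadic_max_ge_avg) (use j x in auto)
      finally have "(X / x)^2 \<le> (12 * dyadic_max n H a 24 0 t)^2"
        using X0 x by (intro power_mono) auto
      then have "ennreal ((X / x)^2) \<le> ennreal (144 * (dyadic_max n H a 24 0 t)^2)"
        by (intro ennreal_leI) (simp add: power_mult_distrib)
      also have "\<dots> = 144 * ennreal ((dyadic_max n H a 24 0 t)^2)" by (simp add: ennreal_mult')
      also have "\<dots> \<le> 144 * V a t" unfolding V_def by (intro mult_left_mono SUP_upper) auto
      finally show ?thesis .
    qed
    show "ennreal ((X / x)^2) \<le> W t" 
      unfolding W_def distrib_left
    proof (rule dyadic_third_trick[of "t-x" "t+x" n])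
      show "t + x - (t - x) \<le> 8 / 2^n" using n by simp
    qed (use x key in \<open>auto intro: add_increasing add_increasing2\<close>)
  qed
qed

section \<open>Radial norms\<close>

lemma epowr_ennreal: "0 \<le> x \<Longrightarrow> ennreal x epowr a = ennreal (x powr a)"
  by (simp add: epowr_def)

lemma epowr_top [simp]: "top epowr a = top" by (simp add: epowr_def)

lemma epowr_epowr: "(x epowr a) epowr b = x epowr (a * b)"
  by (simp add: epowr_def powr_powr)

lemma epowr_mono: "x \<le> y \<Longrightarrow> 0 \<le> a \<Longrightarrow> x epowr a \<le> y epowr a"
  by (auto simp: epowr_def top_unique intro!: ennreal_leI powr_mono2 enn2real_mono)
     (simp add: less_top)

lemma epowr_less_top_iff [simp]: "x epowr a < \<infinity> \<longleftrightarrow> x < \<infinity>" "x epowr a < top \<longleftrightarrow> x < top"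
  by (auto simp: epowr_def less_top[symmetric])

lemma epowr_measurable [measurable]:
  assumes [measurable]: "f \<in> borel_measurable M"
  shows "(\<lambda>x. f x epowr a) \<in> borel_measurable M"
  unfolding epowr_def by measurable

lemma epowr_le_ennreal_iff:
  assumes "0 < a" "0 \<le> B"
  shows "x epowr (1/a) \<le> ennreal B \<longleftrightarrow> x \<le> ennreal (B powr a)"
proof
  assume "x epowr (1/a) \<le> ennreal B"
  then have "(x epowr (1/a)) epowr a \<le> ennreal B epowr a" using assms by (intro epowr_mono) auto
  then show "x \<le> ennreal (B powr a)" using assms by (cases x) (auto simp: epowr_ennreal powr_powr)
next
  assume "x \<le> ennreal (B powr a)"
  then have "x epowr (1/a) \<le> ennreal (B powr a) epowr (1/a)" using assms by (intro epowr_mono) auto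
  then show "x epowr (1/a) \<le> ennreal B" using assms by (simp add: epowr_ennreal powr_powr)
qed

definition ray :: "(complex \<Rightarrow> complex) \<Rightarrow> real \<Rightarrow> real \<Rightarrow> real" where
  "ray f t r = norm (f (of_real r * exp (\<i> * of_real t)))"

lemma ray_nonneg [simp]: "0 \<le> ray f t r" by (simp add: ray_def)

lemma radial_int_ray: "radial_int P f t = (\<integral>\<^sup>+ r\<in>{0..<1}. ennreal (ray f t r powr P) \<partial>lborel)"
  by (simp add: radial_int_def ray_def)

lemma radial_sup_ray: "radial_sup f t = (SUP r\<in>{0..<1}. ennreal (ray f t r))"
  by (simp add: radial_sup_def ray_def)

lemma ray_periodic: "ray f (t + 2 * pi) r = ray f t r"
proof -
  have "exp (\<i> * of_real (t + 2 * pi)) = exp (\<i> * of_real t + of_real (2 * pi) * \<i>)"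
    by (simp add: algebra_simps)
  also have "\<dots> = exp (\<i> * of_real t)" by (simp add: exp_add exp_two_pi_i)
  finally show ?thesis by (simp add: ray_def)
qed

lemma ray_le_SUP: "r \<in> {0..<1} \<Longrightarrow> ennreal (ray f t r) \<le> radial_sup f t"
  unfolding radial_sup_ray by (rule SUP_upper)

lemma in_unit_ball_ray: "r \<in> {0..<1} \<Longrightarrow> of_real r * exp (\<i> * of_real t) \<in> ball (0::complex) 1"
  by (simp add: norm_mult)

lemma continuous_on_ray:
  assumes "f holomorphic_on ball 0 1"
  shows "continuous_on {0..<1} (ray f t)"
  unfolding ray_def
  by (intro continuous_on_norm continuous_on_compose2[OF holomorphic_on_imp_continuous_on[OF assms]] continuous_intros)
     (use in_unit_ball_ray in auto)

lemma continuous_on_ray':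
  assumes "f holomorphic_on ball 0 1" "r \<in> {0..<1}"
  shows "continuous_on UNIV (\<lambda>t. ray f t r)"
  unfolding ray_def
  by (intro continuous_on_norm continuous_on_compose2[OF holomorphic_on_imp_continuous_on[OF assms(1)]] continuous_intros)
     (use in_unit_ball_ray assms in auto)

lemma ray_indicator_measurable:
  assumes "f holomorphic_on ball 0 1"
  shows "(\<lambda>r. indicator {0..<1} r * ray f t r) \<in> borel_measurable borel"
  using borel_measurable_continuous_on_indicator[OF _ continuous_on_ray[OF assms]] by simp

lemma ray_powr_measurable:
  assumes "f holomorphic_on ball 0 1" "S \<in> sets borel" "S \<subseteq> {0..<1}"
  shows "(\<lambda>r. ennreal (ray f t r powr P) * indicator S r) \<in> borel_measurable borel"
proof -
  note [measurable] = ray_indicator_measurable[OF assms(1), of t] assms(2)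
  have "(\<lambda>r. ennreal ((indicator {0..<1} r * ray f t r) powr P) * indicator S r) \<in> borel_measurable borel"
    by measurable
  also have "(\<lambda>r. ennreal ((indicator {0..<1} r * ray f t r) powr P) * indicator S r)
      = (\<lambda>r. ennreal (ray f t r powr P) * indicator S r)"
  proof (rule ext)
    fix r
    show "ennreal ((indicator {0..<1} r * ray f t r) powr P) * indicator S r = ennreal (ray f t r powr P) * indicator S r"
      by (cases "r \<in> S") (use assms(3) in auto)
  qed
  finally show ?thesis .
qed

text \<open>The supremum is uncountable, but over functions continuous in \<open>t\<close>, so its
  superlevel sets are open.\<close>

lemma radial_sup_measurable:
  assumes "f holomorphic_on ball 0 1"
  shows "radial_sup f \<in> borel_measurable borel"
proof (rule borel_measurableI_greater)
  fix a
  have "{t \<in> space borel. a < radial_sup f t} = (\<Union>r\<in>{0..<1}. {t. a < ennreal (ray f t r)})"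
    by (auto simp: radial_sup_ray less_SUP_iff)
  also have "open \<dots>"
    by (intro open_UN ballI open_Collect_less continuous_on_ennreal continuous_on_ray' assms) auto
  finally show "{t \<in> space borel. a < radial_sup f t} \<in> sets borel" by simp
qed

text \<open>The inner quasi-norm of \<open>rho\<close> on one ray. It makes membership in
  \<open>RM\<close> a condition on a single function of \<open>t\<close>, stated alike for finite
  and infinite \<open>p\<close>.\<close>

definition rnorm :: "ennreal \<Rightarrow> (complex \<Rightarrow> complex) \<Rightarrow> real \<Rightarrow> ennreal" where
  "rnorm p f t = (if p < \<infinity> then radial_int (enn2real p) f t epowr (1 / enn2real p) else radial_sup f t)"

lemma rnorm_periodic: "rnorm p f (t + 2 * pi) = rnorm p f t"
  by (simp only: rnorm_def radial_int_ray radial_sup_ray ray_periodic)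

lemma rnorm_measurable:
  assumes "f holomorphic_on ball 0 1"
  shows "rnorm p f \<in> borel_measurable borel"
proof -
  note [measurable] = radial_int_measurable[OF assms, of "enn2real p"] radial_sup_measurable[OF assms]
  show ?thesis unfolding rnorm_def by measurable
qed

lemma rnorm_fin_le_iff:
  assumes "0 < P" "0 \<le> B"
  shows "rnorm (ennreal P) f t \<le> ennreal B \<longleftrightarrow> radial_int P f t \<le> ennreal (B powr P)"
  using assms by (simp add: rnorm_def epowr_le_ennreal_iff)

lemma rnorm_top_le_iff:
  assumes "0 \<le> B"
  shows "rnorm \<infinity> f t \<le> ennreal B \<longleftrightarrow> (\<forall>r\<in>{0..<1}. ray f t r \<le> B)"
    "rnorm top f t \<le> ennreal B \<longleftrightarrow> (\<forall>r\<in>{0..<1}. ray f t r \<le> B)"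
  using assms by (simp_all add: rnorm_def radial_sup_ray SUP_le_iff)

lemma ennreal_cases_pos:
  fixes p :: ennreal
  assumes "0 < p" obtains "p = \<infinity>" | P where "0 < P" "p = ennreal P"
  using assms by (cases p) (auto simp: ennreal_zero_less_top)

lemma RM_fin:
  assumes "0 < p" "0 < Q"
  shows "f \<in> RM p (ennreal Q) \<longleftrightarrow> f holomorphic_on ball 0 1 \<and> (\<integral>\<^sup>+t\<in>{0..<2*pi}. rnorm p f t epowr Q \<partial>lborel) < \<infinity>"
proof -
  \<comment> \<open>Neither the normalizing factor nor the outer root affects finiteness.\<close>
  have cm: "circle_mean g epowr (1/Q) < \<infinity> \<longleftrightarrow> (\<integral>\<^sup>+t\<in>{0..<2*pi}. g t \<partial>lborel) < \<infinity>" for g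
    unfolding epowr_less_top_iff circle_mean_def by (auto simp: ennreal_mult_less_top)
  show ?thesis
    using assms by (auto simp: RM_def rho_def rnorm_def cm[unfolded infinity_ennreal_def] epowr_epowr simp del: epowr_less_top_iff)
qed

lemma RM_top:
  assumes "0 < P"
  shows "f \<in> RM (ennreal P) \<infinity> \<longleftrightarrow> f holomorphic_on ball 0 1 \<and>
    (\<exists>C::real. AE t in lborel. t \<in> {0..<2*pi} \<longrightarrow> rnorm (ennreal P) f t \<le> ennreal C)"
proof (cases "f holomorphic_on ball 0 1")
  case True
  let ?M = "restrict_space lborel {0..<2*pi}"
  let ?g = "rnorm (ennreal P) f"
  have m: "?g \<in> borel_measurable ?M"
    using rnorm_measurable[OF True] by (intro measurable_restrict_space1) auto
  have AE: "(AE t in ?M. Q t) \<longleftrightarrow> (AE t in lborel. t \<in> {0..<2*pi} \<longrightarrow> Q t)" for Q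
    by (subst AE_restrict_space_iff) auto
  have rho: "rho (ennreal P) \<infinity> f = esssup ?M ?g"
    by (simp add: rho_def rnorm_def[abs_def])
  have "esssup ?M ?g < \<infinity> \<longleftrightarrow> (\<exists>C::real. AE t in ?M. ?g t \<le> ennreal C)"
  proof
    assume "esssup ?M ?g < \<infinity>"
    then obtain C where "esssup ?M ?g = ennreal C" by (cases "esssup ?M ?g") auto
    with esssup_AE[of ?g ?M] show "\<exists>C::real. AE t in ?M. ?g t \<le> ennreal C" by auto
  next
    assume "\<exists>C::real. AE t in ?M. ?g t \<le> ennreal C"
    then obtain C :: real where "AE t in ?M. ?g t \<le> ennreal C" by auto
    from esssup_I[OF m this] show "esssup ?M ?g < \<infinity>" by (simp add: le_less_trans)
  qed
  with True show ?thesis unfolding RM_def mem_Collect_eq rho AE by simp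
qed (simp add: RM_def)

lemma RM_top_top: "f \<in> RM \<infinity> \<infinity> \<longleftrightarrow> f holomorphic_on ball 0 1 \<and> (\<exists>C. \<forall>z\<in>ball 0 1. norm (f z) \<le> C)"
proof -
  have "(SUP z\<in>ball 0 1. ennreal (norm (f z))) < \<infinity> \<longleftrightarrow> (\<exists>C. \<forall>z\<in>ball 0 1. norm (f z) \<le> C)"
  proof
    assume "(SUP z\<in>ball 0 1. ennreal (norm (f z))) < \<infinity>"
    then obtain C where C: "0 \<le> C" "(SUP z\<in>ball 0 1. ennreal (norm (f z))) = ennreal C"
      by (cases "SUP z\<in>ball 0 1. ennreal (norm (f z))") auto
    have "norm (f z) \<le> C" if "z \<in> ball 0 1" for z
      using SUP_upper[OF that, of "\<lambda>z. ennreal (norm (f z))"] C by simp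
    then show "\<exists>C. \<forall>z\<in>ball 0 1. norm (f z) \<le> C" by blast
  next
    assume "\<exists>C. \<forall>z\<in>ball 0 1. norm (f z) \<le> C"
    then obtain C where "\<forall>z\<in>ball 0 1. norm (f z) \<le> C" by blast
    then have "(SUP z\<in>ball 0 1. ennreal (norm (f z))) \<le> ennreal C" by (intro SUP_least ennreal_leI) auto
    then show "(SUP z\<in>ball 0 1. ennreal (norm (f z))) < \<infinity>" by (simp add: le_less_trans)
  qed
  then show ?thesis by (simp add: RM_def rho_def)
qed

lemma RM_holomorphic: "f \<in> RM p q \<Longrightarrow> f holomorphic_on ball 0 1" by (simp add: RM_def)

text \<open>One form for both definitions of the outer norm, the essential supremum and the supremum
  over the disc. Enlarging the constant to at least 1 provides the positive bound that
  \<open>rnorm_Jensen\<close> asks for.\<close>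

lemma RM_top_AE:
  assumes "f \<in> RM p \<infinity>" "0 < p"
  obtains C :: real where "0 < C" "AE t in lborel. t \<in> {0..<2*pi} \<longrightarrow> rnorm p f t \<le> ennreal C"
proof (cases "p = \<infinity>")
  case True
  then obtain C where C: "\<forall>z\<in>ball 0 1. norm (f z) \<le> C" using assms RM_top_top by auto
  have "rnorm p f t \<le> ennreal (max C 1)" for t
    using C in_unit_ball_ray unfolding True
    by (subst rnorm_top_le_iff) (auto simp: ray_def le_max_iff_disj)
  then show ?thesis using that[of "max C 1"] by auto
next
  case False
  with assms(2) obtain P where P: "0 < P" "p = ennreal P" by (auto elim: ennreal_cases_pos)
  with assms obtain C :: real where C: "AE t in lborel. t \<in> {0..<2*pi} \<longrightarrow> rnorm p f t \<le> ennreal C"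
    using RM_top by auto
  have "AE t in lborel. t \<in> {0..<2*pi} \<longrightarrow> rnorm p f t \<le> ennreal (max C 1)"
    using C by eventually_elim (auto intro: order_trans ennreal_leI)
  then show ?thesis using that[of "max C 1"] by auto
qed

text \<open>The bound is required for every \<open>t\<close> because for
  \<open>p = q = \<infinity>\<close> the defining supremum runs over the whole disc.\<close>

lemma rnorm_bounded_imp_RM:
  assumes "f holomorphic_on ball 0 1" "0 < p" "0 < q" "\<And>t. rnorm p f t \<le> ennreal C"
  shows "f \<in> RM p q"
proof -
  define B where "B = max C 0"
  have "ennreal C = ennreal B" by (cases "0 \<le> C") (auto simp: B_def max_def ennreal_neg)
  then have B: "0 \<le> B" "\<And>t. rnorm p f t \<le> ennreal B" using assms(4) by (simp_all add: B_def)
  show ?thesis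
    using \<open>0 < q\<close>
  proof (cases rule: ennreal_cases_pos)
    case 1
    show ?thesis using \<open>0 < p\<close>
    proof (cases rule: ennreal_cases_pos)
      case p: 1
      have "norm (f z) \<le> B" if "z \<in> ball 0 1" for z
      proof -
        have "norm (f z) = ray f (Arg z) (norm z)" 
          unfolding ray_def using rcis_cmod_Arg[of z] by (simp add: rcis_def cis_conv_exp)
        also have "\<dots> \<le> B" using B(2)[of "Arg z"] that B(1) unfolding p by (subst (asm) rnorm_top_le_iff) auto
        finally show ?thesis .
      qed
      then have "\<exists>C. \<forall>z\<in>ball 0 1. norm (f z) \<le> C" by blast
      then show ?thesis unfolding 1 p RM_top_top using assms(1) by simp
    next
      case (2 P)
      have "AE t in lborel. t \<in> {0..<2*pi} \<longrightarrow> rnorm (ennreal P) f t \<le> ennreal B" using B 2 by simp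
      then show ?thesis unfolding 1 2(2) RM_top[OF 2(1)] using assms(1) by blast
    qed
  next
    case (2 Q)
    have "(\<integral>\<^sup>+t\<in>{0..<2*pi}. rnorm p f t epowr Q \<partial>lborel) \<le> (\<integral>\<^sup>+t\<in>{0..<2*pi}. ennreal (B powr Q) \<partial>lborel)"
      by (intro nn_integral_mono mult_right_mono) (use B 2 epowr_mono[OF B(2)] in \<open>auto simp: epowr_ennreal\<close>)
    also have "\<dots> < \<infinity>" by (subst nn_integral_cmult_indicator) (auto simp: ennreal_mult_less_top)
    finally show ?thesis using RM_fin assms 2 by auto
  qed
qed

text \<open>A scale-invariant substitute for Jensen's inequality: \<open>y powr a \<le> 1 + y powr b\<close> for \<open>y = h / \<Lambda>\<close>.\<close>

lemma power_mean_le: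
  fixes h :: "'a \<Rightarrow> real"
  assumes "0 < a" "a \<le> b" "0 < \<Lambda>" "\<And>x. 0 \<le> h x"
    and m: "(\<lambda>x. ennreal (h x powr b) * indicator S x) \<in> borel_measurable M" "S \<in> sets M"
    and mS: "emeasure M S \<le> ennreal m" "0 \<le> m"
    and le: "(\<integral>\<^sup>+x\<in>S. ennreal (h x powr b) \<partial>M) \<le> ennreal (c * \<Lambda> powr b)" "0 \<le> c"
  shows "(\<integral>\<^sup>+x\<in>S. ennreal (h x powr a) \<partial>M) \<le> ennreal ((m + c) * \<Lambda> powr a)"
proof -
  have pt: "h x powr a \<le> \<Lambda> powr a + \<Lambda> powr (a - b) * h x powr b" for x
  proof (cases "h x \<le> \<Lambda>")
    case True
    then have "h x powr a \<le> \<Lambda> powr a" using assms by (intro powr_mono2) auto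
    then show ?thesis by (simp add: add_increasing2)
  next
    case False
    then have "h x powr a = h x powr (a - b) * h x powr b" by (simp add: powr_add[symmetric])
    also have "\<dots> \<le> \<Lambda> powr (a - b) * h x powr b"
      using False assms by (intro mult_right_mono powr_mono2') auto
    finally show ?thesis using add_increasing[of "\<Lambda> powr a"] by simp
  qed
  have "(\<integral>\<^sup>+x\<in>S. ennreal (h x powr a) \<partial>M) \<le> (\<integral>\<^sup>+x. ennreal (\<Lambda> powr a) * indicator S x + ennreal (\<Lambda> powr (a-b)) * (ennreal (h x powr b) * indicator S x) \<partial>M)"
  proof (rule nn_integral_mono)
    fix x
    have "ennreal (h x powr a) \<le> ennreal (\<Lambda> powr a) + ennreal (\<Lambda> powr (a-b)) * ennreal (h x powr b)"
      using ennreal_leI[OF pt[of x]] by (simp add: ennreal_mult' ennreal_plus)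
    then show "ennreal (h x powr a) * indicator S x \<le> ennreal (\<Lambda> powr a) * indicator S x + ennreal (\<Lambda> powr (a-b)) * (ennreal (h x powr b) * indicator S x)"
      by (simp add: indicator_def)
  qed
  also have "\<dots> = ennreal (\<Lambda> powr a) * emeasure M S + ennreal (\<Lambda> powr (a-b)) * (\<integral>\<^sup>+x\<in>S. ennreal (h x powr b) \<partial>M)"
    using m by (subst nn_integral_add) (auto simp: nn_integral_cmult nn_integral_cmult_indicator)
  also have "\<dots> \<le> ennreal (\<Lambda> powr a) * ennreal m + ennreal (\<Lambda> powr (a-b)) * ennreal (c * \<Lambda> powr b)"
    by (intro add_mono mult_left_mono mS le) auto
  also have "\<dots> = ennreal (\<Lambda> powr a * m + \<Lambda> powr (a-b) * (c * \<Lambda> powr b))"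
    using mS le by (simp add: ennreal_mult'[symmetric] ennreal_plus[symmetric] del: ennreal_plus)
  also have "\<Lambda> powr a * m + \<Lambda> powr (a-b) * (c * \<Lambda> powr b) = (m + c) * \<Lambda> powr a"
  proof -
    have "\<Lambda> powr (a-b) * \<Lambda> powr b = \<Lambda> powr a" by (simp add: powr_add[symmetric])
    then show ?thesis by (simp add: algebra_simps)
  qed
  finally show ?thesis .
qed

text \<open>The point is that \<open>K\<close> is the same for all \<open>t\<close>. A ray has
  length 1, so \<open>power_mean_le\<close> with \<open>m = c = 1\<close> loses a factor 2 in the
  \<open>P\<close>-th power, whence \<open>K = 2 powr (1/P)\<close>.\<close>

lemma rnorm_Jensen:
  assumes f: "f holomorphic_on ball 0 1" and "0 < p" "p \<le> p0"
  obtains K where "1 \<le> K" "\<And>t B. 0 < B \<Longrightarrow> rnorm p0 f t \<le> ennreal B \<Longrightarrow> rnorm p f t \<le> ennreal (K * B)"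
proof -
  have "0 < p0" using assms by auto
  show ?thesis using \<open>0 < p\<close>
  proof (cases rule: ennreal_cases_pos)
    case 1
    then have "p0 = p" using assms by (simp add: top_unique)
    then show ?thesis using that[of 1] by simp
  next
    case P: (2 P)
    define K where "K = 2 powr (1/P)"
    have K: "1 \<le> K" "K powr P = 2" using P by (auto simp: K_def powr_powr ge_one_powr_ge_zero)
    have eml: "emeasure lborel {0..<1::real} \<le> ennreal 1" by simp
    show ?thesis
    proof (rule that[OF K(1)])
      fix t and B :: real assume B: "0 < B" and le: "rnorm p0 f t \<le> ennreal B"
      have "radial_int P f t \<le> ennreal ((K * B) powr P)"
        using \<open>0 < p0\<close>
      proof (cases rule: ennreal_cases_pos)
        case 1
        then have r: "ray f t r \<le> B" if "r \<in> {0..<1}" for r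
          using le B that by (simp add: rnorm_top_le_iff)
        have "radial_int P f t \<le> (\<integral>\<^sup>+ r\<in>{0..<1::real}. ennreal (B powr P) \<partial>lborel)"
          unfolding radial_int_ray
        proof (rule nn_integral_mono)
          show "ennreal (ray f t r powr P) * indicator {0..<1} r \<le> ennreal (B powr P) * indicator {0..<1} r" for r
            using r[of r] P(1) powr_mono2[of P "ray f t r" B] by (auto simp: indicator_def intro!: ennreal_leI)
        qed
        also have "\<dots> = ennreal (B powr P)" by (subst nn_integral_cmult_indicator) auto
        also have "\<dots> \<le> ennreal ((K * B) powr P)"
          using K B P by (intro ennreal_leI powr_mono2) auto
        finally show ?thesis .
      next
        case P0: (2 P0)
        then have "P \<le> P0" using assms P by auto
        have "radial_int P0 f t \<le> ennreal (1 * B powr P0)"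
          using le B P0 by (simp add: rnorm_fin_le_iff)
        then have "radial_int P f t \<le> ennreal ((1 + 1) * B powr P)"
          unfolding radial_int_ray
          using P \<open>P \<le> P0\<close> B ray_powr_measurable[OF f] 
          by (intro power_mean_le) auto
        then show ?thesis using K B by (simp add: powr_mult)
      qed
      then show "rnorm p f t \<le> ennreal (K * B)" using P B K by (simp add: rnorm_fin_le_iff)
    qed
  qed
qed

text \<open>The radial exponent is lowered ray by ray with a uniform constant; the angular one is
  lowered because the circle has finite measure.\<close>

lemma RM_antimono:
  assumes "0 < p" "p \<le> p0" "0 < q" "q \<le> q0"
  shows "RM p0 q0 \<subseteq> RM p q"
proof
  fix f assume f0: "f \<in> RM p0 q0"
  have f: "f holomorphic_on ball 0 1" using f0 by (rule RM_holomorphic)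
  have "0 < p0" "0 < q0" using assms by auto
  obtain K where K: "1 \<le> K" "\<And>t B. 0 < B \<Longrightarrow> rnorm p0 f t \<le> ennreal B \<Longrightarrow> rnorm p f t \<le> ennreal (K * B)"
    using rnorm_Jensen[OF f assms(1,2)] by blast
  note [measurable] = rnorm_measurable[OF f]
  show "f \<in> RM p q" using \<open>0 < q0\<close>
  proof (cases rule: ennreal_cases_pos)
    case q0: 1
    obtain C where C: "0 < C" "AE t in lborel. t \<in> {0..<2*pi} \<longrightarrow> rnorm p0 f t \<le> ennreal C"
      using RM_top_AE f0 \<open>0 < p0\<close> q0 by blast
    have C': "AE t in lborel. t \<in> {0..<2*pi} \<longrightarrow> rnorm p f t \<le> ennreal (K * C)"
      using C(2) by eventually_elim (use K(2)[OF C(1)] in auto)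
    show ?thesis using \<open>0 < q\<close>
    proof (cases rule: ennreal_cases_pos)
      case q: 1
      show ?thesis using \<open>0 < p\<close>
      proof (cases rule: ennreal_cases_pos)
        case 1
        then have "p0 = p" using assms by (simp add: top_unique)
        then show ?thesis using f0 q0 q by simp
      next
        case 2
        then show ?thesis using C' f q RM_top by auto
      qed
    next
      case (2 Q)
      have "(\<integral>\<^sup>+t\<in>{0..<2*pi}. rnorm p f t epowr Q \<partial>lborel) \<le> (\<integral>\<^sup>+t\<in>{0..<2*pi}. ennreal ((K * C) powr Q) \<partial>lborel)"
      proof (rule nn_integral_mono_AE)
        show "AE t in lborel. rnorm p f t epowr Q * indicator {0..<2*pi} t \<le> ennreal ((K * C) powr Q) * indicator {0..<2*pi} t"
          using C'
        proof eventually_elim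
          case (elim t)
          then show ?case using epowr_mono[of "rnorm p f t" "ennreal (K*C)" Q] C K 2 by (auto simp: indicator_def epowr_ennreal)
        qed
      qed
      also have "\<dots> < \<infinity>" by (subst nn_integral_cmult_indicator) (auto simp: ennreal_mult_less_top)
      finally show ?thesis using RM_fin assms 2 f by auto
    qed
  next
    case q0: (2 Q0)
    then obtain Q where Q: "0 < Q" "q = ennreal Q" "Q \<le> Q0"
      using assms by (cases q) (auto simp: top_unique)
    have pt: "rnorm p f t epowr Q \<le> ennreal ((2 * K) powr Q0) * (1 + rnorm p0 f t epowr Q0)" for t
    proof (cases "rnorm p0 f t")
      case (real x)
      \<comment> \<open>Raised to at least 1, so that \<open>K * B\<close> is at least 1 and the
        exponent \<open>Q\<close> may be replaced by the larger \<open>Q0\<close>.\<close>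
      define B where "B = max x 1"
      have B: "1 \<le> B" "x \<le> B" "0 < B" by (auto simp: B_def)
      have "rnorm p f t \<le> ennreal (K * B)" by (rule K) (use B real in auto)
      then have "rnorm p f t epowr Q \<le> ennreal (K * B) epowr Q" using Q by (intro epowr_mono) auto
      also have "\<dots> = ennreal ((K * B) powr Q)" using B K by (simp add: epowr_ennreal)
      also have "\<dots> \<le> ennreal ((2 * K) powr Q0 * (1 + x powr Q0))"
      proof (rule ennreal_leI)
        have "(K * B) powr Q \<le> (K * B) powr Q0" using B K Q mult_mono[of 1 K 1 B] by (intro powr_mono) auto
        also have "\<dots> = K powr Q0 * B powr Q0" using B K by (simp add: powr_mult)
        also have "\<dots> \<le> (2 * K) powr Q0 * (1 + x powr Q0)"
        proof (intro mult_mono)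
          show "K powr Q0 \<le> (2 * K) powr Q0" using K q0 by (intro powr_mono2) auto
          show "B powr Q0 \<le> 1 + x powr Q0" by (auto simp: B_def max_def)
        qed auto
        finally show "(K * B) powr Q \<le> (2 * K) powr Q0 * (1 + x powr Q0)" .
      qed
      finally show ?thesis using real by (simp add: epowr_ennreal ennreal_mult' ennreal_plus)
    next
      case top
      then have "rnorm p0 f t epowr Q0 = \<infinity>" by (simp add: epowr_def)
      then show ?thesis using K by (simp add: ennreal_mult_top)
    qed
    have "(\<integral>\<^sup>+t\<in>{0..<2*pi}. rnorm p f t epowr Q \<partial>lborel) \<le>
      (\<integral>\<^sup>+t. ennreal ((2 * K) powr Q0) * (indicator {0..<2*pi} t + rnorm p0 f t epowr Q0 * indicator {0..<2*pi} t) \<partial>lborel)"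
      by (intro nn_integral_mono) (use pt in \<open>auto simp: indicator_def\<close>)
    also have "\<dots> = ennreal ((2 * K) powr Q0) * (ennreal (2 * pi) + (\<integral>\<^sup>+t\<in>{0..<2*pi}. rnorm p0 f t epowr Q0 \<partial>lborel))"
      by (simp add: nn_integral_cmult nn_integral_add)
    also have "\<dots> < \<infinity>"
      using f0 RM_fin[OF \<open>0 < p0\<close> q0(1)] q0 by (simp add: ennreal_mult_less_top)
    finally show ?thesis using RM_fin[OF assms(1) Q(1)] f Q by simp
  qed
qed

section \<open>Pointwise estimates\<close>

text \<open>The reciprocal as a real number, with value 0 at infinity: all conditions on exponents
  become linear real inequalities, in which differences may be formed freely.\<close>

definition recip :: "ennreal \<Rightarrow> real" where "recip p = enn2real (1 / p)"

lemma recip_ennreal: "0 < P \<Longrightarrow> recip (ennreal P) = 1 / P"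
  by (simp add: recip_def divide_ennreal flip: ennreal_1)

lemma recip_top: "recip \<infinity> = 0" "recip top = 0" by (simp_all add: recip_def)

lemma recip_nonneg: "0 \<le> recip p" by (simp add: recip_def)

text \<open>In the coordinates (ln r, t) the polar box is a square and \<open>f\<close> composed
  with \<open>exp\<close> is holomorphic on it, so the mean value inequality for squares applies
  directly.\<close>

lemma box_estimate:
  assumes f: "f holomorphic_on ball 0 1" and r: "1/2 \<le> r" "r < 1" and x: "x = 1 - r"
  shows "ennreal (sqrt (ray f t r)) \<le> ennreal (768 / x^2) *
    (\<integral>\<^sup>+\<theta>\<in>{t-x/2..t+x/2}. (\<integral>\<^sup>+\<rho>\<in>{r * exp (-x/2)..r * exp (x/2)}. ennreal (sqrt (ray f \<theta> \<rho>)) \<partial>lborel) \<partial>lborel)"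
proof -
  have x0: "0 < x" "x \<le> 1/2" using r x by auto
  define h where "h = (\<lambda>w. f (exp w))"
  define a where "a = ln r"
  have ea: "exp a = r" using r by (simp add: a_def)
  \<comment> \<open>Hence ln r <= -x, and a square of half side \<open>x/2\<close> stays in the open
    left half plane, which \<open>exp\<close> maps into the disc.\<close>
  have "ln r \<le> r - 1" using r ln_le_minus_one[of r] by simp
  then have neg: "a + x/2 < 0" using x x0 unfolding a_def by linarith
  let ?C = "cbox (Complex (a-x/2) (t-x/2)) (Complex (a+x/2) (t+x/2))"
  have "h holomorphic_on ?C"
    unfolding h_def
  proof (rule holomorphic_on_compose_gen[OF _ f, unfolded o_def])
    show "exp ` ?C \<subseteq> ball 0 1"
      using neg by (auto simp: in_cbox_complex_iff)
  qed (intro holomorphic_intros)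
  then have "ennreal ((x/2)^2 * sqrt (norm (h (Complex a t)))) \<le>
    48 * (\<integral>\<^sup>+y\<in>{t-x/2..t+x/2}. (\<integral>\<^sup>+s\<in>{a-x/2..a+x/2}. ennreal (sqrt (norm (h (Complex s y)))) \<partial>lborel) \<partial>lborel)"
    by (rule square_mean_value_sqrt) (use x0 in auto)
  moreover have hr: "norm (h (Complex s y)) = ray f y (exp s)" for s y
    by (simp add: h_def ray_def Complex_eq exp_add exp_of_real)
  ultimately have 1: "ennreal (x^2/4 * sqrt (ray f t r)) \<le>
    48 * (\<integral>\<^sup>+y\<in>{t-x/2..t+x/2}. (\<integral>\<^sup>+s\<in>{a-x/2..a+x/2}. ennreal (sqrt (ray f y (exp s))) \<partial>lborel) \<partial>lborel)"
    by (simp add: ea power_divide)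
  define T where "T = {r * exp (-x/2)..r * exp (x/2)}"
  have ends: "exp (a - x/2) = r * exp (-x/2)" "exp (a + x/2) = r * exp (x/2)"
    unfolding ea[symmetric] exp_add[symmetric] by simp_all
  \<comment> \<open>The density of d rho = exp(s) ds is at least 1/4, so changing variables costs a
    factor 4. With (x/2)^2 and the constant 48 this makes 768 = 4 * 48 * 4.\<close>
  have low: "1/4 \<le> exp s" if "s \<in> {a-x/2..a+x/2}" for s
  proof -
    have "1 - x/2 \<le> exp (-x/2)" using exp_ge_add_one_self[of "-x/2"] by simp
    then have "1/2 * (3/4) \<le> r * exp (-x/2)" using r x0 by (intro mult_mono) auto
    then have "1/4 \<le> exp (a - x/2)" using ends by linarith
    also have "\<dots> \<le> exp s" using that by simp
    finally show ?thesis .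
  qed
  have up: "r * exp (x/2) < 1" unfolding ends[symmetric] using neg by simp
  have low': "0 \<le> r * exp (-x/2)" using r by simp
  have inner: "(\<integral>\<^sup>+s\<in>{a-x/2..a+x/2}. ennreal (sqrt (ray f y (exp s))) \<partial>lborel) \<le> 4 * (\<integral>\<^sup>+\<rho>\<in>T. ennreal (sqrt (ray f y \<rho>)) \<partial>lborel)" for y
  proof -
    have Tsub: "T \<subseteq> {0..<1}" using up low' unfolding T_def by (auto intro: order_trans less_imp_le le_less_trans)
    have m: "set_borel_measurable borel {exp (a-x/2)..exp (a+x/2)} (\<lambda>\<rho>. sqrt (ray f y \<rho>))"
    proof -
      have "continuous_on T (ray f y)" by (rule continuous_on_subset[OF continuous_on_ray[OF f] Tsub])
      then have "continuous_on {exp (a-x/2)..exp (a+x/2)} (\<lambda>\<rho>. sqrt (ray f y \<rho>))"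
        unfolding ends T_def[symmetric] by (intro continuous_intros)
      then show ?thesis
        unfolding set_borel_measurable_def by (intro borel_measurable_continuous_on_indicator) auto
    qed
    have "(\<integral>\<^sup>+s\<in>{a-x/2..a+x/2}. ennreal (sqrt (ray f y (exp s))) \<partial>lborel)
      \<le> (\<integral>\<^sup>+s. 4 * ennreal (sqrt (ray f y (exp s)) * exp s * indicator {a-x/2..a+x/2} s) \<partial>lborel)"
    proof (rule nn_integral_mono)
      fix s
      show "ennreal (sqrt (ray f y (exp s))) * indicator {a-x/2..a+x/2} s
        \<le> 4 * ennreal (sqrt (ray f y (exp s)) * exp s * indicator {a-x/2..a+x/2} s)"
      proof (cases "s \<in> {a-x/2..a+x/2}")
        case True
        have "sqrt (ray f y (exp s)) * 1 \<le> sqrt (ray f y (exp s)) * (4 * exp s)"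
          using low[OF True] by (intro mult_left_mono) auto
        then have "ennreal (sqrt (ray f y (exp s))) \<le> ennreal (4 * (sqrt (ray f y (exp s)) * exp s))"
          by (intro ennreal_leI) (simp add: mult_ac)
        also have "\<dots> = 4 * ennreal (sqrt (ray f y (exp s)) * exp s)" by (simp add: ennreal_mult')
        finally show ?thesis using True by simp
      qed simp
    qed
    also have "\<dots> = 4 * (\<integral>\<^sup>+s. ennreal (sqrt (ray f y (exp s)) * exp s * indicator {a-x/2..a+x/2} s) \<partial>lborel)"
    proof (rule nn_integral_cmult)
      have "continuous_on {a-x/2..a+x/2} (\<lambda>s. sqrt (ray f y (exp s)) * exp s)"
        using Tsub neg by (intro continuous_intros continuous_on_compose2[OF continuous_on_ray[OF f]]) auto
      then have "(\<lambda>s. indicator {a-x/2..a+x/2} s *\<^sub>R (sqrt (ray f y (exp s)) * exp s)) \<in> borel_measurable borel"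
        by (intro borel_measurable_continuous_on_indicator) auto
      then show "(\<lambda>s. ennreal (sqrt (ray f y (exp s)) * exp s * indicator {a-x/2..a+x/2} s)) \<in> borel_measurable lborel"
        by (simp add: mult.commute mult.left_commute)
    qed
    also have "(\<integral>\<^sup>+s. ennreal (sqrt (ray f y (exp s)) * exp s * indicator {a-x/2..a+x/2} s) \<partial>lborel)
       = (\<integral>\<^sup>+\<rho>. ennreal (sqrt (ray f y \<rho>) * indicator {exp (a-x/2)..exp (a+x/2)} \<rho>) \<partial>lborel)"
      by (rule nn_integral_substitution[where g = exp and g' = exp and f = "\<lambda>\<rho>. sqrt (ray f y \<rho>)" and a = "a-x/2" and b = "a+x/2", OF m, symmetric]) (use x0 in \<open>auto intro!: derivative_eq_intros continuous_intros\<close>)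
    also have "\<dots> = (\<integral>\<^sup>+\<rho>\<in>T. ennreal (sqrt (ray f y \<rho>)) \<partial>lborel)"
      unfolding ends T_def by (intro nn_integral_cong) (auto simp: indicator_def)
    finally show ?thesis .
  qed
  define I where "I = (\<integral>\<^sup>+y\<in>{t-x/2..t+x/2}. (\<integral>\<^sup>+\<rho>\<in>T. ennreal (sqrt (ray f y \<rho>)) \<partial>lborel) \<partial>lborel)"
  note 1
  also have "48 * (\<integral>\<^sup>+y\<in>{t-x/2..t+x/2}. (\<integral>\<^sup>+s\<in>{a-x/2..a+x/2}. ennreal (sqrt (ray f y (exp s))) \<partial>lborel) \<partial>lborel)
     \<le> 48 * (\<integral>\<^sup>+y. 4 * ((\<integral>\<^sup>+\<rho>\<in>T. ennreal (sqrt (ray f y \<rho>)) \<partial>lborel) * indicator {t-x/2..t+x/2} y) \<partial>lborel)"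
    by (intro mult_left_mono nn_integral_mono) (use inner in \<open>auto simp: indicator_def\<close>)
  also have "(\<integral>\<^sup>+y. 4 * ((\<integral>\<^sup>+\<rho>\<in>T. ennreal (sqrt (ray f y \<rho>)) \<partial>lborel) * indicator {t-x/2..t+x/2} y) \<partial>lborel) = 4 * I"
    unfolding I_def
  proof (rule nn_integral_cmult)
    \<comment> \<open>Cutting \<open>f\<close> off outside the disc gives a Borel function on the
      whole plane, hence joint measurability in angle and radius.\<close>
    define g where "g = (\<lambda>z. indicator (ball 0 1) z *\<^sub>R f z)"
    have [measurable]: "g \<in> borel_measurable borel"
      unfolding g_def
      by (rule borel_measurable_continuous_on_indicator)
         (auto intro: holomorphic_on_imp_continuous_on f)
    have "(\<lambda>x. of_real (snd x) * exp (\<i> * of_real (fst x)) :: complex)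
        \<in> borel_measurable (borel :: (real \<times> real) measure)"
      by (intro borel_measurable_continuous_onI continuous_intros)
    then have [measurable]: "(\<lambda>x. of_real (snd x) * exp (\<i> * of_real (fst x)) :: complex)
        \<in> borel_measurable (lborel \<Otimes>\<^sub>M (lborel :: real measure))"
      by (simp add: lborel_prod)
    have [measurable]: "T \<in> sets borel" by (simp add: T_def)
    have Tsub: "T \<subseteq> {0..<1}" using up low' unfolding T_def by (auto intro: order_trans less_imp_le le_less_trans)
    have "(\<lambda>y. (\<integral>\<^sup>+\<rho>. ennreal (sqrt (norm (g (of_real \<rho> * exp (\<i> * of_real y))))) * indicator T \<rho> \<partial>lborel)) \<in> borel_measurable lborel"
      by (rule lborel.borel_measurable_nn_integral) (simp add: split_beta', measurable)
    also have "(\<lambda>y. (\<integral>\<^sup>+\<rho>. ennreal (sqrt (norm (g (of_real \<rho> * exp (\<i> * of_real y))))) * indicator T \<rho> \<partial>lborel))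
      = (\<lambda>y. (\<integral>\<^sup>+\<rho>\<in>T. ennreal (sqrt (ray f y \<rho>)) \<partial>lborel))"
    proof (intro ext nn_integral_cong)
      fix y \<rho> :: real
      show "ennreal (sqrt (norm (g (of_real \<rho> * exp (\<i> * of_real y))))) * indicator T \<rho> = ennreal (sqrt (ray f y \<rho>)) * indicator T \<rho>"
        using in_unit_ball_ray[of \<rho> y] Tsub by (cases "\<rho> \<in> T") (auto simp: g_def ray_def)
    qed
    finally show "(\<lambda>y. (\<integral>\<^sup>+\<rho>\<in>T. ennreal (sqrt (ray f y \<rho>)) \<partial>lborel) * indicator {t-x/2..t+x/2} y) \<in> borel_measurable lborel"
      by measurable
  qed
  finally have "ennreal (4 / x^2) * ennreal (x^2/4 * sqrt (ray f t r)) \<le> ennreal (4 / x^2) * (48 * (4 * I))"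
    by (rule mult_left_mono) simp
  moreover have "ennreal (4 / x^2) * ennreal (x^2/4 * sqrt (ray f t r)) = ennreal (sqrt (ray f t r))"
    using x0 by (simp add: ennreal_mult'[symmetric])
  moreover have "ennreal (4 / x^2) * (48 * (4 * I)) = ennreal (768 / x^2) * I"
    by (simp add: mult.assoc[symmetric] ennreal_mult'[symmetric] ennreal_numeral[symmetric] del: ennreal_numeral)
  ultimately show ?thesis by (simp add: I_def T_def)
qed

text \<open>Hoelder's inequality on an interval of length at most \<open>2 * x\<close>, between the
  exponents 1/2 and \<open>p0\<close>. For finite \<open>p0\<close> it goes through
  \<open>power_mean_le\<close>, whence the constant 3 = 2 + 1.\<close>

lemma inner_estimate:
  assumes f: "f holomorphic_on ball 0 1" and p0: "1 \<le> p0" and B: "0 < B" "rnorm p0 f t \<le> ennreal B"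
    and x: "0 < x" and ab: "0 \<le> \<alpha>" "\<beta> < 1" "\<beta> - \<alpha> \<le> 2 * x"
  shows "(\<integral>\<^sup>+\<rho>\<in>{\<alpha>..\<beta>}. ennreal (sqrt (ray f t \<rho>)) \<partial>lborel) \<le> ennreal (3 * x powr (1 - recip p0 / 2) * sqrt B)"
proof -
  have em: "emeasure lborel {\<alpha>..\<beta>} \<le> ennreal (2 * x)"
    using ab x by (cases "\<alpha> \<le> \<beta>") (auto intro: ennreal_leI)
  have "0 < p0" by (rule less_le_trans[OF _ p0]) simp
  then show ?thesis
  proof (cases rule: ennreal_cases_pos)
    case 1
    then have r: "ray f t \<rho> \<le> B" if "\<rho> \<in> {\<alpha>..\<beta>}" for \<rho>
      using B ab that by (simp add: rnorm_top_le_iff)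
    have "(\<integral>\<^sup>+\<rho>\<in>{\<alpha>..\<beta>}. ennreal (sqrt (ray f t \<rho>)) \<partial>lborel) \<le> (\<integral>\<^sup>+\<rho>\<in>{\<alpha>..\<beta>}. ennreal (sqrt B) \<partial>lborel)"
      by (rule nn_integral_mono) (use r in \<open>auto simp: indicator_def intro!: ennreal_leI\<close>)
    also have "\<dots> = ennreal (sqrt B) * emeasure lborel {\<alpha>..\<beta>}" by (subst nn_integral_cmult_indicator) auto
    also have "\<dots> \<le> ennreal (sqrt B) * ennreal (2 * x)" by (intro mult_left_mono em) auto
    also have "\<dots> \<le> ennreal (3 * x powr (1 - recip p0 / 2) * sqrt B)"
      using x B by (simp add: 1 recip_top ennreal_mult'[symmetric]) 
    finally show ?thesis .
  next
    case P: (2 P)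
    have "1 \<le> P" using p0 P by (simp flip: ennreal_1)
    \<comment> \<open>The height of a function with \<open>P\<close>-norm \<open>B\<close> spread
      evenly over a length \<open>x\<close>.\<close>
    define \<Lambda> where "\<Lambda> = B * x powr (-1/P)"
    have \<Lambda>: "0 < \<Lambda>" "\<Lambda> powr P = B powr P / x" 
      using B x P by (simp_all add: \<Lambda>_def powr_mult powr_powr powr_neg_one)
    have "(\<integral>\<^sup>+\<rho>\<in>{\<alpha>..\<beta>}. ennreal (ray f t \<rho> powr P) \<partial>lborel) \<le> radial_int P f t"
      unfolding radial_int_ray using ab by (intro nn_integral_mono) (auto simp: indicator_def)
    also have "\<dots> \<le> ennreal (B powr P)" using B P by (simp add: rnorm_fin_le_iff)
    also have "B powr P = x * \<Lambda> powr P" using \<Lambda> x by simp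
    finally have le: "(\<integral>\<^sup>+\<rho>\<in>{\<alpha>..\<beta>}. ennreal (ray f t \<rho> powr P) \<partial>lborel) \<le> ennreal (x * \<Lambda> powr P)" .
    have "{\<alpha>..\<beta>} \<subseteq> {0..<1}" using ab by auto
    then have m: "(\<lambda>\<rho>. ennreal (ray f t \<rho> powr P) * indicator {\<alpha>..\<beta>} \<rho>) \<in> borel_measurable lborel"
      using ray_powr_measurable[OF f, of "{\<alpha>..\<beta>}" t P] by simp
    have "(\<integral>\<^sup>+\<rho>\<in>{\<alpha>..\<beta>}. ennreal (ray f t \<rho> powr (1/2)) \<partial>lborel) \<le> ennreal ((2 * x + x) * \<Lambda> powr (1/2))"
      by (rule power_mean_le[OF _ _ \<Lambda>(1) _ m _ em _ le]) (use \<open>1 \<le> P\<close> x in auto)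
    also have "\<Lambda> powr (1/2) = sqrt B * x powr (- 1 / (2 * P))"
      using B x by (simp add: \<Lambda>_def powr_mult powr_powr powr_half_sqrt mult.commute)
    also have "(2 * x + x) * (sqrt B * x powr (- 1 / (2 * P))) = 3 * x powr (1 - recip p0 / 2) * sqrt B"
      using x P by (simp add: recip_ennreal powr_diff powr_minus_divide mult.commute[of P 2])
    finally show ?thesis by (simp add: powr_half_sqrt)
  qed
qed

text \<open>The window [-8, 8) gives the averages around points of [0, 2 pi] room without wrapping
  around; it fits in four periods since 8 < 4 pi.\<close>

lemma periodic_nn_integral_le:
  fixes g :: "real \<Rightarrow> ennreal"
  assumes [measurable]: "g \<in> borel_measurable borel" and per: "\<And>t. g (t + 2 * pi) = g t"
  shows "(\<integral>\<^sup>+t\<in>{-8..<8}. g t \<partial>lborel) \<le> 4 * (\<integral>\<^sup>+t\<in>{0..<2*pi}. g t \<partial>lborel)"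
proof -
  define I where "I = (\<integral>\<^sup>+t\<in>{0..<2*pi}. g t \<partial>lborel)"
  have s: "(\<integral>\<^sup>+t\<in>{c..<c+2*pi}. g t \<partial>lborel) = I" if "\<And>t. g (c + t) = g t" for c
  proof -
    have "(\<integral>\<^sup>+t\<in>{c..<c+2*pi}. g t \<partial>lborel) = (\<integral>\<^sup>+t. g (c + t) * indicator {c..<c+2*pi} (c + t) \<partial>lborel)"
      by (subst nn_integral_real_affine[where c = 1 and t = c]) auto
    also have "\<dots> = I" unfolding I_def by (intro nn_integral_cong) (auto simp: that indicator_def)
    finally show ?thesis .
  qed
  have p1: "g (-2*pi + t) = g t" for t using per[of "-2*pi + t"] by simp
  have p2: "g (-4*pi + t) = g t" for t using p1[of "-2*pi + t"] p1[of t] by simp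
  have p3: "g (2*pi + t) = g t" for t using per[of t] by (simp add: add.commute)
  have "(\<integral>\<^sup>+t\<in>{-8..<8}. g t \<partial>lborel) \<le> (\<integral>\<^sup>+t. (g t * indicator {-4*pi..<-4*pi+2*pi} t + g t * indicator {-2*pi..<-2*pi+2*pi} t)
     + (g t * indicator {0..<0+2*pi} t + g t * indicator {2*pi..<2*pi+2*pi} t) \<partial>lborel)"
    by (intro nn_integral_mono) (use pi_gt3 in \<open>auto simp: indicator_def\<close>)
  also have "\<dots> = (I + I) + (I + I)"
    using s[OF p2] s[OF p1] s[of 0] s[OF p3] by (simp add: nn_integral_add)
  also have "\<dots> = (2 + 2) * I" by (simp only: distrib_right mult_2)
  finally show ?thesis by (simp add: I_def)
qed

text \<open>Passing through \<open>sqrt \<bar>f\<bar>\<close> is what makes the exponent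
  \<open>2\<close> available even when \<open>q0 = 1\<close>.\<close>

lemma RM_pointwise_average:
  assumes f: "f \<in> RM p0 (ennreal Q)" and p0: "1 \<le> p0" and Q: "1 \<le> Q"
  obtains H :: "real \<Rightarrow> real" and C where
    "\<And>x. 0 \<le> H x" "integrable lborel H" "integrable lborel (\<lambda>x. (H x)^2)" "0 < C"
    "\<And>t x. t \<in> {0..2*pi} \<Longrightarrow> 0 < x \<Longrightarrow> x \<le> 1/2 \<Longrightarrow>
       ray f t (1 - x) \<le> C * x powr (- recip p0) * ((LINT \<theta>:{t-x..<t+x}|lborel. H \<theta>) / x) powr (2/Q)"
proof -
  have hol: "f holomorphic_on ball 0 1" using f by (rule RM_holomorphic)
  have "0 < p0" by (rule less_le_trans[OF _ p0]) simp
  note [measurable] = rnorm_measurable[OF hol, of p0]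
  define N where "N = rnorm p0 f"
  have [measurable]: "N \<in> borel_measurable borel" by (simp add: N_def)
  \<comment> \<open>Adding \<open>1\<close> keeps the averages positive, so that one may divide by them.\<close>
  define n where "n \<theta> = enn2real (N \<theta>) + 1" for \<theta>
  have n1: "1 \<le> n \<theta>" for \<theta> by (simp add: n_def)
  have [measurable]: "n \<in> borel_measurable borel" unfolding n_def by measurable
  \<comment> \<open>Its square is the \<open>Q\<close>-th power of \<open>n\<close>, so
    \<open>f \<in> RM p0 (ennreal Q)\<close> puts \<open>H\<close> in L^2; the cut-off then makes it
    integrable as well.\<close>
  define H where "H \<theta> = indicator {-8..<8} \<theta> * n \<theta> powr (Q/2)" for \<theta>
  have Hm[measurable]: "H \<in> borel_measurable borel" unfolding H_def by measurable
  have H0: "0 \<le> H x" for x by (simp add: H_def)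
  have H2: "(H x)^2 = indicator {-8..<8} x * n x powr Q" for x
    by (simp add: H_def power2_eq_square indicator_def flip: powr_add)
  have "(\<integral>\<^sup>+t\<in>{-8..<8}. N t epowr Q \<partial>lborel) \<le> 4 * (\<integral>\<^sup>+t\<in>{0..<2*pi}. N t epowr Q \<partial>lborel)"
    by (rule periodic_nn_integral_le) (simp_all add: N_def rnorm_periodic)
  also have "\<dots> < \<infinity>" using f RM_fin[OF \<open>0 < p0\<close>, of Q] Q by (simp add: N_def ennreal_mult_less_top)
  finally have NI: "(\<integral>\<^sup>+t\<in>{-8..<8}. N t epowr Q \<partial>lborel) < \<infinity>" .
  \<comment> \<open>\<open>enn2real\<close> sends infinity to 0, so the bound of \<open>N\<close> by
    \<open>n\<close> can fail where \<open>N\<close> is infinite; within the window that set is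
    null.\<close>
  have AEfin: "AE t in lborel. t \<in> {-8..<8} \<longrightarrow> N t \<le> ennreal (n t)"
  proof -
    have "AE t in lborel. N t epowr Q * indicator {-8..<8} t \<noteq> \<infinity>"
      by (rule nn_integral_PInf_AE) (use NI in auto)
    then show ?thesis
    proof eventually_elim
      case (elim t)
      show ?case
      proof
        assume "t \<in> {-8..<8}"
        with elim have "N t \<noteq> top" by (auto simp: epowr_def)
        then have "N t = ennreal (enn2real (N t))" by (simp add: less_top)
        also have "\<dots> \<le> ennreal (n t)" by (intro ennreal_leI) (simp add: n_def)
        finally show "N t \<le> ennreal (n t)" .
      qed
    qed
  qed
  have "(\<integral>\<^sup>+x. ennreal ((H x)^2) \<partial>lborel) \<le> (\<integral>\<^sup>+t. ennreal (2 powr Q) * (indicator {-8..<8} t + N t epowr Q * indicator {-8..<8} t) \<partial>lborel)"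
  proof (rule nn_integral_mono)
    fix t
    show "ennreal ((H t)^2) \<le> ennreal (2 powr Q) * (indicator {-8..<8} t + N t epowr Q * indicator {-8..<8} t)"
    proof (cases "t \<in> {-8..<8} \<and> N t \<noteq> top")
      case True
      then obtain u where u: "0 \<le> u" "N t = ennreal u" by (cases "N t") auto
      have "(u + 1) powr Q \<le> (2 * max u 1) powr Q" using u Q by (intro powr_mono2) auto
      also have "\<dots> = 2 powr Q * max u 1 powr Q" by (simp add: powr_mult)
      also have "\<dots> \<le> 2 powr Q * (1 + u powr Q)" by (intro mult_left_mono) (auto simp: max_def)
      finally have "ennreal ((u + 1) powr Q) \<le> ennreal (2 powr Q * (1 + u powr Q))" by (rule ennreal_leI)
      then show ?thesis using True u by (simp add: H2 n_def epowr_ennreal ennreal_mult' ennreal_plus)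
    next
      case False
      then show ?thesis by (cases "t \<in> {-8..<8}") (auto simp: H2 ennreal_mult_top)
    qed
  qed
  also have "\<dots> = ennreal (2 powr Q) * (16 + (\<integral>\<^sup>+t\<in>{-8..<8}. N t epowr Q \<partial>lborel))"
    by (simp add: nn_integral_cmult nn_integral_add)
  also have "\<dots> < \<infinity>" using NI by (simp add: ennreal_mult_less_top)
  finally have "(\<integral>\<^sup>+x. ennreal ((H x)^2) \<partial>lborel) < \<infinity>" .
  then have iH2: "integrable lborel (\<lambda>x. (H x)^2)"
    by (intro integrableI_nonneg) auto
  have iH: "integrable lborel H"
  proof (rule Bochner_Integration.integrable_bound)
    show "integrable lborel (\<lambda>x. indicator {-8..<8} x + (H x)^2)"
      by (intro Bochner_Integration.integrable_add iH2) (simp add: integrable_real_indicator)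
    have "n x powr (Q/2) \<le> 1 + n x powr Q" for x
      using powr_mono[of "Q/2" Q "n x"] n1[of x] Q by simp
    then show "AE x in lborel. norm (H x) \<le> norm (indicator {-8..<8} x + (H x)^2)"
      unfolding H2 by (auto simp: H_def indicator_def)
  qed simp
  show ?thesis
  proof (rule that[of H "4608^2", OF H0 iH iH2])
    fix t x :: real assume t: "t \<in> {0..2*pi}" and x: "0 < x" "x \<le> 1/2"
    define r where "r = 1 - x"
    have pi8: "2 * pi + 1/2 \<le> 8"
      using pi_approx by simp
    have tx: "-8 \<le> t - x" "t + x \<le> 8" using t x pi8 by auto
    define X where "X = (LINT \<theta>:{t-x..<t+x}|lborel. H \<theta>)"
    have si: "set_integrable lborel {t-x..<t+x} H"
      unfolding set_integrable_def by (intro integrable_mult_indicator iH) auto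
    have X2: "2 * x \<le> X"
    proof -
      have "(LINT \<theta>:{t-x..<t+x}|lborel. 1) \<le> X"
        unfolding X_def
      proof (rule set_integral_mono[OF _ si])
        show "set_integrable lborel {t-x..<t+x} (\<lambda>_. 1::real)"
          by (rule set_integrable_const_bounded) (use x in auto)
        show "1 \<le> H \<theta>" if "\<theta> \<in> {t-x..<t+x}" for \<theta>
          using that tx n1[of \<theta>] Q by (auto simp: H_def indicator_def intro: ge_one_powr_ge_zero)
      qed
      then show ?thesis using x by (simp add: set_integral_const)
    qed
    \<comment> \<open>Solves \<open>X = x * \<Lambda> powr (Q/2)\<close>, the form in which
      \<open>power_mean_le\<close> takes its hypothesis. The exponents there are 1/2 and
      \<open>Q/2\<close>, in this order because \<open>1 \<le> Q\<close>.\<close>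
    define \<Lambda> where "\<Lambda> = (X/x) powr (2/Q)"
    have \<Lambda>0: "0 < \<Lambda>" using X2 x by (simp add: \<Lambda>_def)
    have XL: "X = x * \<Lambda> powr (Q/2)" using X2 x Q by (simp add: \<Lambda>_def powr_powr)
    have sqn: "(\<integral>\<^sup>+\<theta>\<in>{t-x/2..t+x/2}. ennreal (n \<theta> powr (1/2)) \<partial>lborel) \<le> ennreal ((x + x) * \<Lambda> powr (1/2))"
    proof (rule power_mean_le[where b = "Q/2"])
      have "(\<integral>\<^sup>+\<theta>\<in>{t-x/2..t+x/2}. ennreal (n \<theta> powr (Q/2)) \<partial>lborel) \<le> (\<integral>\<^sup>+\<theta>\<in>{t-x..<t+x}. ennreal (H \<theta>) \<partial>lborel)"
        by (intro nn_integral_mono) (use x tx in \<open>auto simp: H_def indicator_def\<close>)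
      also have "\<dots> = ennreal X" unfolding X_def by (rule set_nn_integral_eq_ennreal[OF si H0])
      finally show "(\<integral>\<^sup>+\<theta>\<in>{t-x/2..t+x/2}. ennreal (n \<theta> powr (Q/2)) \<partial>lborel) \<le> ennreal (x * \<Lambda> powr (Q/2))"
        by (simp add: XL)
      show "0 \<le> n \<theta>" for \<theta> using n1[of \<theta>] by simp
    qed (use Q x \<Lambda>0 in auto)
    define T where "T = {r * exp (-x/2)..r * exp (x/2)}"
    have r: "1/2 \<le> r" "r < 1" using x by (auto simp: r_def)
    have e1: "exp (x/2) \<le> 1 + x/2 + (x/2)^2" using x by (intro exp_bound) auto
    have e2: "1 - x/2 \<le> exp (-x/2)" using exp_ge_add_one_self[of "-x/2"] by simp
    have xx: "x^2 \<le> x / 2" using x mult_left_mono[of x "1/2" x] by (simp add: power2_eq_square)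
    have up: "r * exp (x/2) < 1"
    proof -
      have "r * exp (x/2) \<le> (1 - x) * (1 + x/2 + (x/2)^2)"
        using e1 r by (simp add: r_def)
      also have "\<dots> = 1 - x/2 - x^2/4 - x * x^2/4" by (simp add: field_simps power2_eq_square)
      also have "\<dots> < 1" using x by (smt (verit) divide_nonneg_nonneg mult_nonneg_nonneg zero_le_power2 divide_pos_pos)
      finally show ?thesis .
    qed
    have len: "r * exp (x/2) - r * exp (-x/2) \<le> 2 * x"
    proof -
      have "exp (x/2) - exp (-x/2) \<le> 2 * x" using e1 e2 xx x by (simp add: power_divide)
      then have "r * (exp (x/2) - exp (-x/2)) \<le> 1 * (2 * x)" using r x by (intro mult_mono) auto
      then show ?thesis by (simp add: algebra_simps)
    qed
    define c where "c = 3 * x powr (1 - recip p0 / 2)"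
    have c0: "0 \<le> c" by (simp add: c_def)
    have "ennreal (sqrt (ray f t r)) \<le> ennreal (768 / x^2) *
      (\<integral>\<^sup>+\<theta>\<in>{t-x/2..t+x/2}. (\<integral>\<^sup>+\<rho>\<in>{r * exp (-x/2)..r * exp (x/2)}. ennreal (sqrt (ray f \<theta> \<rho>)) \<partial>lborel) \<partial>lborel)"
      by (rule box_estimate[OF hol r]) (simp add: r_def)
    also have "\<dots> \<le> ennreal (768 / x^2) * (\<integral>\<^sup>+\<theta>. ennreal c * (ennreal (n \<theta> powr (1/2)) * indicator {t-x/2..t+x/2} \<theta>) \<partial>lborel)"
    proof (rule mult_left_mono[OF nn_integral_mono_AE])
      show "AE \<theta> in lborel. (\<integral>\<^sup>+\<rho>\<in>{r * exp (-x/2)..r * exp (x/2)}. ennreal (sqrt (ray f \<theta> \<rho>)) \<partial>lborel) * indicator {t-x/2..t+x/2} \<theta>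
         \<le> ennreal c * (ennreal (n \<theta> powr (1/2)) * indicator {t-x/2..t+x/2} \<theta>)"
        using AEfin
      proof eventually_elim
        case (elim \<theta>)
        show ?case
        proof (cases "\<theta> \<in> {t-x/2..t+x/2}")
          case True
          then have "\<theta> \<in> {-8..<8}" using tx x by auto
          with elim have "rnorm p0 f \<theta> \<le> ennreal (n \<theta>)" by (simp add: N_def)
          then have "(\<integral>\<^sup>+\<rho>\<in>{r * exp (-x/2)..r * exp (x/2)}. ennreal (sqrt (ray f \<theta> \<rho>)) \<partial>lborel) \<le> ennreal (c * sqrt (n \<theta>))"
            unfolding c_def using n1[of \<theta>] r x up len by (intro inner_estimate[OF hol p0]) auto
          then show ?thesis using True c0 n1[of \<theta>] by (simp add: ennreal_mult' powr_half_sqrt)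
        qed simp
      qed
    qed simp
    also have "(\<integral>\<^sup>+\<theta>. ennreal c * (ennreal (n \<theta> powr (1/2)) * indicator {t-x/2..t+x/2} \<theta>) \<partial>lborel)
       = ennreal c * (\<integral>\<^sup>+\<theta>\<in>{t-x/2..t+x/2}. ennreal (n \<theta> powr (1/2)) \<partial>lborel)"
      by (rule nn_integral_cmult) measurable
    also have "ennreal (768 / x^2) * \<dots> \<le> ennreal (768 / x^2) * (ennreal c * ennreal ((x + x) * \<Lambda> powr (1/2)))"
      by (intro mult_left_mono sqn) auto
    also have "\<dots> = ennreal (768 / x^2 * (c * ((x + x) * \<Lambda> powr (1/2))))"
      using c0 x by (simp add: ennreal_mult'[symmetric])
    finally have "sqrt (ray f t r) \<le> 768 / x^2 * (c * ((x + x) * \<Lambda> powr (1/2)))"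
      using c0 x by (subst (asm) ennreal_le_iff) auto
    \<comment> \<open>4608 = 768 * 3 * 2, and the powers of \<open>x\<close> are -2 from the box, 1
      - 1/(2 p0) from the radial and 1 from the angular integral.\<close>
    also have "\<dots> = 4608 * (x powr (- recip p0 / 2) * \<Lambda> powr (1/2))"
      using x by (simp add: c_def powr_diff powr_minus_divide power2_eq_square)
    finally have "(sqrt (ray f t r))^2 \<le> (4608 * (x powr (- recip p0 / 2) * \<Lambda> powr (1/2)))^2"
      by (rule power_mono) simp
    also have "\<dots> = 4608^2 * x powr (- recip p0) * \<Lambda>"
      using x \<Lambda>0 by (simp add: power_mult_distrib powr_power)
    finally show "ray f t (1 - x) \<le> 4608^2 * x powr (- recip p0) * ((LINT \<theta>:{t-x..<t+x}|lborel. H \<theta>) / x) powr (2/Q)"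
      by (simp add: r_def \<Lambda>_def X_def)
  qed simp
qed

section \<open>Inclusions\<close>

lemma nn_integral_powr_from_0:
  assumes "a < 1" "0 \<le> c"
  shows "(\<integral>\<^sup>+x\<in>{0..c}. ennreal (x powr (-a)) \<partial>lborel) = ennreal (c powr (1 - a) / (1 - a))"
  using nn_integral_has_integral_lebesgue'[OF _ has_integral_powr_from_0[of "-a" c]] assms by simp

lemma nn_integral_powr_to_inf:
  assumes "1 < b" "0 < c"
  shows "(\<integral>\<^sup>+x\<in>{c..}. ennreal (x powr (-b)) \<partial>lborel) = ennreal (c powr (1 - b) / (b - 1))"
proof -
  have "- (c powr (- b + 1)) / (- b + 1) = c powr (1 - b) / (b - 1)"
    by (metis add.commute add_uminus_conv_diff minus_diff_eq minus_divide_divide)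
  then show ?thesis
    using nn_integral_has_integral_lebesgue'[OF _ has_integral_powr_to_inf[of "-b" c]] assms by simp
qed

lemma nn_integral_ray_powr_le:
  assumes "0 < P" "0 \<le> C" "P * g < 1" "0 \<le> d"
    and le: "\<And>x. 0 < x \<Longrightarrow> x \<le> d \<Longrightarrow> ray f t (1 - x) \<le> C * x powr (-g)"
  shows "(\<integral>\<^sup>+x\<in>{0<..d}. ennreal (ray f t (1 - x) powr P) \<partial>lborel)
    \<le> ennreal (C powr P * (d powr (1 - P * g) / (1 - P * g)))"
proof -
  have "(\<integral>\<^sup>+x\<in>{0<..d}. ennreal (ray f t (1 - x) powr P) \<partial>lborel) \<le> (\<integral>\<^sup>+x. ennreal (C powr P) * (ennreal (x powr (-(P*g))) * indicator {0..d} x) \<partial>lborel)"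
  proof (rule nn_integral_mono)
    fix x :: real
    show "ennreal (ray f t (1 - x) powr P) * indicator {0<..d} x \<le> ennreal (C powr P) * (ennreal (x powr (-(P*g))) * indicator {0..d} x)"
    proof (cases "x \<in> {0<..d}")
      case True
      then have "ray f t (1 - x) powr P \<le> (C * x powr (-g)) powr P"
        using assms by (intro powr_mono2) auto
      also have "\<dots> = C powr P * x powr (-(P*g))" using assms by (simp add: powr_mult powr_powr mult.commute)
      finally have "ennreal (ray f t (1 - x) powr P) \<le> ennreal (C powr P * x powr (-(P*g)))" by (rule ennreal_leI)
      then show ?thesis using True by (simp add: ennreal_mult')
    qed simp
  qed
  also have "\<dots> = ennreal (C powr P * (d powr (1 - P * g) / (1 - P * g)))"
    using assms by (simp add: nn_integral_cmult nn_integral_powr_from_0 flip: ennreal_mult')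
  finally show ?thesis .
qed

lemma radial_int_reflect:
  assumes "f holomorphic_on ball 0 1"
  shows "radial_int P f t = (\<integral>\<^sup>+x\<in>{0<..1}. ennreal (ray f t (1 - x) powr P) \<partial>lborel)"
proof -
  have "radial_int P f t = (\<integral>\<^sup>+x. ennreal (ray f t (1 - x) powr P) * indicator {0..<1} (1 - x) \<partial>lborel)"
    unfolding radial_int_ray
    using nn_integral_real_affine[OF ray_powr_measurable[OF assms, of "{0..<1}" t P], of "-1" 1] by simp
  also have "\<dots> = (\<integral>\<^sup>+x\<in>{0<..1}. ennreal (ray f t (1 - x) powr P) \<partial>lborel)"
    by (intro nn_integral_cong) (auto simp: indicator_def)
  finally show ?thesis .
qed

lemma ray_reflect_measurable:
  assumes "f holomorphic_on ball 0 1"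
  shows "(\<lambda>x. ennreal (ray f t (1 - x) powr P) * indicator {0<..1} x) \<in> borel_measurable borel"
proof -
  have "(\<lambda>x. (\<lambda>r. ennreal (ray f t r powr P) * indicator {0..<1} r) (1 - x)) \<in> borel_measurable borel"
    by (rule measurable_compose[OF _ ray_powr_measurable[OF assms, of "{0..<1}" t P]]) auto
  also have "(\<lambda>x. (\<lambda>r. ennreal (ray f t r powr P) * indicator {0..<1} r) (1 - x))
     = (\<lambda>x. ennreal (ray f t (1 - x) powr P) * indicator {0<..1} x)"
    by (auto simp: indicator_def)
  finally show ?thesis .
qed

lemma ray_bounded_near_0:
  assumes "f holomorphic_on ball 0 1"
  obtains M where "0 < M" "\<And>t r. 0 \<le> r \<Longrightarrow> r \<le> 1/2 \<Longrightarrow> ray f t r \<le> M"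
proof -
  have "continuous_on (cball 0 (1/2)) f"
    by (rule continuous_on_subset[OF holomorphic_on_imp_continuous_on[OF assms]]) auto
  then have "bounded (f ` cball 0 (1/2))"
    by (intro compact_imp_bounded compact_continuous_image) auto
  then obtain M where M: "0 < M" "\<And>z. z \<in> cball 0 (1/2) \<Longrightarrow> norm (f z) \<le> M"
    by (auto simp: bounded_pos)
  show ?thesis by (rule that[OF M(1)]) (auto simp: ray_def norm_mult intro!: M(2))
qed

text \<open>The pointwise estimates hold only for \<open>x \<le> 1/2\<close>, that is near the
  circle; the inner half of each ray contributes a constant independent of \<open>t\<close>.\<close>

lemma radial_int_le_split:
  assumes f: "f holomorphic_on ball 0 1" and "0 < P" "0 < M"
    and M: "\<And>t r. 0 \<le> r \<Longrightarrow> r \<le> 1/2 \<Longrightarrow> ray f t r \<le> M"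
  shows "radial_int P f t \<le> ennreal (M powr P) + (\<integral>\<^sup>+x\<in>{0<..1/2}. ennreal (ray f t (1 - x) powr P) \<partial>lborel)"
proof -
  have m: "(\<lambda>x. ennreal (ray f t (1 - x) powr P) * indicator {0<..1/2} x) \<in> borel_measurable lborel"
  proof -
    note [measurable] = ray_reflect_measurable[OF f, of t P]
    have "(\<lambda>x. ennreal (ray f t (1 - x) powr P) * indicator {0<..1} x * indicator {0<..1/2} x) \<in> borel_measurable lborel" by measurable
    also have "(\<lambda>x. ennreal (ray f t (1 - x) powr P) * indicator {0<..1} x * indicator {0<..1/2} x)
       = (\<lambda>x. ennreal (ray f t (1 - x) powr P) * indicator {0<..1/2} x)"
      by (auto simp: indicator_def)
    finally show ?thesis .
  qed
  have "radial_int P f t \<le> (\<integral>\<^sup>+x. ennreal (M powr P) * indicator {0..1} x + ennreal (ray f t (1 - x) powr P) * indicator {0<..1/2} x \<partial>lborel)"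
    unfolding radial_int_reflect[OF f]
  proof (rule nn_integral_mono)
    fix x :: real
    show "ennreal (ray f t (1 - x) powr P) * indicator {0<..1} x \<le> ennreal (M powr P) * indicator {0..1} x + ennreal (ray f t (1 - x) powr P) * indicator {0<..1/2} x"
      using M[of "1-x" t] assms(2) by (auto simp: indicator_def intro!: ennreal_leI powr_mono2)
  qed
  also have "\<dots> = ennreal (M powr P) + (\<integral>\<^sup>+x\<in>{0<..1/2}. ennreal (ray f t (1 - x) powr P) \<partial>lborel)"
    using m by (subst nn_integral_add) (auto simp: nn_integral_cmult_indicator)
  finally show ?thesis .
qed

text \<open>Hedberg's trick: two power bounds are balanced at \<open>\<delta> = y powr (- 1 / (b - a))\<close>.\<close>

lemma nn_integral_two_powers_le:
  assumes "a < 1" "1 < b" "0 < y" "0 \<le> C"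
    and le: "\<And>x. 0 < x \<Longrightarrow> x \<le> d \<Longrightarrow> \<phi> x \<le> C * x powr (-a) * y \<and> \<phi> x \<le> C * x powr (-b)"
  shows "(\<integral>\<^sup>+x\<in>{0<..d}. ennreal (\<phi> x) \<partial>lborel) \<le> ennreal (C * (1/(1-a) + 1/(b-1)) * y powr ((b-1)/(b-a)))"
proof -
  define \<delta> where "\<delta> = y powr (- 1 / (b - a))"
  have \<delta>: "0 < \<delta>" using assms by (simp add: \<delta>_def)
  have e1: "y * \<delta> powr (1 - a) = y powr ((b-1)/(b-a))"
  proof -
    have "y * \<delta> powr (1 - a) = y powr (1 + (- 1 / (b - a)) * (1 - a))"
      using powr_add[of y 1 "(- 1 / (b - a)) * (1 - a)"] assms by (simp add: \<delta>_def powr_powr)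
    also have "1 + (- 1 / (b - a)) * (1 - a) = (b-1)/(b-a)" using assms by (simp add: field_simps)
    finally show ?thesis .
  qed
  have e2: "\<delta> powr (1 - b) = y powr ((b-1)/(b-a))"
  proof -
    have "\<delta> powr (1 - b) = y powr ((- 1 / (b - a)) * (1 - b))"
      using assms by (simp add: \<delta>_def powr_powr)
    also have "(- 1 / (b - a)) * (1 - b) = (b-1)/(b-a)" using assms by (simp add: field_simps)
    finally show ?thesis .
  qed
  have "(\<integral>\<^sup>+x\<in>{0<..d}. ennreal (\<phi> x) \<partial>lborel) \<le>
     (\<integral>\<^sup>+x. ennreal (C * y) * (ennreal (x powr (-a)) * indicator {0..\<delta>} x) + ennreal C * (ennreal (x powr (-b)) * indicator {\<delta>..} x) \<partial>lborel)"
  proof (rule nn_integral_mono)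
    fix x :: real
    show "ennreal (\<phi> x) * indicator {0<..d} x \<le>
      ennreal (C * y) * (ennreal (x powr (-a)) * indicator {0..\<delta>} x) + ennreal C * (ennreal (x powr (-b)) * indicator {\<delta>..} x)"
    proof (cases "x \<in> {0<..d}")
      case True
      show ?thesis
      proof (cases "x \<le> \<delta>")
        case x: True
        have "ennreal (\<phi> x) \<le> ennreal (C * y * x powr (-a))" using le[of x] True by (intro ennreal_leI) (auto simp: mult_ac)
        also have "\<dots> = ennreal (C * y) * (ennreal (x powr (-a)) * indicator {0..\<delta>} x)"
          using True x assms by (simp add: ennreal_mult')
        finally show ?thesis using True by (auto intro: add_increasing2)
      next
        case False
        have "ennreal (\<phi> x) \<le> ennreal (C * x powr (-b))" using le[of x] True by (intro ennreal_leI) (auto simp: mult_ac)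
        also have "\<dots> = ennreal C * (ennreal (x powr (-b)) * indicator {\<delta>..} x)"
          using True False assms by (simp add: ennreal_mult')
        finally show ?thesis using True by (auto intro: add_increasing)
      qed
    qed simp
  qed
  also have "\<dots> = ennreal (C * y) * ennreal (\<delta> powr (1 - a) / (1 - a)) + ennreal C * ennreal (\<delta> powr (1 - b) / (b - 1))"
    using assms \<delta> by (simp add: nn_integral_add nn_integral_cmult nn_integral_powr_from_0 nn_integral_powr_to_inf)
  also have "\<dots> = ennreal (C * y * (\<delta> powr (1 - a) / (1 - a)) + C * (\<delta> powr (1 - b) / (b - 1)))"
    using assms by (simp add: ennreal_mult'[symmetric] ennreal_plus[symmetric] del: ennreal_plus)
  also have "C * y * (\<delta> powr (1 - a) / (1 - a)) + C * (\<delta> powr (1 - b) / (b - 1)) = C * (1/(1-a) + 1/(b-1)) * y powr ((b-1)/(b-a))"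
    unfolding e1[symmetric] using e2[folded e1] by (simp add: algebra_simps)
  finally show ?thesis .
qed

section \<open>The two pointwise bounds and the critical line\<close>

text \<open>Cauchy-Schwarz on an interval of length \<open>2 * x\<close>: the averages grow at most
  like \<open>x powr (-1/2)\<close>. This is the bound by the norm of \<open>H\<close> that is
  balanced against the maximal function.\<close>

lemma interval_average_power2_le:
  fixes H :: "real \<Rightarrow> real"
  assumes H: "integrable lborel H" "integrable lborel (\<lambda>x. (H x)^2)" and "0 < x"
  shows "((LINT \<theta>:{t-x..<t+x}|lborel. H \<theta>) / x)^2 \<le> 2 * (LINT x|lborel. (H x)^2) / x"
proof -
  have si: "set_integrable lborel S H" "set_integrable lborel S (\<lambda>x. (H x)^2)" if "S \<in> sets lborel" for S
    using H that by (auto simp: set_integrable_def integrable_mult_indicator simp del: real_scaleR_def)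
  have e: "t - x + 2 * x = t + x" by simp
  have "(LINT \<theta>:{t-x..<t+x}|lborel. H \<theta>)^2 \<le> 2 * x * (LINT \<theta>:{t-x..<t+x}|lborel. (H \<theta>)^2)"
    using set_integral_power2_ge[of "t-x" "2*x" H, unfolded e] si assms by simp
  also have "\<dots> \<le> 2 * x * (LINT x|lborel. (H x)^2)"
  proof (rule mult_left_mono)
    show "(LINT \<theta>:{t-x..<t+x}|lborel. (H \<theta>)^2) \<le> (LINT x|lborel. (H x)^2)"
      unfolding set_lebesgue_integral_def
      by (rule integral_mono) (use H si(2)[of "{t-x..<t+x}"] in \<open>auto simp: set_integrable_def indicator_def\<close>)
  qed (use \<open>0 < x\<close> in simp)
  finally have "(LINT \<theta>:{t-x..<t+x}|lborel. H \<theta>)^2 \<le> 2 * x * (LINT x|lborel. (H x)^2)" .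
  then have "(LINT \<theta>:{t-x..<t+x}|lborel. H \<theta>)^2 / x^2 \<le> 2 * x * (LINT x|lborel. (H x)^2) / x^2"
    by (rule divide_right_mono) simp
  then show ?thesis using \<open>0 < x\<close> by (simp add: power_divide power2_eq_square)
qed

text \<open>Two estimates of the same average. Cauchy-Schwarz gives a bound uniform in
  \<open>t\<close> that grows like \<open>x powr (-1/Q)\<close>; the maximal function gives one free
  of growth in \<open>x\<close> but dependent on \<open>t\<close>. Since \<open>W\<close> may be
  infinite, the latter is stated through an arbitrary real \<open>w\<close> with
  \<open>W t \<le> ennreal (w^2)\<close>.\<close>

lemma RM_pointwise_growth:
  assumes f: "f \<in> RM p0 (ennreal Q)" and p0: "1 \<le> p0" and Q: "1 \<le> Q"
  obtains W :: "real \<Rightarrow> ennreal" and C where "W \<in> borel_measurable borel"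
    "(\<integral>\<^sup>+t\<in>{0..<2*pi}. W t \<partial>lborel) < \<infinity>" "0 < C"
    "\<And>t x. t \<in> {0..2*pi} \<Longrightarrow> 0 < x \<Longrightarrow> x \<le> 1/2 \<Longrightarrow> ray f t (1 - x) \<le> C * x powr (- (recip p0 + 1/Q))"
    "\<And>t x w. t \<in> {0..2*pi} \<Longrightarrow> 0 < x \<Longrightarrow> x \<le> 1/2 \<Longrightarrow> 0 \<le> w \<Longrightarrow> W t \<le> ennreal (w^2) \<Longrightarrow>
       ray f t (1 - x) \<le> C * x powr (- recip p0) * w powr (2/Q)"
proof -
  obtain H :: "real \<Rightarrow> real" and C where H: "\<And>x. 0 \<le> H x" "integrable lborel H" "integrable lborel (\<lambda>x. (H x)^2)"
    and C: "0 < C" and le: "\<And>t x. t \<in> {0..2*pi} \<Longrightarrow> 0 < x \<Longrightarrow> x \<le> 1/2 \<Longrightarrow>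
       ray f t (1 - x) \<le> C * x powr (- recip p0) * ((LINT \<theta>:{t-x..<t+x}|lborel. H \<theta>) / x) powr (2/Q)"
    by (rule RM_pointwise_average[OF assms]) (rule that; assumption)
  obtain W :: "real \<Rightarrow> ennreal" where W[measurable]: "W \<in> borel_measurable borel"
    and WI: "(\<integral>\<^sup>+t\<in>{-8..<8}. W t \<partial>lborel) \<le> 1152 * (\<integral>\<^sup>+x. ennreal ((H x)^2) \<partial>lborel)"
    and WA: "\<And>t x. 0 < x \<Longrightarrow> x \<le> 2 \<Longrightarrow> -8 \<le> t - x \<Longrightarrow> t + x \<le> 8 \<Longrightarrow>
       ennreal (((LINT \<theta>:{t-x..<t+x}|lborel. H \<theta>) / x)^2) \<le> W t"
    by (rule maximal_function_L2[OF H]) (rule that; assumption)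
  define Y where "Y = (LINT x|lborel. (H x)^2)"
  define D where "D = C * ((sqrt (2 * Y)) powr (2/Q) + 1)"
  have D: "C \<le> D" "C * (sqrt (2 * Y)) powr (2/Q) \<le> D" "0 < D"
    using C by (auto simp: D_def algebra_simps intro: add_pos_nonneg add_nonneg_pos)
  have Av0: "0 \<le> (LINT \<theta>:{t-x..<t+x}|lborel. H \<theta>) / x" if "0 < x" for t x
    unfolding set_lebesgue_integral_def using that by (intro divide_nonneg_pos Bochner_Integration.integral_nonneg) (auto simp: H)
  have pi8: "2 * pi + 1/2 \<le> 8" using pi_approx by simp
  show ?thesis
  proof (rule that[of W D])
    have "(\<integral>\<^sup>+t\<in>{0..<2*pi}. W t \<partial>lborel) \<le> (\<integral>\<^sup>+t\<in>{-8..<8}. W t \<partial>lborel)"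
      using pi8 by (intro nn_integral_mono) (auto simp: indicator_def)
    also have "\<dots> \<le> 1152 * ennreal Y"
      using WI H by (simp add: nn_integral_eq_integral Y_def)
    also have "\<dots> < \<infinity>" by (simp add: ennreal_mult_less_top)
    finally show "(\<integral>\<^sup>+t\<in>{0..<2*pi}. W t \<partial>lborel) < \<infinity>" .
  next
    fix t x :: real assume t: "t \<in> {0..2*pi}" and x: "0 < x" "x \<le> 1/2"
    let ?A = "(LINT \<theta>:{t-x..<t+x}|lborel. H \<theta>) / x"
    have "?A^2 \<le> 2 * Y / x" unfolding Y_def by (rule interval_average_power2_le) fact+
    then have "?A \<le> sqrt (2 * Y / x)" by (rule real_le_rsqrt)
    also have "\<dots> = sqrt (2 * Y) * x powr (-1/2)"
      using x by (simp add: real_sqrt_divide powr_minus_divide powr_half_sqrt)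
    finally have "?A powr (2/Q) \<le> (sqrt (2 * Y) * x powr (-1/2)) powr (2/Q)"
      using Av0[OF x(1), of t] Q by (intro powr_mono2) auto
    also have "\<dots> = sqrt (2 * Y) powr (2/Q) * x powr (-1/Q)"
      using H by (simp add: powr_mult powr_powr Y_def)
    finally have "C * x powr (- recip p0) * ?A powr (2/Q) \<le> C * x powr (- recip p0) * (sqrt (2 * Y) powr (2/Q) * x powr (-1/Q))"
      using C by (intro mult_left_mono) auto
    with le[OF t x] have "ray f t (1 - x) \<le> C * x powr (- recip p0) * (sqrt (2 * Y) powr (2/Q) * x powr (-1/Q))"
      by (rule order_trans)
    also have "\<dots> = (C * sqrt (2 * Y) powr (2/Q)) * x powr (- (recip p0 + 1/Q))"
      by (simp add: powr_add[symmetric] minus_divide_left[symmetric])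
    also have "\<dots> \<le> D * x powr (- (recip p0 + 1/Q))" using D by (intro mult_right_mono) auto
    finally show "ray f t (1 - x) \<le> D * x powr (- (recip p0 + 1/Q))" .
  next
    fix t x w :: real assume t: "t \<in> {0..2*pi}" and x: "0 < x" "x \<le> 1/2" and w: "0 \<le> w" "W t \<le> ennreal (w^2)"
    let ?A = "(LINT \<theta>:{t-x..<t+x}|lborel. H \<theta>) / x"
    have "ennreal (?A^2) \<le> ennreal (w^2)" by (rule order_trans[OF WA w(2)]) (use t x pi8 in auto)
    then have "?A^2 \<le> w^2" by (simp add: ennreal_le_iff)
    then have "?A \<le> w" using w(1) by (rule power2_le_imp_le)
    then have "?A powr (2/Q) \<le> w powr (2/Q)" using Av0[OF x(1), of t] Q by (intro powr_mono2) auto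
    then have "C * x powr (- recip p0) * ?A powr (2/Q) \<le> D * x powr (- recip p0) * w powr (2/Q)"
      using D C by (intro mult_mono) auto
    with le[OF t x] show "ray f t (1 - x) \<le> D * x powr (- recip p0) * w powr (2/Q)" by linarith
  qed (use D in auto)
qed

text \<open>The hypothesis \<open>Q0 < Q\<close> gives \<open>a < 1\<close> and the finiteness of
  \<open>Q\<close> gives \<open>b > 1\<close>, so the two bounds can be balanced. The result is
  \<open>y powr (Q0/Q)\<close> with \<open>y = w powr (2 * P / Q0)\<close>; its power
  \<open>Q/P\<close> is exactly \<open>w^2\<close>, hence integrable in \<open>t\<close>.\<close>

lemma RM_subset_critical:
  assumes p0: "1 \<le> p0" and Q0: "1 \<le> Q0" and Q: "Q0 < Q" and P: "0 < P"
    and crit: "1 / P + 1 / Q = recip p0 + 1 / Q0"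
  shows "RM p0 (ennreal Q0) \<subseteq> RM (ennreal P) (ennreal Q)"
proof
  fix f assume f: "f \<in> RM p0 (ennreal Q0)"
  have hol: "f holomorphic_on ball 0 1" using f by (rule RM_holomorphic)
  obtain W :: "real \<Rightarrow> ennreal" and C where W[measurable]: "W \<in> borel_measurable borel"
    and WI: "(\<integral>\<^sup>+t\<in>{0..<2*pi}. W t \<partial>lborel) < \<infinity>" and C: "0 < C"
    and le1: "\<And>t x. t \<in> {0..2*pi} \<Longrightarrow> 0 < x \<Longrightarrow> x \<le> 1/2 \<Longrightarrow> ray f t (1 - x) \<le> C * x powr (- (recip p0 + 1/Q0))"
    and le2: "\<And>t x w. t \<in> {0..2*pi} \<Longrightarrow> 0 < x \<Longrightarrow> x \<le> 1/2 \<Longrightarrow> 0 \<le> w \<Longrightarrow> W t \<le> ennreal (w^2) \<Longrightarrow>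
       ray f t (1 - x) \<le> C * x powr (- recip p0) * w powr (2/Q0)"
    by (rule RM_pointwise_growth[OF f p0 Q0]) (rule that; assumption)
  obtain M where M: "0 < M" "\<And>t r. 0 \<le> r \<Longrightarrow> r \<le> 1/2 \<Longrightarrow> ray f t r \<le> M"
    by (rule ray_bounded_near_0[OF hol]) (rule that; assumption)
  define a b where "a = P * recip p0" and "b = P * (recip p0 + 1/Q0)"
  have Q': "0 < Q" "1/Q < 1/Q0" using Q Q0 by (auto simp: field_simps)
  have a: "a < 1"
  proof -
    have "recip p0 < 1 / P" using crit Q' by linarith
    then show ?thesis using P by (simp add: a_def field_simps)
  qed
  have b: "b = 1 + P/Q" using P unfolding b_def crit[symmetric] by (simp add: field_simps)
  have ba: "b - a = P / Q0" by (simp add: a_def b_def algebra_simps)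
  have b1: "1 < b" using P Q' by (simp add: b)
  have expo: "(b - 1) / (b - a) = Q0 / Q" using P Q' Q0 by (simp add: ba) (simp add: b)
  define K where "K = M powr P + C powr P * (1/(1-a) + 1/(b-1))"
  have K: "0 \<le> K" using a b1 by (simp add: K_def)
  define L where "L = K powr (Q / P)"
  have pt: "rnorm (ennreal P) f t epowr Q \<le> ennreal L * (1 + W t)" if t: "t \<in> {0..<2*pi}" for t
  proof (cases "W t")
    case (real u)
    \<comment> \<open>At least 1, so that \<open>y \<ge> 1\<close> and the contribution of the inner
      half of the ray is absorbed in \<open>K * y powr (Q0/Q)\<close>.\<close>
    define w where "w = max 1 (sqrt u)"
    have w: "1 \<le> w" "0 \<le> w" by (auto simp: w_def)
    have uw: "u \<le> w^2" using real by (auto simp: w_def max_def)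
    have w2: "w^2 \<le> 1 + u" using real by (auto simp: w_def max_def)
    define y where "y = (w powr (2/Q0)) powr P"
    have y: "1 \<le> y" using w Q0 P by (simp add: y_def ge_one_powr_ge_zero)
    have "(\<integral>\<^sup>+x\<in>{0<..1/2}. ennreal (ray f t (1 - x) powr P) \<partial>lborel) \<le> ennreal (C powr P * (1/(1-a) + 1/(b-1)) * y powr ((b-1)/(b-a)))"
    proof (rule nn_integral_two_powers_le[OF a b1])
      fix x :: real assume x: "0 < x" "x \<le> 1/2"
      have "ray f t (1 - x) \<le> C * x powr (- recip p0) * w powr (2/Q0)"
        by (rule le2) (use t x w uw real in \<open>auto intro: ennreal_leI\<close>)
      then have "ray f t (1 - x) powr P \<le> (C * x powr (- recip p0) * w powr (2/Q0)) powr P"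
        using P by (intro powr_mono2) auto
      also have "\<dots> = C powr P * x powr (-a) * y"
        using C P by (simp add: powr_mult powr_powr y_def a_def mult.commute)
      finally have 1: "ray f t (1 - x) powr P \<le> C powr P * x powr (-a) * y" .
      have "ray f t (1 - x) \<le> C * x powr (- (recip p0 + 1/Q0))"
        by (rule le1) (use t x in auto)
      then have "ray f t (1 - x) powr P \<le> (C * x powr (- (recip p0 + 1/Q0))) powr P"
        using P by (intro powr_mono2) auto
      also have "\<dots> = C powr P * x powr (-b)"
      proof -
        have "(C * x powr g) powr P = C powr P * x powr (g * P)" for g
          using C by (simp add: powr_mult powr_powr)
        moreover have "- (recip p0 + 1/Q0) * P = - b" by (simp add: b_def algebra_simps)
        ultimately show ?thesis by simp
      qed
      finally show "ray f t (1 - x) powr P \<le> C powr P * x powr (-a) * y \<and> ray f t (1 - x) powr P \<le> C powr P * x powr (-b)"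
        using 1 by simp
    qed (use y in auto)
    then have "radial_int P f t \<le> ennreal (M powr P) + ennreal (C powr P * (1/(1-a) + 1/(b-1)) * y powr (Q0/Q))"
      unfolding expo by - (rule order_trans[OF radial_int_le_split[OF hol P M(1) M(2)]], simp, simp, rule add_left_mono)
    also have "\<dots> = ennreal (M powr P * 1 + C powr P * (1/(1-a) + 1/(b-1)) * y powr (Q0/Q))"
      using a b1 by (simp add: ennreal_plus)
    also have "\<dots> \<le> ennreal (K * y powr (Q0/Q))"
      unfolding K_def distrib_right using y Q0 Q' a b1 by (intro ennreal_leI add_mono mult_left_mono) (auto simp: ge_one_powr_ge_zero)
    finally have "radial_int P f t epowr (Q / P) \<le> ennreal (K * y powr (Q0/Q)) epowr (Q / P)"
      using P Q' by (intro epowr_mono) auto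
    also have "\<dots> = ennreal ((K * y powr (Q0/Q)) powr (Q/P))" using K by (simp add: epowr_ennreal)
    also have "(K * y powr (Q0/Q)) powr (Q/P) = L * w^2"
    proof -
      have "(y powr (Q0/Q)) powr (Q/P) = w powr 2"
        using P Q' Q0 by (simp add: y_def powr_powr)
      then show ?thesis using K w by (simp add: L_def powr_mult)
    qed
    also have "ennreal (L * w^2) \<le> ennreal (L * (1 + u))" using w2 by (intro ennreal_leI mult_left_mono) (auto simp: L_def)
    also have "\<dots> = ennreal L * (1 + W t)" using real by (simp add: ennreal_mult' ennreal_plus L_def)
    finally show ?thesis using P by (simp add: rnorm_def epowr_epowr)
  next
    case top
    have "0 < K" unfolding K_def using M a b1 by (intro add_pos_nonneg) auto
    then have "0 < L" by (simp add: L_def)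
    then show ?thesis using top by (simp add: ennreal_mult_top)
  qed
  have "(\<integral>\<^sup>+t\<in>{0..<2*pi}. rnorm (ennreal P) f t epowr Q \<partial>lborel) \<le>
     (\<integral>\<^sup>+t. ennreal L * (indicator {0..<2*pi} t + W t * indicator {0..<2*pi} t) \<partial>lborel)"
    by (intro nn_integral_mono) (use pt in \<open>auto simp: indicator_def\<close>)
  also have "\<dots> = ennreal L * (ennreal (2*pi) + (\<integral>\<^sup>+t\<in>{0..<2*pi}. W t \<partial>lborel))"
    by (simp add: nn_integral_cmult nn_integral_add)
  also have "\<dots> < \<infinity>" using WI by (simp add: ennreal_mult_less_top)
  finally show "f \<in> RM (ennreal P) (ennreal Q)" using RM_fin[of "ennreal P" Q] P Q' hol by simp
qed

text \<open>Off the critical line the growth bound by itself has an integrable \<open>P\<close>-th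
  power on each ray, uniformly in \<open>t\<close>.\<close>

lemma RM_subset_top:
  assumes p0: "1 \<le> p0" and Q0: "1 \<le> Q0" and P: "0 < P" and sub: "recip p0 + 1 / Q0 < 1 / P"
  shows "RM p0 (ennreal Q0) \<subseteq> RM (ennreal P) \<infinity>"
proof
  fix f assume f: "f \<in> RM p0 (ennreal Q0)"
  have hol: "f holomorphic_on ball 0 1" using f by (rule RM_holomorphic)
  define g where "g = recip p0 + 1/Q0"
  obtain C where C: "0 < C" and "\<And>t x. t \<in> {0..2*pi} \<Longrightarrow> 0 < x \<Longrightarrow> x \<le> 1/2 \<Longrightarrow> ray f t (1 - x) \<le> C * x powr (- (recip p0 + 1/Q0))"
    by (rule RM_pointwise_growth[OF f p0 Q0]) (rule that; assumption)
  note le = this(2)[folded g_def]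
  obtain M where M: "0 < M" "\<And>t r. 0 \<le> r \<Longrightarrow> r \<le> 1/2 \<Longrightarrow> ray f t r \<le> M"
    by (rule ray_bounded_near_0[OF hol]) (rule that; assumption)
  have a: "P * g < 1" using sub P by (simp add: g_def field_simps)
  define K where "K = M powr P + C powr P * ((1/2) powr (1 - P * g) / (1 - P * g))"
  have K: "0 \<le> K" using a by (simp add: K_def)
  have "rnorm (ennreal P) f t \<le> ennreal (K powr (1/P))" if t: "t \<in> {0..<2*pi}" for t
  proof -
    have "(\<integral>\<^sup>+x\<in>{0<..1/2}. ennreal (ray f t (1 - x) powr P) \<partial>lborel) \<le> ennreal (C powr P * ((1/2) powr (1 - P * g) / (1 - P * g)))"
      by (rule nn_integral_ray_powr_le) (use P C a le t in auto)
    then have "radial_int P f t \<le> ennreal (M powr P) + ennreal (C powr P * ((1/2) powr (1 - P * g) / (1 - P * g)))"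
      by - (rule order_trans[OF radial_int_le_split[OF hol P M(1) M(2)]], simp, simp, rule add_left_mono)
    also have "\<dots> = ennreal ((K powr (1/P)) powr P)" using a K P by (simp add: K_def ennreal_plus powr_powr)
    finally show ?thesis using P by (simp add: rnorm_fin_le_iff)
  qed
  then have "AE t in lborel. t \<in> {0..<2*pi} \<longrightarrow> rnorm (ennreal P) f t \<le> ennreal (K powr (1/P))" by simp
  then show "f \<in> RM (ennreal P) \<infinity>" unfolding RM_top[OF P] using hol by blast
qed

section \<open>Hardy's inequality and the case of infinite \<open>p0\<close>\<close>

lemma nn_integral_abs_powr_le:
  assumes "0 < x"
  shows "(\<integral>\<^sup>+\<theta>\<in>{t-x..<t+x}. ennreal (\<bar>\<theta> - t\<bar> powr (-1/2)) \<partial>lborel) \<le> ennreal (4 * sqrt x)"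
proof -
  let ?g = "\<lambda>y. ennreal (y powr (-(1/2))) * indicator {0..x} y"
  have I: "(\<integral>\<^sup>+y. ?g y \<partial>lborel) = ennreal (2 * sqrt x)"
    using nn_integral_powr_from_0[of "1/2" x] assms by (simp add: powr_half_sqrt)
  have 1: "(\<integral>\<^sup>+\<theta>. ?g (\<theta> - t) \<partial>lborel) = ennreal (2 * sqrt x)" "(\<integral>\<^sup>+\<theta>. ?g (t - \<theta>) \<partial>lborel) = ennreal (2 * sqrt x)"
    using nn_integral_real_affine[of ?g 1 "-t"] nn_integral_real_affine[of ?g "-1" t] I by (simp_all add: add.commute)
  have "(\<integral>\<^sup>+\<theta>\<in>{t-x..<t+x}. ennreal (\<bar>\<theta> - t\<bar> powr (-1/2)) \<partial>lborel) \<le> (\<integral>\<^sup>+\<theta>. ?g (\<theta> - t) + ?g (t - \<theta>) \<partial>lborel)"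
  proof (rule nn_integral_mono)
    fix \<theta>
    show "ennreal (\<bar>\<theta> - t\<bar> powr (-1/2)) * indicator {t-x..<t+x} \<theta> \<le> ?g (\<theta> - t) + ?g (t - \<theta>)"
      by (cases "t \<le> \<theta>") (auto simp: indicator_def)
  qed
  also have "\<dots> = ennreal (2 * sqrt x) + ennreal (2 * sqrt x)"
    by (subst nn_integral_add, measurable) (simp only: 1)
  also have "\<dots> = ennreal (4 * sqrt x)" using assms by (simp flip: ennreal_plus)
  finally show ?thesis .
qed

text \<open>Schur's test with the weight \<open>\<bar>\<theta> - t\<bar> powr (1/2)\<close>.\<close>

lemma Hardy_L2:
  fixes H :: "real \<Rightarrow> real"
  assumes nn: "\<And>x. 0 \<le> H x" and H: "integrable lborel H"
  shows "(\<integral>\<^sup>+x\<in>{0<..}. ennreal (((LINT \<theta>:{t-x..<t+x}|lborel. H \<theta>) / x)^2) \<partial>lborel) \<le> 8 * (\<integral>\<^sup>+\<theta>. ennreal ((H \<theta>)^2) \<partial>lborel)"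
proof -
  have [measurable]: "H \<in> borel_measurable borel" using H by auto
  define k where "k \<theta> = ennreal (\<bar>\<theta> - t\<bar> powr (1/2) * (H \<theta>)^2)" for \<theta>
  have [measurable]: "k \<in> borel_measurable borel" unfolding k_def by measurable
  \<comment> \<open>Cauchy-Schwarz with the weight gives that the squared average is at most the
    integral of \<open>G x\<close>. Integrating first over x >= |theta - t| yields
    \<open>2 * \<bar>\<theta> - t\<bar> powr (-1/2)\<close>, which cancels the weight; this makes
    the constant 8 = 4 * 2.\<close>
  define G where "G = (\<lambda>x \<theta>. ennreal (4 * x powr (-3/2)) * k \<theta> * indicator {z. 0 < fst z \<and> \<bar>snd z - t\<bar> \<le> fst z} (x, \<theta>))"
  have Gm[measurable]: "case_prod G \<in> borel_measurable (lborel \<Otimes>\<^sub>M lborel)"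
  proof -
    have [measurable]: "{z::real\<times>real. 0 < fst z \<and> \<bar>snd z - t\<bar> \<le> fst z} \<in> sets (lborel \<Otimes>\<^sub>M lborel)"
    proof -
      have "{z::real\<times>real. 0 < fst z \<and> \<bar>snd z - t\<bar> \<le> fst z} = {z. 0 < fst z} \<inter> {z. \<bar>snd z - t\<bar> \<le> fst z}" by auto
      also have "\<dots> \<in> sets borel"
        by (intro sets.Int borel_open borel_closed open_Collect_less closed_Collect_le continuous_intros)
      finally show ?thesis unfolding lborel_prod by simp
    qed
    show ?thesis unfolding G_def by measurable
  qed
  have pt: "ennreal (((LINT \<theta>:{t-x..<t+x}|lborel. H \<theta>) / x)^2) \<le> (\<integral>\<^sup>+\<theta>. G x \<theta> \<partial>lborel)" if x: "0 < x" for x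
  proof -
    define X where "X = (LINT \<theta>:{t-x..<t+x}|lborel. H \<theta>)"
    have X0: "0 \<le> X" unfolding X_def set_lebesgue_integral_def by (rule Bochner_Integration.integral_nonneg) (auto simp: nn)
    let ?I = "indicator {t-x..<t+x} :: real \<Rightarrow> ennreal"
    let ?u = "\<lambda>\<theta>. ennreal (\<bar>\<theta> - t\<bar> powr (1/4) * H \<theta>) * ?I \<theta>"
    let ?v = "\<lambda>\<theta>. ennreal (\<bar>\<theta> - t\<bar> powr (-1/4)) * ?I \<theta>"
    have "ennreal X = (\<integral>\<^sup>+\<theta>\<in>{t-x..<t+x}. ennreal (H \<theta>) \<partial>lborel)"
      unfolding X_def by (rule set_nn_integral_eq_ennreal[symmetric])
        (auto simp: nn set_integrable_def integrable_mult_indicator H simp del: real_scaleR_def)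
    also have "\<dots> = (\<integral>\<^sup>+\<theta>. ?u \<theta> * ?v \<theta> \<partial>lborel)"
    \<comment> \<open>At \<open>\<theta> = t\<close> both powers are 0 by convention and their
      product is not 1, so the factorization holds only almost everywhere.\<close>
    proof (rule nn_integral_cong_AE)
      show "AE \<theta> in lborel. ennreal (H \<theta>) * ?I \<theta> = ?u \<theta> * ?v \<theta>"
        using AE_lborel_singleton[of t]
      proof eventually_elim
        case (elim \<theta>)
        have "\<bar>\<theta> - t\<bar> powr (1/4) * \<bar>\<theta> - t\<bar> powr (-1/4) = 1" using elim by (simp flip: powr_add)
        then have "H \<theta> = (\<bar>\<theta> - t\<bar> powr (1/4) * H \<theta>) * \<bar>\<theta> - t\<bar> powr (-1/4)"
          by (metis mult.assoc mult.commute mult.right_neutral)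
        then have "ennreal (H \<theta>) = ennreal (\<bar>\<theta> - t\<bar> powr (1/4) * H \<theta>) * ennreal (\<bar>\<theta> - t\<bar> powr (-1/4))"
          using nn[of \<theta>] by (metis ennreal_mult powr_ge_zero mult_nonneg_nonneg)
        then show ?case by (simp add: indicator_def)
      qed
    qed
    finally have "(ennreal X)^2 = (\<integral>\<^sup>+\<theta>. ?u \<theta> * ?v \<theta> \<partial>lborel)^2" by simp
    also have "\<dots> \<le> (\<integral>\<^sup>+\<theta>. (?u \<theta>)^2 \<partial>lborel) * (\<integral>\<^sup>+\<theta>. (?v \<theta>)^2 \<partial>lborel)"
      by (rule Cauchy_Schwarz_nn_integral) measurable
    also have "(\<integral>\<^sup>+\<theta>. (?u \<theta>)^2 \<partial>lborel) = (\<integral>\<^sup>+\<theta>. k \<theta> * ?I \<theta> \<partial>lborel)"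
    proof (rule nn_integral_cong)
      fix \<theta>
      have "(\<bar>\<theta> - t\<bar> powr (1/4) * H \<theta>)^2 = \<bar>\<theta> - t\<bar> powr (1/2) * (H \<theta>)^2"
        by (simp add: power_mult_distrib power2_eq_square flip: powr_add)
      then show "(?u \<theta>)^2 = k \<theta> * ?I \<theta>"
        using nn by (simp add: k_def indicator_def ennreal_power)
    qed
    also have "(\<integral>\<^sup>+\<theta>. (?v \<theta>)^2 \<partial>lborel) = (\<integral>\<^sup>+\<theta>\<in>{t-x..<t+x}. ennreal (\<bar>\<theta> - t\<bar> powr (-1/2)) \<partial>lborel)"
    proof (rule nn_integral_cong)
      fix \<theta>
      have "(\<bar>\<theta> - t\<bar> powr (-1/4))^2 = \<bar>\<theta> - t\<bar> powr (-1/2)"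
        by (simp add: power2_eq_square flip: powr_add)
      then show "(?v \<theta>)^2 = ennreal (\<bar>\<theta> - t\<bar> powr (-1/2)) * ?I \<theta>"
        by (simp add: indicator_def ennreal_power)
    qed
    also have "(\<integral>\<^sup>+\<theta>. k \<theta> * ?I \<theta> \<partial>lborel) * \<dots> \<le> (\<integral>\<^sup>+\<theta>. k \<theta> * ?I \<theta> \<partial>lborel) * ennreal (4 * sqrt x)"
      by (intro mult_left_mono nn_integral_abs_powr_le x) auto
    finally have "ennreal (1/x^2) * ennreal (X^2) \<le> ennreal (1/x^2) * ((\<integral>\<^sup>+\<theta>. k \<theta> * ?I \<theta> \<partial>lborel) * ennreal (4 * sqrt x))"
      using X0 by (intro mult_left_mono) (auto simp: ennreal_power)
    also have "\<dots> = ennreal (4 * sqrt x / x^2) * (\<integral>\<^sup>+\<theta>. k \<theta> * ?I \<theta> \<partial>lborel)"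
    proof -
      have "ennreal (4 * sqrt x / x^2) = ennreal (1/x^2) * ennreal (4 * sqrt x)"
        using x by (simp flip: ennreal_mult')
      then show ?thesis by (simp only: mult_ac)
    qed
    also have "4 * sqrt x / x^2 = 4 * x powr (-3/2)"
    proof -
      have "sqrt x / x^2 = x powr (1/2) / x powr 2" using x by (simp add: powr_half_sqrt)
      also have "\<dots> = x powr (-3/2)" by (simp flip: powr_diff)
      finally show ?thesis by simp
    qed
    also have "ennreal (4 * x powr (-3/2)) * (\<integral>\<^sup>+\<theta>. k \<theta> * ?I \<theta> \<partial>lborel) = (\<integral>\<^sup>+\<theta>. ennreal (4 * x powr (-3/2)) * (k \<theta> * ?I \<theta>) \<partial>lborel)"
      by (rule nn_integral_cmult[symmetric]) measurable
    also have "\<dots> \<le> (\<integral>\<^sup>+\<theta>. G x \<theta> \<partial>lborel)"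
      by (rule nn_integral_mono) (use x in \<open>auto simp: G_def indicator_def\<close>)
    also have "ennreal (1/x^2) * ennreal (X^2) = ennreal ((X/x)^2)"
      by (simp add: power_divide flip: ennreal_mult')
    finally show ?thesis by (simp add: X_def)
  qed
  have "(\<integral>\<^sup>+x\<in>{0<..}. ennreal (((LINT \<theta>:{t-x..<t+x}|lborel. H \<theta>) / x)^2) \<partial>lborel) \<le> (\<integral>\<^sup>+x. (\<integral>\<^sup>+\<theta>. G x \<theta> \<partial>lborel) \<partial>lborel)"
    by (rule nn_integral_mono) (use pt in \<open>auto simp: indicator_def\<close>)
  also have "\<dots> = (\<integral>\<^sup>+\<theta>. (\<integral>\<^sup>+x. G x \<theta> \<partial>lborel) \<partial>lborel)"
    by (rule lborel_pair.Fubini'[symmetric]) (use Gm in simp)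
  also have "\<dots> \<le> (\<integral>\<^sup>+\<theta>. 8 * ennreal ((H \<theta>)^2) \<partial>lborel)"
  proof (rule nn_integral_mono_AE)
    show "AE \<theta> in lborel. (\<integral>\<^sup>+x. G x \<theta> \<partial>lborel) \<le> 8 * ennreal ((H \<theta>)^2)"
      using AE_lborel_singleton[of t]
    proof eventually_elim
      case (elim \<theta>)
      define d where "d = \<bar>\<theta> - t\<bar>"
      have d: "0 < d" using elim by (simp add: d_def)
      have "(\<integral>\<^sup>+x. G x \<theta> \<partial>lborel) = (\<integral>\<^sup>+x. 4 * k \<theta> * (ennreal (x powr (-(3/2))) * indicator {d..} x) \<partial>lborel)"
        by (intro nn_integral_cong) (use d in \<open>auto simp: G_def d_def indicator_def ennreal_mult' mult_ac\<close>)
      also have "\<dots> = 4 * k \<theta> * ennreal (2 * d powr (-1/2))"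
        using nn_integral_powr_to_inf[of "3/2" d] d by (subst nn_integral_cmult) (simp_all add: mult.commute)
      also have "\<dots> = 4 * ennreal (d powr (1/2) * (H \<theta>)^2 * (2 * d powr (-1/2)))"
        by (simp add: k_def d_def mult.assoc flip: ennreal_mult')
      also have "d powr (1/2) * (H \<theta>)^2 * (2 * d powr (-1/2)) = 2 * (H \<theta>)^2"
      proof -
        have "d powr (1/2) * d powr (-1/2) = 1" using d by (simp flip: powr_add)
        then show ?thesis by (simp add: mult_ac)
      qed
      also have "4 * ennreal (2 * (H \<theta>)^2) = 8 * ennreal ((H \<theta>)^2)"
        by (simp add: ennreal_mult' mult.assoc[symmetric])
      finally show ?case by simp
    qed
  qed
  also have "\<dots> = 8 * (\<integral>\<^sup>+\<theta>. ennreal ((H \<theta>)^2) \<partial>lborel)"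
    by (rule nn_integral_cmult) measurable
  finally show ?thesis .
qed

text \<open>For infinite \<open>p0\<close> the pointwise bound carries no power of \<open>x\<close>,
  and its \<open>Q\<close>-th power is a constant times the square of the average of
  \<open>H\<close>. Hardy's inequality then bounds the radial integral by the L^2 norm of
  \<open>H\<close>, whatever \<open>t\<close> is.\<close>

lemma RM_Fejer_Riesz:
  assumes Q: "1 \<le> Q"
  shows "RM \<infinity> (ennreal Q) \<subseteq> RM (ennreal Q) \<infinity>"
proof
  fix f assume f: "f \<in> RM \<infinity> (ennreal Q)"
  have hol: "f holomorphic_on ball 0 1" using f by (rule RM_holomorphic)
  have "1 \<le> (\<infinity>::ennreal)" by simp
  obtain H :: "real \<Rightarrow> real" and C where H: "\<And>x. 0 \<le> H x" "integrable lborel H" "integrable lborel (\<lambda>x. (H x)^2)"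
    and C: "0 < C" and "\<And>t x. t \<in> {0..2*pi} \<Longrightarrow> 0 < x \<Longrightarrow> x \<le> 1/2 \<Longrightarrow>
       ray f t (1 - x) \<le> C * x powr (- recip \<infinity>) * ((LINT \<theta>:{t-x..<t+x}|lborel. H \<theta>) / x) powr (2/Q)"
    by (rule RM_pointwise_average[OF f \<open>1 \<le> (\<infinity>::ennreal)\<close> Q]) (rule that; assumption)
  then have le: "ray f t (1 - x) \<le> C * ((LINT \<theta>:{t-x..<t+x}|lborel. H \<theta>) / x) powr (2/Q)"
    if "t \<in> {0..2*pi}" "0 < x" "x \<le> 1/2" for t x
    using that by (simp add: recip_top)
  define Y where "Y = (LINT x|lborel. (H x)^2)"
  have Y: "0 \<le> Y" "(\<integral>\<^sup>+\<theta>. ennreal ((H \<theta>)^2) \<partial>lborel) = ennreal Y"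
    using H by (simp_all add: Y_def nn_integral_eq_integral)
  obtain M where M: "0 < M" "\<And>t r. 0 \<le> r \<Longrightarrow> r \<le> 1/2 \<Longrightarrow> ray f t r \<le> M"
    by (rule ray_bounded_near_0[OF hol]) (rule that; assumption)
  define K where "K = M powr Q + C powr Q * (8 * Y)"
  have K: "0 \<le> K" using Y by (simp add: K_def)
  have "rnorm (ennreal Q) f t \<le> ennreal (K powr (1/Q))" if t: "t \<in> {0..<2*pi}" for t
  proof -
    let ?A = "\<lambda>x. (LINT \<theta>:{t-x..<t+x}|lborel. H \<theta>) / x"
    have A0: "0 \<le> ?A x" if "0 < x" for x
      unfolding set_lebesgue_integral_def using that by (intro divide_nonneg_pos Bochner_Integration.integral_nonneg) (auto simp: H)
    have Am[measurable]: "(\<lambda>x. ?A x) \<in> borel_measurable borel"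
    proof -
      have [measurable]: "H \<in> borel_measurable borel" using H by auto
      have [measurable]: "{z::real\<times>real. t - fst z \<le> snd z \<and> snd z < t + fst z} \<in> sets (lborel \<Otimes>\<^sub>M lborel)"
      proof -
        have "{z::real\<times>real. t - fst z \<le> snd z \<and> snd z < t + fst z} = {z. t - fst z \<le> snd z} \<inter> {z. snd z < t + fst z}" by auto
        also have "\<dots> \<in> sets borel"
          by (intro sets.Int borel_open borel_closed open_Collect_less closed_Collect_le continuous_intros)
        finally show ?thesis unfolding lborel_prod by simp
      qed
      have "(\<lambda>x. LINT \<theta>|lborel. indicator {z. t - fst z \<le> snd z \<and> snd z < t + fst z} (x, \<theta>) * H \<theta>) \<in> borel_measurable lborel"
        by (rule lborel.borel_measurable_lebesgue_integral) (simp add: split_beta', measurable)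
      also have "(\<lambda>x. LINT \<theta>|lborel. indicator {z. t - fst z \<le> snd z \<and> snd z < t + fst z} (x, \<theta>) * H \<theta>)
         = (\<lambda>x. LINT \<theta>:{t-x..<t+x}|lborel. H \<theta>)"
        unfolding set_lebesgue_integral_def by (intro ext Bochner_Integration.integral_cong) (auto simp: indicator_def)
      finally show ?thesis by simp
    qed
    have "(\<integral>\<^sup>+x\<in>{0<..1/2}. ennreal (ray f t (1 - x) powr Q) \<partial>lborel)
       \<le> (\<integral>\<^sup>+x. ennreal (C powr Q) * (ennreal ((?A x)^2) * indicator {0<..} x) \<partial>lborel)"
    proof (rule nn_integral_mono)
      fix x :: real
      show "ennreal (ray f t (1 - x) powr Q) * indicator {0<..1/2} x \<le> ennreal (C powr Q) * (ennreal ((?A x)^2) * indicator {0<..} x)"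
      proof (cases "x \<in> {0<..1/2}")
        case True
        then have "ray f t (1 - x) powr Q \<le> (C * ?A x powr (2/Q)) powr Q"
          using Q t le[of t x] by (intro powr_mono2) auto
        also have "\<dots> = C powr Q * (?A x)^2" using C Q A0[of x] True by (simp add: powr_mult powr_powr)
        finally have "ennreal (ray f t (1 - x) powr Q) \<le> ennreal (C powr Q * (?A x)^2)" by (rule ennreal_leI)
        then show ?thesis using True by (simp add: ennreal_mult')
      qed simp
    qed
    also have "\<dots> = ennreal (C powr Q) * (\<integral>\<^sup>+x\<in>{0<..}. ennreal ((?A x)^2) \<partial>lborel)"
      by (rule nn_integral_cmult) measurable
    also have "\<dots> \<le> ennreal (C powr Q) * (8 * ennreal Y)"
      unfolding Y(2)[symmetric] by (intro mult_left_mono Hardy_L2 H) auto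
    also have "\<dots> = ennreal (C powr Q * (8 * Y))" by (simp add: ennreal_mult')
    finally have "radial_int Q f t \<le> ennreal (M powr Q) + ennreal (C powr Q * (8 * Y))"
      using Q by - (rule order_trans[OF radial_int_le_split[OF hol _ M(1) M(2)]], simp, simp, simp, rule add_left_mono)
    also have "\<dots> = ennreal ((K powr (1/Q)) powr Q)" using Q K Y by (simp add: K_def ennreal_plus powr_powr)
    finally show ?thesis using Q by (simp add: rnorm_fin_le_iff)
  qed
  then have "AE t in lborel. t \<in> {0..<2*pi} \<longrightarrow> rnorm (ennreal Q) f t \<le> ennreal (K powr (1/Q))" by simp
  then show "f \<in> RM (ennreal Q) \<infinity>" using RM_top[of Q] Q hol by auto
qed

section \<open>Counterexamples\<close>

text \<open>Large values on a whole interval (0, delta) cannot be hidden in the null set that an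
  essential supremum disregards.\<close>

lemma not_RM_if_rnorm_unbounded:
  assumes "0 < p" and un: "\<And>K. \<exists>\<delta>>0. \<forall>t\<in>{0<..<\<delta>}. ennreal K < rnorm p f t"
  shows "f \<notin> RM p \<infinity>"
proof
  assume "f \<in> RM p \<infinity>"
  then obtain C where C: "AE t in lborel. t \<in> {0..<2*pi} \<longrightarrow> rnorm p f t \<le> ennreal C"
    using RM_top_AE assms(1) by blast
  obtain \<delta> where \<delta>: "0 < \<delta>" "\<And>t. t \<in> {0<..<\<delta>} \<Longrightarrow> ennreal C < rnorm p f t" using un[of C] by blast
  have "AE t in lborel. t \<notin> {0<..<min \<delta> 1}"
    using C
  proof eventually_elim
    case (elim t)
    then show ?case using \<delta>(2)[of t] pi_gt3 by (auto simp: not_le)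
  qed
  then have "emeasure lborel {0<..<min \<delta> (1::real)} = 0"
    by (subst (asm) AE_iff_measurable[of "{0<..<min \<delta> 1}"]) auto
  then show False using \<delta> by simp
qed

text \<open>Near 0 the function \<open>t powr (-e)\<close> is outside L^q also for
  \<open>e = recip q\<close>. To include this borderline the \<open>Q\<close>-th power is compared
  with \<open>1/t\<close>, whose integral diverges logarithmically.\<close>

lemma not_RM_if_rnorm_ge_powr:
  assumes "0 < p" "0 < q" "0 < c" "0 < e" "recip q \<le> e"
    and le: "\<And>t. 0 < t \<Longrightarrow> t \<le> 1/2 \<Longrightarrow> ennreal (c * t powr (-e)) \<le> rnorm p f t"
  shows "f \<notin> RM p q"
  using \<open>0 < q\<close>
proof (cases rule: ennreal_cases_pos)
  case 1
  show ?thesis unfolding 1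
  proof (rule not_RM_if_rnorm_unbounded[OF assms(1)])
    fix K :: real
    define K' where "K' = max K 1 / c"
    have K': "0 < K'" "K \<le> c * K'" using assms by (auto simp: K'_def)
    define \<delta> where "\<delta> = min (1/2) (K' powr (-1/e))"
    have "ennreal K < rnorm p f t" if t: "t \<in> {0<..<\<delta>}" for t
    proof -
      have "(K' powr (-1/e)) powr (-e) < t powr (-e)"
        using t assms by (intro powr_less_mono2_neg) (auto simp: \<delta>_def)
      then have "K' < t powr (-e)" using K' assms by (simp add: powr_powr)
      then have "c * K' < c * t powr (-e)" using assms by simp
      moreover have "0 < c * K'" using K' assms by simp
      ultimately have "ennreal K < ennreal (c * t powr (-e))" using K' by (intro ennreal_lessI) linarith+
      also have "\<dots> \<le> rnorm p f t" using t by (intro le) (auto simp: \<delta>_def)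
      finally show ?thesis .
    qed
    moreover have "0 < \<delta>" using K' by (simp add: \<delta>_def)
    ultimately show "\<exists>\<delta>>0. \<forall>t\<in>{0<..<\<delta>}. ennreal K < rnorm p f t" by blast
  qed
next
  case Q: (2 Q)
  have eQ: "1 \<le> e * Q" using assms Q by (simp add: recip_ennreal field_simps)
  have low: "ennreal (c powr Q) * (ennreal (1/t) * indicator {d..1/2} t) \<le> rnorm p f t epowr Q * indicator {0..<2*pi} t" if "0 < d" for d t
  proof (cases "t \<in> {d..1/2}")
    case True
    then have t: "0 < t" "t \<le> 1/2" using that by auto
    have "1/t = t powr (-1)" using t by (simp add: powr_neg_one)
    also have "\<dots> \<le> t powr (-(e*Q))" using t eQ by (intro powr_mono') auto
    also have "c powr Q * \<dots> = (c * t powr (-e)) powr Q" using assms by (simp add: powr_mult powr_powr)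
    finally have "c powr Q * (1/t) \<le> (c * t powr (-e)) powr Q" by (simp add: mult_left_mono)
    then have "ennreal (c powr Q * (1/t)) \<le> ennreal ((c * t powr (-e)) powr Q)" by (rule ennreal_leI)
    also have "\<dots> = ennreal (c * t powr (-e)) epowr Q" using assms by (simp add: epowr_ennreal)
    also have "\<dots> \<le> rnorm p f t epowr Q" using Q le[OF t] by (intro epowr_mono) auto
    finally show ?thesis using True t pi_gt3 by (simp flip: ennreal_mult')
  qed simp
  have "ennreal (c powr Q * (ln (1/2) - ln d)) \<le> (\<integral>\<^sup>+t\<in>{0..<2*pi}. rnorm p f t epowr Q \<partial>lborel)" if d: "0 < d" "d \<le> 1/2" for d
  proof -
    have "((\<lambda>t. 1/t) has_integral (ln (1/2) - ln d)) {d..1/2}"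
      by (rule fundamental_theorem_of_calculus)
         (use d in \<open>auto simp flip: has_real_derivative_iff_has_vector_derivative intro!: derivative_eq_intros\<close>)
    then have "(\<integral>\<^sup>+t\<in>{d..1/2}. ennreal (1/t) \<partial>lborel) = ennreal (ln (1/2) - ln d)"
      by (intro nn_integral_has_integral_lebesgue') (use d in auto)
    then have "ennreal (c powr Q * (ln (1/2) - ln d)) = (\<integral>\<^sup>+t. ennreal (c powr Q) * (ennreal (1/t) * indicator {d..1/2} t) \<partial>lborel)"
      by (subst nn_integral_cmult) (auto simp: ennreal_mult')
    also have "\<dots> \<le> (\<integral>\<^sup>+t\<in>{0..<2*pi}. rnorm p f t epowr Q \<partial>lborel)"
      by (rule nn_integral_mono) (rule low[OF d(1)])
    finally show ?thesis .
  qed note lb = this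
  have "\<not> (\<integral>\<^sup>+t\<in>{0..<2*pi}. rnorm p f t epowr Q \<partial>lborel) < \<infinity>"
  proof
    assume "(\<integral>\<^sup>+t\<in>{0..<2*pi}. rnorm p f t epowr Q \<partial>lborel) < \<infinity>"
    then obtain R where R: "0 \<le> R" "(\<integral>\<^sup>+t\<in>{0..<2*pi}. rnorm p f t epowr Q \<partial>lborel) = ennreal R"
      by (cases "(\<integral>\<^sup>+t\<in>{0..<2*pi}. rnorm p f t epowr Q \<partial>lborel)") auto
    \<comment> \<open>The integral of \<open>1/t\<close> over \<open>{exp (-s) / 2..1/2}\<close>
      equals \<open>s\<close>; this \<open>s\<close> pushes the lower bound to
      \<open>R + 1\<close>.\<close>
    define s where "s = (R + 1) / c powr Q"
    have s: "0 \<le> s" using R by (simp add: s_def)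
    have "ennreal (c powr Q * (ln (1/2) - ln (exp (-s) / 2))) \<le> ennreal R"
      using lb[of "exp (-s) / 2"] R s by simp
    then have "c powr Q * (ln (1/2) - ln (exp (-s) / 2)) \<le> R" using R by (simp add: ennreal_le_iff)
    moreover have "ln (1/2) - ln (exp (-s) / 2) = s" by (simp add: ln_div)
    moreover have "c powr Q * s = R + 1" using assms by (simp add: s_def)
    ultimately show False by simp
  qed
  then show ?thesis unfolding Q(2) using RM_fin[OF assms(1) Q(1)] by simp
qed

lemma not_RM_if_rnorm_infinite:
  assumes "0 < p" "0 < q" "\<And>t. rnorm p f t = \<infinity>"
  shows "f \<notin> RM p q"
  using assms by (intro not_RM_if_rnorm_ge_powr[where c = 1 and e = "recip q + 1"]) (auto simp: recip_nonneg add_nonneg_pos)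

section \<open>Lacunary series and the radial exponent\<close>

lemma exp_minus_le_powr:
  fixes y :: real assumes "0 < y" "0 \<le> a" "a \<le> 1"
  shows "exp (- y) \<le> y powr (-a)"
proof (cases "y \<le> 1")
  case True
  have "exp (-y) \<le> 1" using assms by simp
  also have "1 \<le> y powr (-a)" using True assms by (simp add: powr_minus_divide powr_le1)
  finally show ?thesis .
next
  case False
  have "exp (-y) = 1 / exp y" by (simp add: exp_minus field_simps)
  also have "\<dots> \<le> 1 / y"
  proof -
    have "y \<le> exp y" using exp_ge_add_one_self[of y] by linarith
    then show ?thesis using assms by (intro divide_left_mono) auto
  qed
  also have "\<dots> = y powr (-1)" using assms by (simp add: powr_neg_one)
  also have "\<dots> \<le> y powr (-a)" using False assms by (intro powr_mono) auto
  finally show ?thesis .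
qed

text \<open>Serves twice: with \<open>a = \<alpha>'\<close> it controls the growth of the series,
  with \<open>a = 1\<close> the terms beyond the dominant one.\<close>

lemma power_one_minus_le_powr:
  fixes x :: real assumes "0 < x" "x \<le> 1" "0 < N" "0 \<le> a" "a \<le> 1"
  shows "(1 - x)^N \<le> (real N * x) powr (-a)"
proof -
  have "(1 - x)^N \<le> exp (-x)^N" using assms exp_ge_add_one_self[of "-x"] by (intro power_mono) auto
  also have "\<dots> = exp (- (real N * x))" by (simp add: exp_of_nat_mult[symmetric])
  also have "\<dots> \<le> (real N * x) powr (-a)" using assms by (intro exp_minus_le_powr) auto
  finally show ?thesis .
qed

lemma sum_geometric_reverse_le:
  fixes q :: real assumes "0 \<le> q" "q < 1"
  shows "(\<Sum>i<k. q^(k-i)) \<le> q / (1 - q)"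
proof (induction k)
  case (Suc k)
  have "(\<Sum>i<Suc k. q^(Suc k - i)) = q * (\<Sum>i<k. q^(k-i)) + q"
    by (simp add: sum_distrib_left Suc_diff_le flip: power_Suc)
  also have "\<dots> \<le> q * (q / (1 - q)) + q" using Suc assms by (intro add_mono mult_left_mono) auto
  also have "\<dots> = q / (1 - q)" using assms by (simp add: field_simps)
  finally show ?case .
qed (use assms in simp)

text \<open>Near \<open>r = 1 - 1 / B^k\<close> the \<open>k\<close>-th term dominates.\<close>

lemma lacunary_series:
  assumes \<alpha>: "0 < \<alpha>" "\<alpha> < \<alpha>'" "\<alpha>' \<le> 1"
  obtains f :: "complex \<Rightarrow> complex" and C :: real and B :: nat where "f holomorphic_on ball 0 1" "33 \<le> B"
    "\<And>t x. 0 < x \<Longrightarrow> x \<le> 1 \<Longrightarrow> ray f t (1 - x) \<le> C * x powr (-\<alpha>')"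
    "\<And>t x k. x \<in> {1 / (4 * real B ^ k)..1 / (2 * real B ^ k)} \<Longrightarrow> (real B ^ k) powr \<alpha> / 4 \<le> ray f t (1 - x)"
proof -
  \<comment> \<open>At the \<open>k\<close>-th scale the earlier terms decay at rate \<alpha> and
    the later ones at rate 1 - \<alpha> per index; \<open>\<gamma>\<close> serves both
    sides.\<close>
  define \<gamma> where "\<gamma> = min \<alpha> (1 - \<alpha>)"
  have \<gamma>: "0 < \<gamma>" "\<gamma> \<le> \<alpha>" "\<gamma> \<le> 1 - \<alpha>" "\<gamma> < 1" using \<alpha> by (auto simp: \<gamma>_def)
  \<comment> \<open>Makes the ratio \<open>q = b powr (-\<gamma>)\<close> at most 1/33, so q/(1 - q)
    <= 1/32. Each of the two remainders is then at most D/8, which leaves D/4 of the dominant term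
    D/2.\<close>
  define B where "B = nat \<lceil>33 powr (1/\<gamma>)\<rceil>"
  have B33: "33 powr (1/\<gamma>) \<le> real B" by (simp add: B_def)
  have "33 powr 1 \<le> 33 powr (1/\<gamma>)" using \<gamma> by (intro powr_mono) (auto simp: field_simps)
  with B33 have B: "33 \<le> B" by simp
  define b where "b = real B"
  have b: "33 \<le> b" using B by (simp add: b_def)
  define q where "q = b powr (-\<gamma>)"
  have "33 \<le> b powr \<gamma>"
  proof -
    have "33 = (33 powr (1/\<gamma>)) powr \<gamma>" using \<gamma> by (simp add: powr_powr)
    also have "\<dots> \<le> b powr \<gamma>" using B33 \<gamma> by (intro powr_mono2) (auto simp: b_def)
    finally show ?thesis .
  qed
  then have q: "0 \<le> q" "q \<le> 1/33" "0 < q" using b by (auto simp: q_def powr_minus_divide field_simps)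
  define T where "T = (\<lambda>z::complex. \<lambda>k. of_real ((b^k) powr \<alpha>) * z^(B^k))"
  have T: "norm (T z k) = (b^k) powr \<alpha> * norm z^(B^k)" for z k by (simp add: T_def norm_mult norm_power)
  have Bk: "real (B^k) = b^k" "0 < B^k" "0 < b^k" for k using B b by (simp_all add: b_def)
  \<comment> \<open>The room between \<alpha> and \<alpha>' turns the bounds for the terms into a
    convergent geometric series.\<close>
  define s where "s = b powr (\<alpha> - \<alpha>')"
  have s: "0 \<le> s" "s < 1" using \<alpha> b by (auto simp: s_def powr_less_one)
  have T1: "norm (T z k) \<le> x powr (-\<alpha>') * s^k" if "0 < x" "x \<le> 1" "norm z = 1 - x" for z x k
  proof -
    have "norm (T z k) \<le> (b^k) powr \<alpha> * (b^k * x) powr (-\<alpha>')"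
      unfolding T that(3) using power_one_minus_le_powr[of x "B^k" \<alpha>'] that \<alpha> Bk[of k] by (intro mult_left_mono) auto
    also have "\<dots> = x powr (-\<alpha>') * (b^k) powr (\<alpha> - \<alpha>')"
      using that b by (simp add: powr_mult powr_diff powr_minus_divide)
    also have "(b^k) powr (\<alpha> - \<alpha>') = s^k" using b by (simp add: s_def powr_power powr_powr mult.commute flip: powr_realpow)
    finally show ?thesis .
  qed
  have sumT: "summable (T z)" if "z \<in> ball 0 1" for z
  proof (rule summable_comparison_test')
    show "summable (\<lambda>k. (1 - norm z) powr (-\<alpha>') * s^k)"
      using s by (intro summable_mult summable_geometric) auto
    show "norm (T z k) \<le> (1 - norm z) powr (-\<alpha>') * s^k" for k
      using T1[of "1 - norm z" z k] that by simp
  qed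
  define f where "f z = suminf (T z)" for z
  have hol: "f holomorphic_on ball 0 1"
  proof (rule power_series_holomorphic)
    fix z :: complex assume z: "z \<in> ball 0 1"
    \<comment> \<open>Holomorphy comes from a power series with gaps: reindexing along the powers of
      \<open>B\<close> inserts the zero coefficients.\<close>
    define a :: "nat \<Rightarrow> complex" where "a n = (if n \<in> range (\<lambda>k. B^k) then of_real (real n powr \<alpha>) else 0)" for n
    have "(\<lambda>k. a (B^k) * (z - 0)^(B^k)) sums f z"
    proof -
      have "a (B^k) * (z - 0)^(B^k) = T z k" for k using Bk[of k] by (simp add: a_def T_def)
      then show ?thesis using summable_sums[OF sumT[OF z]] by (simp add: f_def)
    qed
    then show "(\<lambda>n. a n * (z - 0)^n) sums f z"
      by (subst (asm) sums_mono_reindex[where g = "\<lambda>k. B^k" and f = "\<lambda>n. a n * (z - 0)^n"])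
         (use B in \<open>auto simp: a_def strict_mono_def power_strict_increasing_iff\<close>)
  qed
  have nz: "norm (of_real (1 - x) * exp (\<i> * of_real t) :: complex) = 1 - x" if "x \<le> 1" for x t
    using that by (simp add: norm_mult del: of_real_diff)
  show ?thesis
  proof (rule that[of f B "1 / (1 - s)", OF hol B])
    fix t x :: real assume x: "0 < x" "x \<le> 1"
    let ?z = "of_real (1 - x) * exp (\<i> * of_real t) :: complex"
    have "norm (suminf (T ?z)) \<le> (\<Sum>k. x powr (-\<alpha>') * s^k)"
      by (rule norm_suminf_le) (use T1[OF x nz] x s in \<open>auto intro!: summable_mult summable_geometric\<close>)
    also have "\<dots> = 1 / (1 - s) * x powr (-\<alpha>')"
      using s by (subst suminf_mult) (auto simp: suminf_geometric intro: summable_geometric)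
    finally show "ray f t (1 - x) \<le> 1 / (1 - s) * x powr (-\<alpha>')" by (simp add: ray_def f_def)
  next
    fix t x :: real and k assume "x \<in> {1 / (4 * real B ^ k)..1 / (2 * real B ^ k)}"
    then have xk: "1 / (4 * b^k) \<le> x" "x \<le> 1 / (2 * b^k)" by (auto simp: b_def)
    have bk: "1 \<le> b^k" using b by simp
    have x: "0 < x" "b^k * x \<le> 1/2" "1/4 \<le> b^k * x"
      using xk bk by (auto simp: field_simps intro: less_le_trans[of 0 "1 / (4 * b^k)"])
    have "1 * x \<le> b^k * x" using bk x by (intro mult_right_mono) auto
    then have x1: "x \<le> 1/2" using x(2) by linarith
    let ?z = "of_real (1 - x) * exp (\<i> * of_real t) :: complex"
    have zn: "norm ?z = 1 - x" using nz[of x t] x1 by simp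
    define D where "D = (b^k) powr \<alpha>"
    have D: "0 < D" using b by (simp add: D_def)
    have main: "D / 2 \<le> norm (T ?z k)"
    proof -
      have "1 - b^k * x \<le> (1 - x)^(B^k)" using Bernoulli_inequality[of "-x" "B^k"] x1 Bk by simp
      then have "1/2 \<le> (1 - x)^(B^k)" using x by linarith
      then show ?thesis unfolding T zn using D by (simp add: D_def)
    qed
    have low: "norm (T ?z j) \<le> 4 * D * q^(k-j)" if "j < k" for j
    proof -
      have "norm (T ?z j) \<le> (b^j) powr \<alpha> * 1"
        unfolding T zn using x x1 by (intro mult_left_mono power_le_one) auto
      also have "(b^j) powr \<alpha> = D * b powr (-\<alpha> * real (k - j))"
      proof -
        have "(b^j) powr \<alpha> = b powr (real j * \<alpha>)" "D = b powr (real k * \<alpha>)" using b by (simp_all add: D_def powr_powr flip: powr_realpow)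
        moreover have "real j * \<alpha> = real k * \<alpha> + -\<alpha> * real (k - j)" using that by (simp add: of_nat_diff algebra_simps)
        ultimately show ?thesis by (simp only: powr_add)
      qed
      also have "b powr (-\<alpha> * real (k - j)) \<le> b powr (-\<gamma> * real (k - j))"
        using b \<gamma> by (intro powr_mono) (auto intro: mult_right_mono)
      also have "b powr (-\<gamma> * real (k - j)) = q^(k-j)" using b by (simp add: q_def powr_power mult.commute)
      finally have "norm (T ?z j) \<le> D * q^(k-j)" using D q by (simp add: mult_left_mono)
      also have "\<dots> \<le> 4 * D * q^(k-j)" using D q by (intro mult_right_mono) auto
      finally show ?thesis .
    qed
    have high: "norm (T ?z (j + Suc k)) \<le> 4 * D * q * q^j" for j
    proof -
      have "(1 - x)^(B^(j + Suc k)) \<le> (b^(j + Suc k) * x) powr (-1)"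
        using power_one_minus_le_powr[of x "B^(j + Suc k)" 1] x x1 Bk[of "j + Suc k"] by auto
      also have "\<dots> \<le> 4 * b powr (- real (Suc j))"
      proof -
        have "b powr real (Suc j) / 4 \<le> b^(j + Suc k) * x"
        proof -
          have "b^(Suc j) * (1/4) \<le> b^(Suc j) * (b^k * x)" using x b by (intro mult_left_mono) auto
          then show ?thesis using b by (simp add: powr_realpow power_add mult_ac del: of_nat_Suc)
        qed
        then have "(b^(j + Suc k) * x) powr (-1) \<le> (b powr real (Suc j) / 4) powr (-1)"
          using b by (intro powr_mono2') auto
        also have "\<dots> = 4 * b powr (- real (Suc j))" using b by (simp add: powr_neg_one powr_minus_divide del: of_nat_Suc)
        finally show ?thesis .
      qed
      finally have "norm (T ?z (j + Suc k)) \<le> (b^(j + Suc k)) powr \<alpha> * (4 * b powr (- real (Suc j)))"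
        unfolding T zn by (intro mult_left_mono) auto
      also have "\<dots> = 4 * D * b powr (-(1 - \<alpha>) * real (Suc j))"
      proof -
        have pw: "(b^n) powr \<alpha> = b powr (real n * \<alpha>)" for n
          using b powr_realpow[of b n] powr_powr[of b "real n" \<alpha>] by simp
        have "(b^(j + Suc k)) powr \<alpha> = b powr (real (j + Suc k) * \<alpha>)" "D = b powr (real k * \<alpha>)" unfolding D_def by (rule pw)+
        moreover have "b powr (real (j + Suc k) * \<alpha>) * b powr (- real (Suc j)) = b powr (real k * \<alpha>) * b powr (-(1 - \<alpha>) * real (Suc j))"
          unfolding powr_add[symmetric] by (rule arg_cong[where f = "\<lambda>u. b powr u"]) (simp add: algebra_simps)
        ultimately show ?thesis by (metis mult.assoc mult.commute)
      qed
      also have "b powr (-(1 - \<alpha>) * real (Suc j)) \<le> b powr (-\<gamma> * real (Suc j))"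
        using b \<gamma> by (intro powr_mono mult_right_mono) auto
      also have "b powr (-\<gamma> * real (Suc j)) = q * q^j"
      proof -
        have "q^Suc j = b powr (-\<gamma> * real (Suc j))" unfolding q_def using b by (subst powr_power) (auto simp: mult.commute)
        then show ?thesis by simp
      qed
      finally show ?thesis using D q by (simp add: mult_left_mono mult_ac)
    qed
    have zb: "?z \<in> ball 0 1" using zn x by simp
    have fz: "f ?z = suminf (\<lambda>j. T ?z (j + Suc k)) + (sum (T ?z) {..<k} + T ?z k)"
      unfolding f_def using suminf_split_initial_segment[OF sumT[OF zb], of "Suc k"] by simp
    have "norm (sum (T ?z) {..<k}) \<le> (\<Sum>j<k. 4 * D * q^(k-j))"
      by (rule sum_norm_le) (use low in auto)
    also have "\<dots> \<le> 4 * D * (q / (1 - q))"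
      unfolding sum_distrib_left[symmetric] using D q by (intro mult_left_mono sum_geometric_reverse_le) auto
    finally have 1: "norm (sum (T ?z) {..<k}) \<le> 4 * D * (q / (1 - q))" .
    have "norm (suminf (\<lambda>j. T ?z (j + Suc k))) \<le> (\<Sum>j. 4 * D * q * q^j)"
      by (rule norm_suminf_le) (use high q in \<open>auto intro!: summable_mult summable_geometric\<close>)
    also have "\<dots> = 4 * D * (q / (1 - q))"
      using q by (subst suminf_mult) (auto simp: suminf_geometric intro: summable_geometric)
    finally have 2: "norm (suminf (\<lambda>j. T ?z (j + Suc k))) \<le> 4 * D * (q / (1 - q))" .
    have "q / (1 - q) \<le> 1/32" using q by (simp add: field_simps)
    then have "4 * D * (q / (1 - q)) \<le> 4 * D * (1/32)" using D by (intro mult_left_mono) auto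
    moreover have "norm (T ?z k) \<le> norm (f ?z) + norm (suminf (\<lambda>j. T ?z (j + Suc k))) + norm (sum (T ?z) {..<k})"
    proof -
      have "norm t \<le> norm (a + (c + t)) + norm a + norm c" for a c t :: complex by norm
      then show ?thesis unfolding fz .
    qed
    ultimately have "D / 4 \<le> norm (f ?z)" using 1 2 main by linarith
    then show "(real B ^ k) powr \<alpha> / 4 \<le> ray f t (1 - x)" by (simp add: ray_def D_def b_def)
  qed
qed

lemma radial_int_ge:
  assumes "f holomorphic_on ball 0 1" "S \<subseteq> {0<..1}" "\<And>x. x \<in> S \<Longrightarrow> g x \<le> ray f t (1 - x) powr P"
  shows "(\<integral>\<^sup>+x\<in>S. ennreal (g x) \<partial>lborel) \<le> radial_int P f t"
  unfolding radial_int_reflect[OF assms(1)]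
  by (rule nn_integral_mono) (use assms in \<open>auto simp: indicator_def intro!: ennreal_leI\<close>)

text \<open>With \<alpha> = 1/p for finite \<open>p\<close>, every dyadic-like layer contributes
  equally to the radial integral, which therefore diverges on every ray. For infinite
  \<open>p\<close> any positive \<alpha> below \<open>1/P0\<close> makes all rays unbounded.
  Choosing \<alpha>' < 1/P0 keeps the radial \<open>P0\<close>-norm bounded uniformly in
  \<open>t\<close>, so that any \<open>q0\<close> is reached.\<close>

lemma not_RM_subset_radial:
  assumes "1 \<le> p0" "p0 < p" "0 < q0" "0 < q"
  shows "\<not> RM p0 q0 \<subseteq> RM p q"
proof -
  have "0 < p0" by (rule less_le_trans[OF _ assms(1)]) simp
  moreover have "p0 \<noteq> \<infinity>" using assms by auto
  ultimately obtain P0 where P0: "0 < P0" "p0 = ennreal P0" by (auto elim: ennreal_cases_pos)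
  have P1: "1 \<le> P0" using assms P0 by (simp flip: ennreal_1)
  have p: "0 < p" using \<open>0 < p0\<close> assms(2) by (rule less_trans)
  define \<alpha> where "\<alpha> = (if p = \<infinity> then 1 / (2 * P0) else recip p)"
  have \<alpha>: "0 < \<alpha>" "\<alpha> < 1 / P0" using p
  proof (atomize (full), cases rule: ennreal_cases_pos)
    case 1
    then show "0 < \<alpha> \<and> \<alpha> < 1 / P0" using P0 by (simp add: \<alpha>_def field_simps)
  next
    case (2 P)
    then have "P0 < P" using assms P0 by (simp add: ennreal_less_iff)
    then show "0 < \<alpha> \<and> \<alpha> < 1 / P0" using P0 2 by (simp add: \<alpha>_def recip_ennreal field_simps)
  qed
  define \<alpha>' where "\<alpha>' = (\<alpha> + 1 / P0) / 2"
  have \<alpha>': "\<alpha> < \<alpha>'" "\<alpha>' < 1 / P0" using \<alpha> by (auto simp: \<alpha>'_def)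
  have "1 / P0 \<le> 1" using P1 by simp
  then have "\<alpha>' \<le> 1" using \<alpha>' by linarith
  obtain f :: "complex \<Rightarrow> complex" and C :: real and B :: nat where
    hol: "f holomorphic_on ball 0 1" and B: "33 \<le> B"
    and up: "\<And>t x. 0 < x \<Longrightarrow> x \<le> 1 \<Longrightarrow> ray f t (1 - x) \<le> C * x powr (-\<alpha>')"
    and low: "\<And>t x k. x \<in> {1 / (4 * real B ^ k)..1 / (2 * real B ^ k)} \<Longrightarrow> (real B ^ k) powr \<alpha> / 4 \<le> ray f t (1 - x)"
    by (rule lacunary_series[OF \<alpha>(1) \<alpha>'(1) \<open>\<alpha>' \<le> 1\<close>]) (rule that; assumption)
  have C: "0 \<le> C" using order_trans[OF ray_nonneg up[of 1 0]] by simp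
  define K where "K = C powr P0 * (1 / (1 - P0 * \<alpha>'))"
  have a': "P0 * \<alpha>' < 1" using \<alpha>' P0 by (simp add: field_simps)
  have K: "0 \<le> K" using a' by (simp add: K_def)
  have "rnorm p0 f t \<le> ennreal (K powr (1/P0))" for t
  proof -
    have "radial_int P0 f t \<le> ennreal K"
      unfolding radial_int_reflect[OF hol] K_def
      using nn_integral_ray_powr_le[of P0 C \<alpha>' 1 f t] P0 C a' up by simp
    also have "K = (K powr (1/P0)) powr P0" using K P0 by (simp add: powr_powr)
    finally show ?thesis unfolding P0(2) using P0(1) by (subst rnorm_fin_le_iff) auto
  qed
  then have inRM: "f \<in> RM p0 q0" using \<open>0 < p0\<close> assms(3) by (intro rnorm_bounded_imp_RM[OF hol])
  have b1: "1 \<le> real B ^ k" for k using B by simp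
  have b0: "0 < real B ^ k" for k using B by simp
  have bb: "0 < 1 / (2 * real B ^ k)" "1 / (2 * real B ^ k) \<le> 1/2" "0 < 1 / (4 * real B ^ k)" for k
    using b1[of k] b0[of k] by (simp_all add: divide_le_eq)
  have inI: "1 / (2 * real B ^ k) \<in> {1 / (4 * real B ^ k)..1 / (2 * real B ^ k)}" for k
  proof -
    have "0 < real B ^ k" using B by simp
    then show ?thesis by (simp add: divide_simps)
  qed
  have "rnorm p f t = \<infinity>" for t
    using p
  proof (cases rule: ennreal_cases_pos)
    case 1
    show ?thesis
    proof (rule ccontr)
      assume "rnorm p f t \<noteq> \<infinity>"
      then obtain R where R: "0 \<le> R" "rnorm p f t = ennreal R" by (cases "rnorm p f t") auto
      then have le: "\<And>r. r \<in> {0..<1} \<Longrightarrow> ray f t r \<le> R"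
        using rnorm_top_le_iff(1)[of R f t] 1 by simp
      have "(real B ^ k) powr \<alpha> / 4 \<le> R" for k
      proof -
        have "1 - 1 / (2 * real B ^ k) \<in> {0..<1}" unfolding atLeastLessThan_iff using bb[of k] by linarith
        then show ?thesis using low[OF inI] le order_trans by blast
      qed
      then have le: "(real B powr \<alpha>) ^ k \<le> 4 * R" for k
        using B by (simp add: powr_power powr_powr mult.commute flip: powr_realpow)
      have "1 < real B powr \<alpha>" using B \<alpha> by (simp add: gr_one_powr)
      then obtain k where "4 * R < (real B powr \<alpha>) ^ k" using real_arch_pow by blast
      with le[of k] show False by simp
    qed
  next
    case (2 P)
    have aP: "\<alpha> * P = 1" using 2 by (simp add: \<alpha>_def recip_ennreal)
    define I where "I k = {1 / (4 * real B ^ k)..1 / (2 * real B ^ k)}" for k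
    define F where "F x = ennreal (ray f t (1 - x) powr P) * indicator {0<..1} x" for x
    have [measurable]: "F \<in> borel_measurable borel" unfolding F_def by (rule ray_reflect_measurable[OF hol])
    have Isub: "I k \<subseteq> {0<..1}" for k
    proof
      fix x assume "x \<in> I k"
      then have "1 / (4 * real B ^ k) \<le> x" "x \<le> 1 / (2 * real B ^ k)" by (auto simp: I_def)
      then have "0 < x" "x \<le> 1" using bb[of k] by linarith+
      then show "x \<in> {0<..1}" by simp
    qed
    have lt: "1 / (2 * real B ^ j) < 1 / (4 * real B ^ k)" if "k < j" for k j
    proof -
      have "2 * real B ^ k < real B * real B ^ k" using B b1[of k] by (intro mult_strict_right_mono) auto
      also have "\<dots> \<le> real B ^ j" using that B by (auto simp flip: power_Suc intro!: power_increasing)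
      finally show ?thesis using b0[of k] b0[of j] by (intro divide_strict_left_mono) auto
    qed
    have "I k \<inter> I j = {}" if "k < j" for k j using lt[OF that] by (auto simp: I_def)
    then have disj: "disjoint_family I"
      unfolding disjoint_family_on_def by (metis Int_commute linorder_neqE_nat)
    \<comment> \<open>The contribution of each layer \<open>I k\<close>: since
      \<open>\<alpha> * P = 1\<close>, the lower bound to the power \<open>P\<close> is
      \<open>real B ^ k * (1/4) powr P\<close>, and the length of \<open>I k\<close> is
      \<open>1 / (4 * real B ^ k)\<close>.\<close>
    define c where "c = (1/4) powr P * (1/4)"
    have c: "0 < c" by (simp add: c_def)
    have Ik: "ennreal c \<le> (\<integral>\<^sup>+x\<in>I k. F x \<partial>lborel)" for k
    proof -
      have len: "emeasure lborel (I k) = ennreal (1 / (4 * real B ^ k))"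
        unfolding I_def using inI[of k] b0[of k] by (subst emeasure_lborel_Icc) (auto intro!: arg_cong[where f = ennreal] simp: divide_simps)
      have "c = real B ^ k * (1/4) powr P * (1 / (4 * real B ^ k))"
        using b0[of k] by (simp add: c_def)
      then have "ennreal c = ennreal (real B ^ k * (1/4) powr P) * ennreal (1 / (4 * real B ^ k))"
        by (simp flip: ennreal_mult')
      also have "\<dots> = (\<integral>\<^sup>+x\<in>I k. ennreal (real B ^ k * (1/4) powr P) \<partial>lborel)"
        unfolding len[symmetric] by (subst nn_integral_cmult_indicator) (auto simp: I_def)
      also have "\<dots> \<le> (\<integral>\<^sup>+x\<in>I k. F x \<partial>lborel)"
      proof (rule nn_integral_mono)
        fix x
        show "ennreal (real B ^ k * (1/4) powr P) * indicator (I k) x \<le> F x * indicator (I k) x"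
        proof (cases "x \<in> I k")
          case True
          have "real B ^ k * (1/4) powr P = ((real B ^ k) powr \<alpha> / 4) powr P"
            using b1[of k] aP by (simp add: powr_powr powr_divide)
          also have "\<dots> \<le> ray f t (1 - x) powr P" using low[of x k t] True 2 by (intro powr_mono2) (auto simp: I_def)
          finally have "real B ^ k * (1/4) powr P \<le> ray f t (1 - x) powr P" .
          moreover have "x \<in> {0<..1}" using True Isub by blast
          ultimately show ?thesis using True by (simp add: F_def ennreal_leI)
        qed simp
      qed
      finally show ?thesis .
    qed
    have "radial_int P f t = top"
    proof (rule ccontr)
      assume "radial_int P f t \<noteq> top"
      then obtain R where R: "0 \<le> R" "radial_int P f t = ennreal R" by (cases "radial_int P f t") auto
      have "real n * c \<le> R" for n
      proof -
        have "ennreal (real n * c) = (\<Sum>k<n. ennreal c)" using c by (simp add: ennreal_mult' ennreal_of_nat_eq_real_of_nat)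
        also have "\<dots> \<le> (\<Sum>k<n. (\<integral>\<^sup>+x\<in>I k. F x \<partial>lborel))" by (intro sum_mono Ik)
        also have "\<dots> \<le> (\<Sum>k. (\<integral>\<^sup>+x\<in>I k. F x \<partial>lborel))" by (rule sum_le_suminf) auto
        also have "\<dots> = (\<integral>\<^sup>+x\<in>(\<Union>k. I k). F x \<partial>lborel)"
        proof (rule nn_integral_disjoint_family[symmetric])
          show "I k \<in> sets lborel" for k by (simp add: I_def)
        qed (use disj in simp_all)
        also have "\<dots> \<le> (\<integral>\<^sup>+x. F x \<partial>lborel)" by (intro nn_integral_mono) (auto simp: indicator_def)
        also have "\<dots> = ennreal R" unfolding F_def using R radial_int_reflect[OF hol] by simp
        finally show ?thesis using R by (simp add: ennreal_le_iff)
      qed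
      moreover obtain n :: nat where "R < real n * c" using reals_Archimedean3[OF c] by blast
      ultimately show False using not_le by blast
    qed
    then show ?thesis using 2 by (simp add: rnorm_def)
  qed
  then have "f \<notin> RM p q" using p assms by (intro not_RM_if_rnorm_infinite) auto
  with inRM show ?thesis by blast
qed

section \<open>Powers of 1 - z\<close>

text \<open>A weak form of Jordan's inequality: up to pi/3 the derivative cos - 1/2 of the
  difference is nonnegative, and beyond that sin y >= 4/5 >= pi/4 >= y/2.\<close>

lemma sin_ge_half:
  assumes "0 \<le> y" "y \<le> pi / 2" shows "y / 2 \<le> sin y"
proof (cases "y \<le> pi/3")
  case True
  have "sin 0 - 0 / 2 \<le> sin y - y / 2"
  proof (rule DERIV_nonneg_imp_nondecreasing[OF assms(1)])
    fix x assume x: "0 \<le> x" "x \<le> y"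
    have "cos (pi/3) \<le> cos x" using x True pi_gt_zero by (intro cos_monotone_0_pi_le) auto
    then have "0 \<le> cos x - 1/2" by (simp add: cos_60)
    moreover have "((\<lambda>x. sin x - x / 2) has_real_derivative cos x - 1/2) (at x)"
      by (auto intro!: derivative_eq_intros)
    ultimately show "\<exists>d. ((\<lambda>x. sin x - x / 2) has_real_derivative d) (at x) \<and> 0 \<le> d" by blast
  qed
  then show ?thesis by simp
next
  case False
  have "8/5 \<le> sqrt 3" by (rule real_le_rsqrt) (simp add: power2_eq_square)
  then have "4/5 \<le> sqrt 3 / 2" by simp
  also have "\<dots> = sin (pi/3)" by (simp add: sin_60)
  also have "\<dots> \<le> sin y" using assms False by (intro sin_monotone_2pi_le) auto
  finally have "4/5 \<le> sin y" .
  moreover have "pi \<le> 16/5" using pi_approx by simp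
  ultimately show ?thesis using assms by linarith
qed

lemma norm_one_minus_exp_ge:
  assumes "t \<in> {0..<2*pi}"
  shows "min t (2*pi - t) / 2 \<le> norm (exp (\<i> * of_real t) - 1)"
proof -
  have e: "norm (exp (\<i> * of_real t) - 1) = 2 * \<bar>sin (t/2)\<bar>"
    by (rule dist_exp_i_1)
  show ?thesis
  proof (cases "t \<le> pi")
    case True
    then show ?thesis using assms sin_ge_half[of "t/2"] unfolding e by auto
  next
    case False
    have "sin (t/2) = sin (pi - t/2)" by simp
    then show ?thesis using False assms sin_ge_half[of "pi - t/2"] unfolding e by (auto simp: field_simps)
  qed
qed

text \<open>Up to constants, |1 - z| is the sum of \<open>x\<close> and the distance from
  \<open>t\<close> to 0 on the circle. These bounds turn the remaining examples into integrals of
  real functions.\<close>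

lemma dist_1_polar:
  assumes x: "0 < x" "x \<le> 1"
  defines "S \<equiv> \<lambda>t. norm (1 - of_real (1 - x) * exp (\<i> * of_real t) :: complex)"
  shows "x \<le> S t" "S t < 2" "t \<in> {0..<2*pi} \<Longrightarrow> min t (2*pi - t) / 4 \<le> S t" "0 \<le> t \<Longrightarrow> S t \<le> x + t"
proof -
  define w where "w = exp (\<i> * of_real t :: complex)"
  have w: "norm w = 1" by (simp add: w_def)
  have n: "norm (of_real (1 - x) * w) = 1 - x" using x w by (simp add: norm_mult del: of_real_diff)
  have S: "S t = norm (1 - of_real (1 - x) * w)" by (simp add: S_def w_def)
  have "norm (1::complex) - norm (of_real (1 - x) * w) \<le> S t" unfolding S by (rule norm_triangle_ineq2)
  then show xS: "x \<le> S t" using n by simp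
  have "S t \<le> norm (1::complex) + norm (of_real (1 - x) * w)" unfolding S by (rule norm_triangle_ineq4)
  then show "S t < 2" using n x by simp
  \<comment> \<open>The distance from \<open>w\<close> to 1 is at most \<open>S t + x\<close>, hence
    at most \<open>2 * S t\<close>; this halves the chord estimate and produces the 4.\<close>
  have e: "w - 1 = - (1 - of_real (1 - x) * w) + of_real x * w" by (simp add: algebra_simps)
  have xw: "norm (of_real x * w) = x" using x w by (simp add: norm_mult)
  have "norm (w - 1) \<le> norm (- (1 - of_real (1 - x) * w)) + norm (of_real x * w)"
    unfolding e by (rule norm_triangle_ineq)
  then have "norm (w - 1) \<le> S t + x" using xw unfolding S norm_minus_cancel by simp
  then show "min t (2*pi - t) / 4 \<le> S t" if "t \<in> {0..<2*pi}"
    using norm_one_minus_exp_ge[OF that] xS unfolding w_def by linarith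
  show "S t \<le> x + t" if "0 \<le> t"
  proof -
    have "1 - of_real (1 - x) * w = of_real x * w - (w - 1)" by (simp add: algebra_simps)
    then have "S t \<le> norm (of_real x * w) + norm (w - 1)" unfolding S by (simp only: norm_triangle_ineq4)
    also have "norm (w - 1) = 2 * \<bar>sin (t/2)\<bar>" unfolding w_def by (rule dist_exp_i_1)
    also have "\<dots> \<le> t" using abs_sin_x_le_abs_x[of "t/2"] that by simp
    finally show ?thesis using xw by simp
  qed
qed

lemma one_minus_in_slit:
  assumes "z \<in> ball (0::complex) 1"
  shows "1 - z \<noteq> 0" "1 - z \<notin> \<real>\<^sub>\<le>\<^sub>0" "norm (1 - z) < 2"
proof -
  have "Re z < 1" using assms complex_Re_le_cmod[of z] by auto
  then have "0 < Re (1 - z)" by simp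
  then show "1 - z \<noteq> 0" "1 - z \<notin> \<real>\<^sub>\<le>\<^sub>0" by (auto simp: complex_nonpos_Reals_iff)
  show "norm (1 - z) < 2" using norm_triangle_ineq4[of 1 z] assms by simp
qed

lemma nn_integral_folded_le:
  assumes [measurable]: "g \<in> borel_measurable borel"
  shows "(\<integral>\<^sup>+t\<in>{0..<2*pi}. g (min t (2*pi - t)) \<partial>lborel) \<le> 2 * (\<integral>\<^sup>+t\<in>{0..pi}. g t \<partial>lborel)"
proof -
  let ?h = "\<lambda>t. g t * indicator {0..pi} t"
  have "(\<integral>\<^sup>+t\<in>{0..<2*pi}. g (min t (2*pi - t)) \<partial>lborel) \<le> (\<integral>\<^sup>+t. ?h t + ?h (2*pi - t) \<partial>lborel)"
  proof (rule nn_integral_mono)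
    fix t show "g (min t (2*pi - t)) * indicator {0..<2*pi} t \<le> ?h t + ?h (2*pi - t)"
      by (cases "t \<le> pi") (auto simp: indicator_def min_def)
  qed
  also have "\<dots> = (\<integral>\<^sup>+t. ?h t \<partial>lborel) + (\<integral>\<^sup>+t. ?h (2*pi - t) \<partial>lborel)"
    by (rule nn_integral_add) measurable
  also have "(\<integral>\<^sup>+t. ?h (2*pi - t) \<partial>lborel) = (\<integral>\<^sup>+t. ?h t \<partial>lborel)"
    using nn_integral_real_affine[of ?h "-1" "2*pi"] by simp
  finally show ?thesis by (simp only: mult_2)
qed

lemma rnorm_ge_ray: "0 < x \<Longrightarrow> x \<le> 1 \<Longrightarrow> ennreal (ray f t (1 - x)) \<le> rnorm \<infinity> f t"
  unfolding rnorm_def using ray_le_SUP[of "1 - x" f t] by simp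

text \<open>The function (1 - z)^(-\<gamma>) with \<gamma> strictly between the two sums of
  reciprocals. On the ray at angle \<open>t\<close> the segment x <= t alone makes its
  \<open>p\<close>-norm at least a multiple of \<open>t powr (- (\<gamma> - recip p))\<close>, and
  \<gamma> - 1/p > 1/q.\<close>

lemma not_RM_subset_diagonal:
  assumes "1 \<le> p0" "1 \<le> q0" "0 < p" "0 < q" and lt: "recip p + recip q < recip p0 + recip q0"
  shows "\<not> RM p0 q0 \<subseteq> RM p q"
proof -
  have p0: "0 < p0" by (rule less_le_trans[OF _ assms(1)]) simp
  have q0: "0 < q0" by (rule less_le_trans[OF _ assms(2)]) simp
  define R where "R = recip p0 + recip q0"
  have R: "0 < R" using lt recip_nonneg[of p] recip_nonneg[of q] by (simp add: R_def)
  \<comment> \<open>Midway between the ratio of the two sums and 1: \<mu> < 1 keeps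
    \<open>P0 * g1\<close> and \<open>Q0 * g2\<close> below 1 where these exponents are finite,
    while \<open>\<mu> * R\<close> still exceeds the smaller sum.\<close>
  define \<mu> where "\<mu> = ((recip p + recip q) / R + 1) / 2"
  have \<mu>: "0 < \<mu>" "\<mu> < 1" "recip p + recip q < \<mu> * R"
  proof -
    have "(recip p + recip q) / R < 1" using lt R by (simp add: R_def)
    moreover have "0 \<le> (recip p + recip q) / R" using R recip_nonneg by simp
    ultimately show "0 < \<mu>" "\<mu> < 1" by (auto simp: \<mu>_def)
    have "\<mu> * R = (recip p + recip q + R) / 2" using R by (simp add: \<mu>_def field_simps)
    then show "recip p + recip q < \<mu> * R" using lt by (simp add: R_def)
  qed
  \<comment> \<open>\<open>g1\<close> is spent on \<open>1 - r \<le> \<bar>1 - z\<bar>\<close> and \<open>g2\<close> on \<open>m t / 4 \<le> \<bar>1 - z\<bar>\<close>.\<close>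
  define g1 g2 \<gamma> where "g1 = \<mu> * recip p0" and "g2 = \<mu> * recip q0" and "\<gamma> = g1 + g2"
  have g: "0 \<le> g1" "0 \<le> g2" "0 \<le> \<gamma>" using \<mu> recip_nonneg[of p0] recip_nonneg[of q0] by (auto simp: g1_def g2_def \<gamma>_def)
  have \<gamma>: "recip p + recip q < \<gamma>" using \<mu> by (simp add: \<gamma>_def g1_def g2_def R_def algebra_simps)
  define f where "f = (\<lambda>z. exp (- of_real \<gamma> * Ln (1 - z)) :: complex)"
  have hol: "f holomorphic_on ball 0 1"
    unfolding f_def by (intro holomorphic_intros) (use one_minus_in_slit in auto)
  define S where "S x t = norm (1 - of_real (1 - x) * exp (\<i> * of_real t) :: complex)" for x t
  have rayS: "ray f t (1 - x) = S x t powr (-\<gamma>)" if "0 < x" "x \<le> 1" for x t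
  proof -
    have "1 - of_real (1 - x) * exp (\<i> * of_real t) \<noteq> (0::complex)"
      using in_unit_ball_ray[of "1 - x" t] one_minus_in_slit(1)[of "of_real (1 - x) * exp (\<i> * of_real t)"] that by auto
    then show ?thesis by (simp add: ray_def f_def S_def powr_def)
  qed
  \<comment> \<open>The distance from \<open>t\<close> to 0 on the circle.\<close>
  define m where "m t = min t (2*pi - t)" for t
  have up: "ray f t (1 - x) \<le> x powr (-g1) * (m t / 4) powr (-g2)" if t: "t \<in> {0<..<2*pi}" and x: "0 < x" "x \<le> 1" for t x
  proof -
    have mt: "0 < m t" using t by (auto simp: m_def)
    have "x \<le> S x t" "m t / 4 \<le> S x t"
      unfolding S_def m_def by (rule dist_1_polar[OF x]; use t in auto)+
    then have "S x t powr (-g1) * S x t powr (-g2) \<le> x powr (-g1) * (m t / 4) powr (-g2)"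
      using x mt g by (intro mult_mono powr_mono2') auto
    then show ?thesis unfolding rayS[OF x] \<gamma>_def by (simp flip: powr_add)
  qed
  obtain K where K: "0 \<le> K" "\<And>t. t \<in> {0<..<2*pi} \<Longrightarrow> rnorm p0 f t \<le> ennreal (K * (m t / 4) powr (-g2))"
    using p0
  proof (cases rule: ennreal_cases_pos)
    case 1
    show ?thesis
    proof (rule that[of 1])
      fix t assume t: "t \<in> {0<..<2*pi}"
      have "ray f t r \<le> (m t / 4) powr (-g2)" if "r \<in> {0..<1}" for r
        using up[OF t, of "1 - r"] that 1 by (simp add: g1_def recip_top)
      then show "rnorm p0 f t \<le> ennreal (1 * (m t / 4) powr (-g2))"
        unfolding 1 by (subst rnorm_top_le_iff) auto
    qed simp
  next
    case (2 P0)
    have a: "P0 * g1 < 1" using 2 \<mu> by (simp add: g1_def recip_ennreal)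
    define K where "K = (1 / (1 - P0 * g1)) powr (1/P0)"
    show ?thesis
    proof (rule that[of K])
      show "0 \<le> K" by (simp add: K_def)
      fix t assume t: "t \<in> {0<..<2*pi}"
      have mt: "0 < m t" using t by (auto simp: m_def)
      define E where "E = (m t / 4) powr (-g2)"
      have "radial_int P0 f t \<le> ennreal (E powr P0 * (1 / (1 - P0 * g1)))"
        unfolding radial_int_reflect[OF hol]
        using nn_integral_ray_powr_le[of P0 E g1 1 f t] 2 a up[OF t] by (simp add: E_def mult.commute)
      also have "E powr P0 * (1 / (1 - P0 * g1)) = (K * E) powr P0"
        using a 2 by (simp add: K_def powr_mult powr_powr E_def)
      finally show "rnorm p0 f t \<le> ennreal (K * (m t / 4) powr (-g2))"
        unfolding 2(2) using 2(1) by (subst rnorm_fin_le_iff) (auto simp: E_def K_def)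
    qed
  qed
  have inRM: "f \<in> RM p0 q0"
    using q0
  proof (cases rule: ennreal_cases_pos)
    case 1
    \<comment> \<open>Positivity of \<open>R\<close> excludes that \<open>p0\<close> and
      \<open>q0\<close> are both infinite.\<close>
    then have "0 < recip p0" using R by (simp add: R_def recip_top)
    then have "p0 \<noteq> \<infinity>" by (auto simp: recip_top)
    then obtain P0 where P0: "0 < P0" "p0 = ennreal P0" using p0 by (auto elim: ennreal_cases_pos)
    have bnd: "rnorm p0 f t \<le> ennreal K" if t: "t \<in> {0<..<2*pi}" for t
    proof -
      \<comment> \<open>The exponent \<open>g2\<close> is 0 here, and \<open>0 powr 0\<close> is 0:
        the power equals 1 only for a nonzero base.\<close>
      have "m t \<noteq> 0" using t by (auto simp: m_def min_def)
      then show ?thesis using K(2)[OF t] 1 by (simp add: g2_def recip_top)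
    qed
    have "AE t in lborel. t \<in> {0..<2*pi} \<longrightarrow> rnorm p0 f t \<le> ennreal K"
      using AE_lborel_singleton[of "0::real"] by eventually_elim (use bnd in auto)
    then show ?thesis unfolding 1 P0(2) RM_top[OF P0(1)] using hol by blast
  next
    case (2 Q0)
    have b: "Q0 * g2 < 1" using 2 \<mu> by (simp add: g2_def recip_ennreal)
    define g where "g t = ennreal ((K * 4 powr g2) powr Q0) * ennreal (t powr (-(Q0 * g2)))" for t
    have gm[measurable]: "g \<in> borel_measurable borel" unfolding g_def by measurable
    have "(\<integral>\<^sup>+t\<in>{0..<2*pi}. rnorm p0 f t epowr Q0 \<partial>lborel) \<le> (\<integral>\<^sup>+t\<in>{0..<2*pi}. g (min t (2*pi - t)) \<partial>lborel)"
    proof (rule nn_integral_mono_AE)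
      show "AE t in lborel. rnorm p0 f t epowr Q0 * indicator {0..<2*pi} t \<le> g (min t (2*pi - t)) * indicator {0..<2*pi} t"
        using AE_lborel_singleton[of "0::real"]
      proof eventually_elim
        case (elim t)
        show ?case
        proof (cases "t \<in> {0..<2*pi}")
          case True
          then have t: "t \<in> {0<..<2*pi}" using elim by auto
          have mt: "0 < m t" using t by (auto simp: m_def)
          have "rnorm p0 f t epowr Q0 \<le> ennreal (K * (m t / 4) powr (-g2)) epowr Q0"
            using K(2)[OF t] 2 by (intro epowr_mono) auto
          also have "\<dots> = ennreal ((K * (m t / 4) powr (-g2)) powr Q0)" using K(1) by (simp add: epowr_ennreal)
          also have "(m t / 4) powr (-g2) = 4 powr g2 * m t powr (-g2)"
            using mt by (simp add: powr_divide powr_minus_divide)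
          also have "(K * (4 powr g2 * m t powr (-g2))) powr Q0 = (K * 4 powr g2) powr Q0 * m t powr (-(Q0 * g2))"
            using K(1) by (simp add: powr_mult powr_powr mult.commute)
          also have "ennreal \<dots> = g (m t)" by (simp add: g_def ennreal_mult')
          finally show ?thesis using True by (simp add: m_def)
        qed simp
      qed
    qed
    also have "\<dots> \<le> 2 * (\<integral>\<^sup>+t\<in>{0..pi}. g t \<partial>lborel)" by (rule nn_integral_folded_le) measurable
    also have "(\<integral>\<^sup>+t\<in>{0..pi}. g t \<partial>lborel) = ennreal ((K * 4 powr g2) powr Q0) * (\<integral>\<^sup>+t\<in>{0..pi}. ennreal (t powr (-(Q0 * g2))) \<partial>lborel)"
      unfolding g_def mult.assoc by (rule nn_integral_cmult) measurable
    also have "(\<integral>\<^sup>+t\<in>{0..pi}. ennreal (t powr (-(Q0 * g2))) \<partial>lborel) = ennreal (pi powr (1 - Q0 * g2) / (1 - Q0 * g2))"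
      by (rule nn_integral_powr_from_0[OF b]) simp
    also have "2 * (ennreal ((K * 4 powr g2) powr Q0) * \<dots>) < \<infinity>" by (simp add: ennreal_mult_less_top)
    finally show ?thesis unfolding 2(2) using RM_fin[OF p0 2(1)] hol by simp
  qed
  have "f \<notin> RM p q"
  proof (rule not_RM_if_rnorm_ge_powr[OF assms(3,4), where c = "2 powr (-\<gamma>)" and e = "\<gamma> - recip p"])
    show "0 < \<gamma> - recip p" "recip q \<le> \<gamma> - recip p" using \<gamma> recip_nonneg[of q] by auto
    fix t :: real assume t: "0 < t" "t \<le> 1/2"
    \<comment> \<open>For x <= t the point is within \<open>2 * t\<close> of 1, so the ray carries
      this lower bound on a segment of length \<open>t\<close>.\<close>
    have low: "(2 * t) powr (-\<gamma>) \<le> ray f t (1 - x)" if x: "0 < x" "x \<le> t" for x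
    proof -
      have x1: "x \<le> 1" using x t by simp
      have "S x t \<le> x + t" unfolding S_def by (rule dist_1_polar(4)[OF x(1) x1]) (use t in simp)
      moreover have "x \<le> S x t" unfolding S_def by (rule dist_1_polar(1)[OF x(1) x1])
      ultimately have "(2 * t) powr (-\<gamma>) \<le> S x t powr (-\<gamma>)" using x g by (intro powr_mono2') auto
      then show ?thesis using rayS[OF x(1) x1] by simp
    qed
    show "ennreal (2 powr (-\<gamma>) * t powr (- (\<gamma> - recip p))) \<le> rnorm p f t"
      using assms(3)
    proof (cases rule: ennreal_cases_pos)
      case 1
      have "ennreal (2 powr (-\<gamma>) * t powr (- (\<gamma> - recip p))) = ennreal ((2 * t) powr (-\<gamma>))"
        using t by (simp add: 1 recip_top powr_mult)
      also have "\<dots> \<le> ennreal (ray f t (1 - t))" using low[of t] t by (intro ennreal_leI) auto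
      also have "\<dots> \<le> rnorm p f t" unfolding 1 by (rule rnorm_ge_ray) (use t in auto)
      finally show ?thesis .
    next
      case (2 P)
      have "ennreal (t * ((2 * t) powr (-\<gamma>)) powr P) = (\<integral>\<^sup>+x\<in>{0<..t}. ennreal (((2 * t) powr (-\<gamma>)) powr P) \<partial>lborel)"
        using t by (subst nn_integral_cmult_indicator) (auto simp: mult.commute simp flip: ennreal_mult')
      also have "\<dots> \<le> radial_int P f t"
        by (rule radial_int_ge[OF hol]) (use t low 2 in \<open>auto intro!: powr_mono2\<close>)
      finally have "ennreal (t * ((2 * t) powr (-\<gamma>)) powr P) epowr (1/P) \<le> radial_int P f t epowr (1/P)"
        using 2 by (intro epowr_mono) auto
      also have "\<dots> = rnorm p f t" using 2 by (simp add: rnorm_def)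
      also have "ennreal (t * ((2 * t) powr (-\<gamma>)) powr P) epowr (1/P) = ennreal (t powr (1/P) * (2 * t) powr (-\<gamma>))"
        using t 2 by (simp add: epowr_ennreal powr_mult powr_powr)
      also have "t powr (1/P) * (2 * t) powr (-\<gamma>) = 2 powr (-\<gamma>) * t powr (- (\<gamma> - recip p))"
        using t 2 by (simp add: powr_mult recip_ennreal powr_diff powr_minus_divide)
      finally show ?thesis .
    qed
  qed simp
  with inRM show ?thesis by blast
qed

section \<open>The logarithmic endpoint\<close>

text \<open>The derivative is \<open>x powr (\<kappa> - 1) * (\<kappa> * (c - ln x) - 1)\<close>, so
  it is enough to control the sign at the right end \<open>u\<close>. Used with
  \<open>u = 2\<close>, which bounds |1 - z|, once with \<open>\<kappa> = 1\<close> and once with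
  \<open>\<kappa> = 1 - \<eta>\<close>; it allows |1 - z| to be replaced by its estimates.\<close>

lemma powr_times_log_mono:
  assumes "0 < y" "y \<le> z" "z \<le> u" "0 < \<kappa>" "1 \<le> \<kappa> * (c - ln u)"
  shows "y powr \<kappa> * (c - ln y) \<le> z powr \<kappa> * (c - ln (z::real))"
proof (rule DERIV_nonneg_imp_nondecreasing[OF assms(2)])
  fix x assume x: "y \<le> x" "x \<le> z"
  have x0: "0 < x" using x assms by simp
  have "ln x \<le> ln u" using x x0 assms by simp
  then have "\<kappa> * (c - ln u) \<le> \<kappa> * (c - ln x)" using assms by (intro mult_left_mono) auto
  then have "1 \<le> \<kappa> * (c - ln x)" using assms by linarith
  then have "0 \<le> x powr (\<kappa> - 1) * (\<kappa> * (c - ln x) - 1)" by simp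
  moreover have "((\<lambda>x. x powr \<kappa> * (c - ln x)) has_real_derivative x powr (\<kappa> - 1) * (\<kappa> * (c - ln x) - 1)) (at x)"
    using x0 by (auto intro!: derivative_eq_intros simp: powr_diff field_simps)
  ultimately show "\<exists>d. ((\<lambda>x. x powr \<kappa> * (c - ln x)) has_real_derivative d) (at x) \<and> 0 \<le> d" by blast
qed

text \<open>The antiderivative \<open>(c - ln t) powr (1 - b) / (b - 1)\<close> tends to 0 at the
  left end. The integrand is singular there, so the form of the fundamental theorem is used that
  requires continuity up to the boundary and derivatives inside only.\<close>

lemma nn_integral_log_powr_finite:
  assumes b: "1 < b" and R: "0 < R" "ln R < c"
  shows "(\<integral>\<^sup>+t\<in>{0..R}. ennreal (1/t * (c - ln t) powr (-b)) \<partial>lborel) < \<infinity>"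
proof -
  \<comment> \<open>The value at 0 is set by hand to the limit from the right.\<close>
  define F where "F t = (if t \<le> 0 then 0 else (c - ln t) powr (1 - b) / (b - 1))" for t
  have "((\<lambda>t. 1/t * (c - ln t) powr (-b)) has_integral (F R - F 0)) {0..R}"
  proof (rule fundamental_theorem_of_calculus_interior)
    have lnl: "ln x < c" if "0 < x" "x \<le> R" for x
    proof -
      have "ln x \<le> ln R" using that R by simp
      then show ?thesis using R by linarith
    qed
    have ev: "eventually (\<lambda>t. F t = (c - ln t) powr (1 - b) / (b - 1)) (nhds x)" if "0 < x" for x
      by (rule eventually_mono[OF eventually_nhds_in_open[of "{0<..}" x]]) (use that in \<open>auto simp: F_def\<close>)
    show "continuous_on {0..R} F"
      unfolding continuous_on_eq_continuous_within
    proof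
      fix x assume x: "x \<in> {0..R}"
      show "continuous (at x within {0..R}) F"
      proof (cases "x = 0")
        case True
        have "((\<lambda>t. (c - ln t) powr (1 - b) / (b - 1)) \<longlongrightarrow> 0 / (b - 1)) (at_right 0)"
        proof (intro tendsto_divide tendsto_const tendsto_neg_powr)
          show "filterlim (\<lambda>t::real. c - ln t) at_top (at_right 0)"
            unfolding diff_conv_add_uminus
            by (intro filterlim_tendsto_add_at_top[OF tendsto_const] filterlim_compose[OF filterlim_uminus_at_top_at_bot ln_at_0])
        qed (use b in auto)
        moreover have "eventually (\<lambda>t. F t = (c - ln t) powr (1 - b) / (b - 1)) (at_right 0)"
          by (rule eventually_mono[OF eventually_at_right_less]) (auto simp: F_def)
        ultimately have "(F \<longlongrightarrow> 0) (at_right 0)"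
          by (simp add: filterlim_cong)
        moreover have "at 0 within {0..R} = at_right 0"
          using R by (intro at_within_nhd[of _ "{-R<..<R}"]) auto
        ultimately show ?thesis using True by (simp add: continuous_within F_def)
      next
        case False
        then have x0: "0 < x" using x by auto
        have "isCont (\<lambda>t. (c - ln t) powr (1 - b) / (b - 1)) x"
          using x0 lnl[of x] x b by (intro continuous_intros) auto
        then have "isCont F x" using isCont_cong[OF ev[OF x0]] by simp
        then show ?thesis by (rule continuous_at_imp_continuous_at_within)
      qed
    qed
    fix x assume "x \<in> {0<..<R}"
    then have x: "0 < x" "x < R" by auto
    have "((\<lambda>t. (c - ln t) powr (1 - b) / (b - 1)) has_real_derivative 1/x * (c - ln x) powr (-b)) (at x)"
    proof -
      have d1: "((\<lambda>t. c - ln t) has_real_derivative - (1/x)) (at x)"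
        using x by (auto intro!: derivative_eq_intros)
      have d2: "((\<lambda>z. z powr (1 - b)) has_real_derivative (1 - b) * (c - ln x) powr (1 - b - 1)) (at (c - ln x))"
        by (rule has_real_derivative_powr) (use lnl[of x] x in simp)
      have e: "(1 - b) * Y * - (1/x) / (b - 1) = 1/x * Y" for Y
        using b x by (simp add: field_simps)
      show ?thesis
        using DERIV_cdivide[OF DERIV_chain2[OF d2 d1], of "b - 1"] unfolding e by simp
    qed
    then have "(F has_real_derivative 1/x * (c - ln x) powr (-b)) (at x)"
      by (subst DERIV_cong_ev[OF refl ev[OF x(1)] refl])
    then show "(F has_vector_derivative 1/x * (c - ln x) powr (-b)) (at x)"
      by (simp add: has_real_derivative_iff_has_vector_derivative)
  qed (use R in simp)
  then have "(\<integral>\<^sup>+t\<in>{0..R}. ennreal (1/t * (c - ln t) powr (-b)) \<partial>lborel) = ennreal (F R - F 0)"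
    by (intro nn_integral_has_integral_lebesgue') auto
  then show ?thesis by simp
qed

text \<open>With m the distance of \<open>t\<close> to 0 on the circle and l(m) = c - ln m, the
  radial integral of the \<open>P0\<close>-th power is at most of order m^(1-a) l(m)^(-a); to the
  power Q0/P0 this becomes m^(-1) l(m)^(-b), integrable because b > 1. For the exponent \<beta> the
  integrand is comparable to 1/(y l(y)) with y = |1 - z|, and its integral grows like ln (l(t)) as
  \<open>t\<close> tends to 0.\<close>

lemma not_RM_subset_endpoint:
  assumes P0: "1 \<le> P0" and Q0: "1 \<le> Q0" and \<beta>: "0 < \<beta>" "1 / \<beta> = 1 / P0 + 1 / Q0"
  shows "\<not> RM (ennreal P0) (ennreal Q0) \<subseteq> RM (ennreal \<beta>) \<infinity>"
proof -
  define s where "s = 1 / \<beta>"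
  have s: "0 < s" "s = 1 / P0 + 1 / Q0" "s * \<beta> = 1"
    unfolding s_def by (use \<beta>(1) in simp, rule \<beta>(2), use \<beta>(1) in simp)
  define a where "a = s * P0"
  have a: "a = 1 + P0 / Q0" "1 < a" using P0 Q0 by (simp_all add: a_def s(2) distrib_right)
  define b where "b = s * Q0"
  have b: "b = 1 + Q0 / P0" "1 < b" using P0 Q0 by (simp_all add: b_def s(2) distrib_right)
  have aQ: "a * (Q0 / P0) = b" using P0 by (simp add: a_def b_def)
  \<comment> \<open>The factor \<open>S powr \<eta>\<close> of \<open>S * l S\<close> gives convergence of the radial integral; the constant \<open>c\<close>
    makes the remaining factor \<open>S powr (1 - \<eta>) * l S\<close> increasing.\<close>
  define \<eta> where "\<eta> = (1 + 1/a) / 2"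
  have \<eta>: "0 < \<eta>" "\<eta> < 1" "1 < \<eta> * a" using a(2) by (auto simp: \<eta>_def field_simps)
  define c where "c = 1 + ln 2 + 1 / (1 - \<eta>)"
  have c1: "1 \<le> 1 * (c - ln 2)" "1 \<le> (1 - \<eta>) * (c - ln 2)" using \<eta> by (simp_all add: c_def distrib_left)
  define l where "l y = c - ln y" for y
  have l1: "1 \<le> l y" if "0 < y" "y \<le> 2" for y
  proof -
    have "ln y \<le> ln 2" using that by simp
    then show ?thesis using c1(1) by (simp add: l_def)
  qed
  \<comment> \<open>\<open>c - Ln (1 - z)\<close> has real part l(|1 - z|) >= 1, so the outer
    logarithm stays off its cut. Its imaginary part is at most pi < 4, so its modulus lies between
    \<open>l\<close> and \<open>5 * l\<close>; hence the factor 5 below.\<close>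
  define f where "f = (\<lambda>z. exp (- of_real s * (Ln (1 - z) + Ln (of_real c - Ln (1 - z)))) :: complex)"
  have ReL: "Re (of_real c - Ln (1 - z)) = l (norm (1 - z))" if "z \<in> ball 0 1" for z :: complex
    using one_minus_in_slit(1)[OF that] by (simp add: l_def)
  have lz: "1 \<le> l (norm (1 - z))" if "z \<in> ball 0 1" for z :: complex
    using one_minus_in_slit[OF that] by (intro l1) auto
  have slit: "of_real c - Ln (1 - z) \<notin> \<real>\<^sub>\<le>\<^sub>0" "of_real c - Ln (1 - z) \<noteq> 0" if "z \<in> ball 0 1" for z :: complex
  proof -
    have pos: "0 < Re (of_real c - Ln (1 - z))" unfolding ReL[OF that] using lz[OF that] by linarith
    then show "of_real c - Ln (1 - z) \<notin> \<real>\<^sub>\<le>\<^sub>0" by (metis complex_nonpos_Reals_iff not_le)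
    show "of_real c - Ln (1 - z) \<noteq> 0" using pos by (metis less_irrefl zero_complex.sel(1))
  qed
  have hol: "f holomorphic_on ball 0 1"
    unfolding f_def by (intro holomorphic_intros) (use one_minus_in_slit slit in auto)
  define S where "S x t = norm (1 - of_real (1 - x) * exp (\<i> * of_real t) :: complex)" for x t
  have rays: "(5 * (S x t * l (S x t))) powr (-s) \<le> ray f t (1 - x)" "ray f t (1 - x) \<le> (S x t * l (S x t)) powr (-s)" "0 < S x t"
    if x: "0 < x" "x \<le> 1" for x t
  proof -
    let ?z = "of_real (1 - x) * exp (\<i> * of_real t) :: complex"
    have z: "?z \<in> ball 0 1" using in_unit_ball_ray[of "1 - x" t] x by auto
    define w where "w = of_real c - Ln (1 - ?z)"
    have nz: "1 - ?z \<noteq> 0" "w \<noteq> 0" using one_minus_in_slit[OF z] slit[OF z] by (auto simp: w_def)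
    have S: "S x t = norm (1 - ?z)" by (simp add: S_def)
    show S0: "0 < S x t" using nz by (simp add: S)
    have "ray f t (1 - x) = exp (- s * (ln (norm (1 - ?z)) + ln (norm w)))"
      unfolding ray_def f_def w_def[symmetric] norm_exp_eq_Re using nz by simp
    also have "\<dots> = (S x t * norm w) powr (-s)"
      using S0 nz by (simp add: powr_def S ln_mult)
    finally have r: "ray f t (1 - x) = (S x t * norm w) powr (-s)" .
    have Rew: "Re w = l (S x t)" unfolding w_def S by (rule ReL[OF z])
    have l1: "1 \<le> l (S x t)" unfolding S by (rule lz[OF z])
    have lw: "l (S x t) \<le> norm w" using abs_Re_le_cmod[of w] Rew by linarith
    have "\<bar>Im w\<bar> \<le> pi"
      using mpi_less_Im_Ln[OF nz(1)] Im_Ln_le_pi[OF nz(1)] by (simp add: w_def abs_le_iff)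
    then have "norm w \<le> l (S x t) + pi" using cmod_le[of w] l1 Rew by linarith
    also have "\<dots> \<le> 5 * l (S x t)" using l1 pi_less_4 by linarith
    finally have wl: "norm w \<le> 5 * l (S x t)" .
    show "ray f t (1 - x) \<le> (S x t * l (S x t)) powr (-s)"
      unfolding r using lw l1 S0 s by (intro powr_mono2' mult_left_mono mult_pos_pos) auto
    have "S x t * norm w \<le> 5 * (S x t * l (S x t))" using mult_left_mono[OF wl, of "S x t"] S0 by (simp add: mult_ac)
    then show "(5 * (S x t * l (S x t))) powr (-s) \<le> ray f t (1 - x)"
      unfolding r using nz S0 s by (intro powr_mono2' mult_pos_pos) auto
  qed
  define m where "m t = min t (2*pi - t)" for t
  define K where "K = 8 powr (\<eta> * a) / (\<eta> * a - 1)"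
  have K: "0 \<le> K" using \<eta> by (simp add: K_def)
  define g where "g t = ennreal (K powr (Q0/P0) * 4 powr ((1 - \<eta>) * b)) * ennreal (1/t * (c + ln 4 - ln t) powr (-b))" for t
  have gm[measurable]: "g \<in> borel_measurable borel" unfolding g_def by measurable
  have up: "rnorm (ennreal P0) f t epowr Q0 \<le> g (m t)" if t: "t \<in> {0<..<2*pi}" for t
  proof -
    have mt: "0 < m t" "m t \<le> pi" using t by (auto simp: m_def)
    define E where "E = (m t / 4) powr (1 - \<eta>) * l (m t / 4)"
    have lm: "1 \<le> l (m t / 4)" using mt pi_less_4 by (intro l1) auto
    have E: "0 < E" using mt lm by (simp add: E_def)
    have pt: "ray f t (1 - x) powr P0 \<le> 8 powr (\<eta> * a) * E powr (-a) * (x + m t) powr (-(\<eta> * a))" if x: "0 < x" "x \<le> 1" for x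
    proof -
      have Sx: "x \<le> S x t" "S x t < 2" unfolding S_def by (rule dist_1_polar[OF x])+
      have Sm: "m t / 4 \<le> S x t" unfolding S_def m_def by (rule dist_1_polar(3)[OF x]) (use t in auto)
      have S0: "0 < S x t" by (rule rays(3)[OF x])
      have "E \<le> S x t powr (1 - \<eta>) * l (S x t)"
        unfolding E_def l_def by (rule powr_times_log_mono[where u = 2]) (use mt Sm Sx \<eta> c1 in auto)
      moreover have "((x + m t) / 8) powr \<eta> \<le> S x t powr \<eta>" using Sx Sm x mt \<eta> by (intro powr_mono2) auto
      ultimately have "((x + m t) / 8) powr \<eta> * E \<le> S x t powr \<eta> * (S x t powr (1 - \<eta>) * l (S x t))"
        using E by (intro mult_mono) auto
      also have "\<dots> = S x t * l (S x t)" using S0 by (simp add: mult.assoc[symmetric] powr_add[symmetric])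
      finally have le: "((x + m t) / 8) powr \<eta> * E \<le> S x t * l (S x t)" .
      have "ray f t (1 - x) powr P0 \<le> ((S x t * l (S x t)) powr (-s)) powr P0"
        using P0 rays(2)[OF x] by (intro powr_mono2) auto
      also have "\<dots> = (S x t * l (S x t)) powr (-a)" by (simp add: powr_powr a_def)
      also have "\<dots> \<le> (((x + m t) / 8) powr \<eta> * E) powr (-a)"
        using le a E x mt by (intro powr_mono2' mult_pos_pos) auto
      also have "\<dots> = 8 powr (\<eta> * a) * E powr (-a) * (x + m t) powr (-(\<eta> * a))"
      proof -
        have "(((x + m t) / 8) powr \<eta> * E) powr (-a) = ((x + m t) / 8) powr (-(\<eta> * a)) * E powr (-a)"
          using E by (simp add: powr_mult powr_powr)
        also have "((x + m t) / 8) powr (-(\<eta> * a)) = (x + m t) powr (-(\<eta> * a)) * 8 powr (\<eta> * a)"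
          using x mt by (simp add: powr_divide powr_minus_divide)
        finally show ?thesis by (simp add: mult_ac)
      qed
      finally show ?thesis .
    qed
    \<comment> \<open>The range of \<open>x\<close> is enlarged to the whole half line, where the
      integral of \<open>(m t + x) powr (-(\<eta> * a))\<close> is explicit and finite because
      \<open>\<eta> * a > 1\<close>.\<close>
    have "radial_int P0 f t \<le> (\<integral>\<^sup>+x. ennreal (8 powr (\<eta> * a) * E powr (-a)) * (ennreal ((m t + x) powr (-(\<eta> * a))) * indicator {m t..} (m t + x)) \<partial>lborel)"
      unfolding radial_int_reflect[OF hol]
    proof (rule nn_integral_mono)
      fix x :: real
      show "ennreal (ray f t (1 - x) powr P0) * indicator {0<..1} x
         \<le> ennreal (8 powr (\<eta> * a) * E powr (-a)) * (ennreal ((m t + x) powr (-(\<eta> * a))) * indicator {m t..} (m t + x))"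
      proof (cases "x \<in> {0<..1}")
        case True
        then have "ennreal (ray f t (1 - x) powr P0) \<le> ennreal (8 powr (\<eta> * a) * E powr (-a) * (m t + x) powr (-(\<eta> * a)))"
          using pt[of x] by (intro ennreal_leI) (auto simp: add.commute)
        then show ?thesis using True by (simp add: ennreal_mult')
      qed simp
    qed
    also have "\<dots> = ennreal (8 powr (\<eta> * a) * E powr (-a)) * (\<integral>\<^sup>+x. ennreal ((m t + x) powr (-(\<eta> * a))) * indicator {m t..} (m t + x) \<partial>lborel)"
      by (rule nn_integral_cmult) measurable
    also have "(\<integral>\<^sup>+x. ennreal ((m t + x) powr (-(\<eta> * a))) * indicator {m t..} (m t + x) \<partial>lborel) = (\<integral>\<^sup>+y\<in>{m t..}. ennreal (y powr (-(\<eta> * a))) \<partial>lborel)"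
      using nn_integral_real_affine[of "\<lambda>y. ennreal (y powr (-(\<eta> * a))) * indicator {m t..} y" 1 "m t"] by simp
    also have "\<dots> = ennreal (m t powr (1 - \<eta> * a) / (\<eta> * a - 1))"
      by (rule nn_integral_powr_to_inf) (use \<eta> mt in auto)
    also have "ennreal (8 powr (\<eta> * a) * E powr (-a)) * \<dots> = ennreal (K * (E powr (-a) * m t powr (1 - \<eta> * a)))"
      by (simp add: K_def mult_ac flip: ennreal_mult')
    finally have "radial_int P0 f t epowr (Q0/P0) \<le> ennreal (K * (E powr (-a) * m t powr (1 - \<eta> * a))) epowr (Q0/P0)"
      using P0 Q0 by (intro epowr_mono) auto
    also have "\<dots> = ennreal ((K * (E powr (-a) * m t powr (1 - \<eta> * a))) powr (Q0/P0))"
      using K by (simp add: epowr_ennreal)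
    also have "(K * (E powr (-a) * m t powr (1 - \<eta> * a))) powr (Q0/P0) = (K powr (Q0/P0) * 4 powr ((1 - \<eta>) * b)) * (1 / m t * (c + ln 4 - ln (m t)) powr (-b))"
    proof -
      have "(K * (E powr (-a) * m t powr (1 - \<eta> * a))) powr (Q0/P0) = K powr (Q0/P0) * (E powr (-(a * (Q0/P0))) * m t powr ((1 - \<eta> * a) * (Q0/P0)))"
        using K by (simp add: powr_mult powr_powr)
      also have "E powr (-(a * (Q0/P0))) = (m t / 4) powr (-((1 - \<eta>) * b)) * l (m t / 4) powr (-b)"
        unfolding aQ E_def using lm by (simp add: powr_mult powr_powr)
      also have "(m t / 4) powr (-((1 - \<eta>) * b)) = m t powr (-((1 - \<eta>) * b)) * 4 powr ((1 - \<eta>) * b)"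
        using mt by (simp add: powr_divide powr_minus_divide)
      also have "l (m t / 4) = c + ln 4 - ln (m t)" using mt by (simp add: l_def ln_div)
      also have "(1 - \<eta> * a) * (Q0/P0) = Q0/P0 - \<eta> * b" unfolding aQ[symmetric] by (simp add: algebra_simps)
      finally have "(K * (E powr (-a) * m t powr (1 - \<eta> * a))) powr (Q0/P0) =
          (K powr (Q0/P0) * 4 powr ((1 - \<eta>) * b)) * ((m t powr (-((1 - \<eta>) * b)) * m t powr (Q0/P0 - \<eta> * b)) * (c + ln 4 - ln (m t)) powr (-b))"
        by (simp only: mult_ac)
      \<comment> \<open>The auxiliary \<eta> drops out: the exponents add up to Q0/P0 - b =
        -1.\<close>
      also have "m t powr (-((1 - \<eta>) * b)) * m t powr (Q0/P0 - \<eta> * b) = 1 / m t"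
      proof -
        have "-((1 - \<eta>) * b) + (w - \<eta> * b) = w - b" for w by (simp add: algebra_simps)
        then have "-((1 - \<eta>) * b) + (Q0/P0 - \<eta> * b) = -1" using b(1) by simp
        then show ?thesis unfolding powr_add[symmetric] using mt by (simp add: powr_neg_one)
      qed
      finally show ?thesis .
    qed
    also have "ennreal \<dots> = g (m t)" unfolding g_def by (rule ennreal_mult') simp
    finally show ?thesis using P0 by (simp add: rnorm_def epowr_epowr)
  qed
  have "(\<integral>\<^sup>+t\<in>{0..<2*pi}. rnorm (ennreal P0) f t epowr Q0 \<partial>lborel) \<le> (\<integral>\<^sup>+t\<in>{0..<2*pi}. g (min t (2*pi - t)) \<partial>lborel)"
  proof (rule nn_integral_mono_AE)
    show "AE t in lborel. rnorm (ennreal P0) f t epowr Q0 * indicator {0..<2*pi} t \<le> g (min t (2*pi - t)) * indicator {0..<2*pi} t"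
      using AE_lborel_singleton[of "0::real"]
    proof eventually_elim
      case (elim t)
      then show ?case using up[of t] by (cases "t \<in> {0..<2*pi}") (auto simp: m_def)
    qed
  qed
  also have "\<dots> \<le> 2 * (\<integral>\<^sup>+t\<in>{0..pi}. g t \<partial>lborel)" by (rule nn_integral_folded_le) measurable
  also have "(\<integral>\<^sup>+t\<in>{0..pi}. g t \<partial>lborel) = ennreal (K powr (Q0/P0) * 4 powr ((1 - \<eta>) * b)) * (\<integral>\<^sup>+t\<in>{0..pi}. ennreal (1/t * (c + ln 4 - ln t) powr (-b)) \<partial>lborel)"
    unfolding g_def mult.assoc by (rule nn_integral_cmult) measurable
  also have "2 * \<dots> < \<infinity>"
  proof -
    have "ln pi < ln 4" using pi_less_4 by simp
    moreover have "0 \<le> c" using c1(1) by (simp add: add_nonneg_nonneg order_trans[of 0 "1 + ln 2"])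
    ultimately have "ln pi < c + ln 4" by linarith
    then show ?thesis using nn_integral_log_powr_finite[OF b(2), of pi "c + ln 4"] by (simp add: ennreal_mult_less_top)
  qed
  finally have inRM: "f \<in> RM (ennreal P0) (ennreal Q0)"
    using RM_fin[of "ennreal P0" Q0] P0 Q0 hol by simp
  have "f \<notin> RM (ennreal \<beta>) \<infinity>"
  proof (rule not_RM_if_rnorm_unbounded)
    fix R :: real
    define R' where "R' = max R 0"
    \<comment> \<open>A threshold for \<open>l t\<close> beyond which a fifth of ln (l t) - ln (l
      (1/2)) exceeds \<open>R' powr \<beta>\<close>. The condition t < exp (c - Z) in
      \<open>\<delta>\<close> says precisely that \<open>l t\<close> is above it.\<close>
    define Z where "Z = l (1/2) * exp (6 * R' powr \<beta>)"
    define \<delta> where "\<delta> = min (1/2) (exp (c - Z))"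
    have l2: "1 \<le> l (1/2)" by (rule l1) auto
    have "ennreal R < rnorm (ennreal \<beta>) f t" if t: "t \<in> {0<..<\<delta>}" for t
    proof -
      have t': "0 < t" "t < 1/2" "t < exp (c - Z)" using t by (auto simp: \<delta>_def)
      have "ln t < c - Z" using t' by (metis exp_gt_zero ln_exp ln_less_cancel_iff)
      then have lt: "Z < l t" by (simp add: l_def)
      \<comment> \<open>Since \<open>s * \<beta> = 1\<close>, the \<beta>-th power of the lower
        bound on the ray is 1/(5 S l(S)); monotonicity of y l(y) on (0, 2] lets the larger
        \<open>x + t\<close> take the place of S.\<close>
      define h where "h x = 1 / (5 * ((x + t) * l (x + t)))" for x
      have hx: "h x \<le> ray f t (1 - x) powr \<beta>" if x: "x \<in> {0<..1/2}" for x
      proof -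
        have x': "0 < x" "x \<le> 1" using x by auto
        have S0: "0 < S x t" by (rule rays(3)[OF x'])
        have Sxt: "S x t \<le> x + t" unfolding S_def by (rule dist_1_polar(4)[OF x']) (use t' in simp)
        have lS: "1 \<le> l (S x t)" using S0 Sxt x t' by (intro l1) auto
        have "S x t powr 1 * (c - ln (S x t)) \<le> (x + t) powr 1 * (c - ln (x + t))"
          by (rule powr_times_log_mono[where u = 2]) (use S0 Sxt x t' c1 in auto)
        then have "S x t * l (S x t) \<le> (x + t) * l (x + t)" using S0 x t' by (simp add: l_def)
        then have "1 / (5 * ((x + t) * l (x + t))) \<le> 1 / (5 * (S x t * l (S x t)))"
          using S0 lS by (intro frac_le) auto
        also have "\<dots> = ((5 * (S x t * l (S x t))) powr (-s)) powr \<beta>"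
          using s(3) S0 lS by (simp add: powr_powr powr_neg_one)
        also have "\<dots> \<le> ray f t (1 - x) powr \<beta>"
          using rays(1)[OF x'] \<beta> by (intro powr_mono2) auto
        finally show ?thesis by (simp add: h_def)
      qed
      have lpos: "0 < l (x + t)" if "0 \<le> x" "x \<le> 1/2" for x
        using l1[of "x + t"] that t' by simp
      \<comment> \<open>The derivative of \<open>l y\<close> is -1/y, so -ln (l y) is an
        antiderivative of 1/(y l(y)).\<close>
      have hi: "(h has_integral (- ln (l (1/2 + t)) / 5 - (- ln (l (0 + t)) / 5))) {0..1/2}"
      proof (rule fundamental_theorem_of_calculus)
        fix x :: real assume "x \<in> {0..1/2}"
        then have x: "0 \<le> x" "x \<le> 1/2" by auto
        have "((\<lambda>x. l (x + t)) has_real_derivative - (1 / (x + t))) (at x)"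
          unfolding l_def using x t' by (auto intro!: derivative_eq_intros)
        from DERIV_chain2[OF DERIV_ln_divide[OF lpos[OF x]] this]
        have "((\<lambda>x. ln (l (x + t))) has_real_derivative 1 / l (x + t) * - (1 / (x + t))) (at x)" .
        from DERIV_cdivide[OF DERIV_minus[OF this], of 5]
        have "((\<lambda>x. - ln (l (x + t)) / 5) has_real_derivative h x) (at x)"
          by (simp add: h_def mult_ac)
        then show "((\<lambda>x. - ln (l (x + t)) / 5) has_vector_derivative h x) (at x within {0..1/2})"
          by (simp add: has_real_derivative_iff_has_vector_derivative has_vector_derivative_at_within)
      qed simp
      have "(\<integral>\<^sup>+x\<in>{0..1/2}. ennreal (h x) \<partial>lborel) = ennreal (- ln (l (1/2 + t)) / 5 - (- ln (l (0 + t)) / 5))"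
        by (rule nn_integral_has_integral_lebesgue'[OF _ hi]) (use lpos t' in \<open>auto simp: h_def less_imp_le\<close>)
      moreover have "(\<integral>\<^sup>+x\<in>{0..1/2}. ennreal (h x) \<partial>lborel) = (\<integral>\<^sup>+x\<in>{0<..1/2}. ennreal (h x) \<partial>lborel)"
        by (rule nn_integral_cong_AE, use AE_lborel_singleton[of "0::real"] in eventually_elim) (auto simp: indicator_def)
      moreover have "(\<integral>\<^sup>+x\<in>{0<..1/2}. ennreal (h x) \<partial>lborel) \<le> radial_int \<beta> f t"
        by (rule radial_int_ge[OF hol]) (use hx in auto)
      ultimately have int: "ennreal ((ln (l t) - ln (l (1/2 + t))) / 5) \<le> radial_int \<beta> f t"
        by (simp add: diff_divide_distrib)
      have "R' powr \<beta> < (ln (l t) - ln (l (1/2 + t))) / 5"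
      proof -
        have Z0: "0 < Z" using l2 by (simp add: Z_def)
        have "ln Z < ln (l t)" using lt Z0 by simp
        moreover have "ln Z = ln (l (1/2)) + 6 * R' powr \<beta>" using l2 by (simp add: Z_def ln_mult)
        moreover have "ln (l (1/2 + t)) \<le> ln (l (1/2))"
        proof -
          have "l (1/2 + t) \<le> l (1/2)" using t' by (simp add: l_def)
          then show ?thesis using lpos[of "1/2"] by simp
        qed
        moreover define Y where "Y = R' powr \<beta>"
        moreover have "0 \<le> Y" by (simp add: Y_def)
        ultimately show ?thesis unfolding Y_def[symmetric] by (simp add: field_simps)
      qed
      then have "ennreal (R' powr \<beta>) < ennreal ((ln (l t) - ln (l (1/2 + t))) / 5)"
        by (metis ennreal_lessI le_less_trans powr_ge_zero)
      also note int
      finally have "\<not> radial_int \<beta> f t \<le> ennreal (R' powr \<beta>)" by simp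
      then have "\<not> rnorm (ennreal \<beta>) f t \<le> ennreal R'"
        using \<beta> by (simp add: rnorm_fin_le_iff R'_def)
      then have "ennreal R' < rnorm (ennreal \<beta>) f t" by simp
      moreover have "ennreal R \<le> ennreal R'" by (intro ennreal_leI) (simp add: R'_def)
      ultimately show ?thesis by (rule le_less_trans[rotated])
    qed
    moreover have "0 < \<delta>" by (simp add: \<delta>_def)
    ultimately show "\<exists>\<delta>>0. \<forall>t\<in>{0<..<\<delta>}. ennreal R < rnorm (ennreal \<beta>) f t" by blast
  qed (use \<beta> in simp)
  with inRM show ?thesis by blast
qed

section \<open>The characterization\<close>

lemma recip_ennreal_eq: "0 < p \<Longrightarrow> 1 / p = ennreal (recip p)"
  by (cases rule: ennreal_cases_pos[of p]) (auto simp: recip_ennreal recip_top divide_ennreal simp flip: ennreal_1)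

lemma mem_A_iff:
  assumes "0 < p0" "0 < q0"
  shows "(p, q) \<in> A p0 q0 \<longleftrightarrow> 0 < p \<and> 0 < q \<and> recip p0 + recip q0 \<le> recip p + recip q \<and> p \<le> p0"
  using assms
  by (auto simp: A_def recip_ennreal_eq recip_nonneg ennreal_le_iff simp flip: ennreal_plus)

lemma ennreal_eq_inverse_recip: "0 < p \<Longrightarrow> 0 < q \<Longrightarrow> recip p = recip q \<Longrightarrow> p = q"
  by (cases rule: ennreal_cases_pos[of p]; cases rule: ennreal_cases_pos[of q])
     (auto simp: recip_ennreal recip_top)

text \<open>Writing the excluded point through \<open>recip\<close> merges the two cases of the
  characterization. For \<open>q \<le> q0\<close> the inclusion is monotonicity in both exponents; a
  larger finite \<open>q\<close> is reached by first moving to the critical line at this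
  \<open>q\<close> and then lowering the radial exponent.\<close>

lemma RM_subset_iff_mem_A:
  assumes "1 \<le> p0" "1 \<le> q0" "0 < p" "0 < q"
  shows "RM p0 q0 \<subseteq> RM p q \<longleftrightarrow> (p, q) \<in> A p0 q0 \<and>
    \<not> (p0 < \<infinity> \<and> q0 < \<infinity> \<and> q = \<infinity> \<and> recip p = recip p0 + recip q0)"
proof -
  have p0: "0 < p0" by (rule less_le_trans[OF _ assms(1)]) simp
  have q0: "0 < q0" by (rule less_le_trans[OF _ assms(2)]) simp
  show ?thesis
  proof
    assume sub: "RM p0 q0 \<subseteq> RM p q"
    have "p \<le> p0" using not_RM_subset_radial[OF assms(1) _ q0 assms(4)] sub not_le by blast
    moreover have "recip p0 + recip q0 \<le> recip p + recip q"
      using not_RM_subset_diagonal[OF assms] sub not_le by blast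
    moreover have False if fin: "p0 < \<infinity>" "q0 < \<infinity>" and q: "q = \<infinity>" and eq: "recip p = recip p0 + recip q0"
    proof -
      obtain P0 where P0: "0 < P0" "p0 = ennreal P0" using p0 fin(1) by (auto elim: ennreal_cases_pos)
      obtain Q0 where Q0: "0 < Q0" "q0 = ennreal Q0" using q0 fin(2) by (auto elim: ennreal_cases_pos)
      have e: "recip p = 1 / P0 + 1 / Q0" using eq P0 Q0 by (simp add: recip_ennreal)
      moreover have "0 < 1 / P0 + 1 / Q0" using P0 Q0 by (simp add: add_pos_pos)
      ultimately have "p \<noteq> \<infinity>" by (auto simp: recip_top)
      then obtain P where P: "0 < P" "p = ennreal P" using assms(3) by (auto elim: ennreal_cases_pos)
      have "\<not> RM (ennreal P0) (ennreal Q0) \<subseteq> RM (ennreal P) \<infinity>"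
        by (rule not_RM_subset_endpoint) (use assms P0 Q0 P e in \<open>auto simp: recip_ennreal simp flip: ennreal_1\<close>)
      then show False using sub P0 Q0 P q by simp
    qed
    ultimately show "(p, q) \<in> A p0 q0 \<and> \<not> (p0 < \<infinity> \<and> q0 < \<infinity> \<and> q = \<infinity> \<and> recip p = recip p0 + recip q0)"
      using assms mem_A_iff[OF p0 q0] by blast
  next
    assume R: "(p, q) \<in> A p0 q0 \<and> \<not> (p0 < \<infinity> \<and> q0 < \<infinity> \<and> q = \<infinity> \<and> recip p = recip p0 + recip q0)"
    then have le: "p \<le> p0" "recip p0 + recip q0 \<le> recip p + recip q"
      and ne: "\<not> (p0 < \<infinity> \<and> q0 < \<infinity> \<and> q = \<infinity> \<and> recip p = recip p0 + recip q0)"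
      using mem_A_iff[OF p0 q0] by blast+
    show "RM p0 q0 \<subseteq> RM p q"
    proof (cases "q \<le> q0")
      case True
      then show ?thesis using RM_antimono assms le by blast
    next
      case False
      then have "q0 \<noteq> \<infinity>" by auto
      then obtain Q0 where Q0: "0 < Q0" "q0 = ennreal Q0" using q0 by (auto elim: ennreal_cases_pos)
      have Q01: "1 \<le> Q0" using assms Q0 by (simp flip: ennreal_1)
      show ?thesis using assms(4)
      proof (cases rule: ennreal_cases_pos)
        case q: 1
        have rp: "recip p0 + 1 / Q0 \<le> recip p" using le q Q0 by (simp add: recip_top recip_ennreal)
        moreover have "0 < 1 / Q0" using Q0 by simp
        ultimately have "0 < recip p" using recip_nonneg[of p0] by linarith
        then have "p \<noteq> \<infinity>" by (auto simp: recip_top)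
        then obtain P where P: "0 < P" "p = ennreal P" using assms(3) by (auto elim: ennreal_cases_pos)
        show ?thesis
        proof (cases "p0 = \<infinity>")
          case True
          \<comment> \<open>For infinite \<open>p0\<close> the endpoint exponent is
            \<open>Q0\<close> itself; Fejer-Riesz reaches it and monotonicity does the rest.\<close>
          then have "P \<le> Q0" using rp P Q0 by (simp add: recip_top recip_ennreal field_simps)
          then have "RM (ennreal Q0) \<infinity> \<subseteq> RM p q"
            unfolding P(2) q using P Q0 by (intro RM_antimono) (auto intro: ennreal_leI)
          then show ?thesis using RM_Fejer_Riesz[OF Q01] True Q0 by auto
        next
          case False
          then have "recip p \<noteq> recip p0 + recip q0" using ne q Q0 by (auto simp: less_top)
          then have "recip p0 + 1 / Q0 < 1 / P" using rp P Q0 by (simp add: recip_ennreal)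
          then show ?thesis using RM_subset_top[OF assms(1) Q01 P(1)] P q Q0 by simp
        qed
      next
        case Q: (2 Q)
        have QQ: "Q0 < Q" using False Q Q0 by (simp add: not_le ennreal_less_iff)
        then have lt: "1 / Q < 1 / Q0" using Q0 by (simp add: frac_less2)
        \<comment> \<open>The radial exponent paired with \<open>Q\<close> on the critical line; the
          denominator is positive because \<open>Q0 < Q\<close>.\<close>
        define P' where "P' = 1 / (recip p0 + 1/Q0 - 1/Q)"
        have P': "0 < P'" "1 / P' + 1 / Q = recip p0 + 1 / Q0" using lt recip_nonneg[of p0] by (auto simp: P'_def)
        have sub: "RM p0 q0 \<subseteq> RM (ennreal P') q"
          unfolding Q0(2) Q(2) by (rule RM_subset_critical[OF assms(1) Q01 QQ P'])
        have "1 / P' \<le> recip p" using P' le Q Q0 by (simp add: recip_ennreal)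
        moreover have "0 < 1 / P'" using P' by simp
        ultimately have "p \<noteq> \<infinity>" by (auto simp: recip_top)
        then obtain P where P: "0 < P" "p = ennreal P" using assms(3) by (auto elim: ennreal_cases_pos)
        have "P \<le> P'" using \<open>1 / P' \<le> recip p\<close> P P' by (simp add: recip_ennreal field_simps)
        then have "RM (ennreal P') q \<subseteq> RM p q"
          unfolding P(2) using P assms by (intro RM_antimono) (auto intro: ennreal_leI)
        with sub show ?thesis by blast
      qed
    qed
  qed
qed

theorem theorem3p3:
  fixes p0 q0 p q :: ennreal
  assumes "1 \<le> p0" and "1 \<le> q0" and "0 < p" and "0 < q"
  shows "(p0 < \<infinity> \<and> q0 < \<infinity> \<longrightarrow>
           (RM p0 q0 \<subseteq> RM p q \<longleftrightarrow> (p, q) \<in> A p0 q0 - {(p0 * q0 / (p0 + q0), \<infinity>)}))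
       \<and> (p0 = \<infinity> \<or> q0 = \<infinity> \<longrightarrow>
           (RM p0 q0 \<subseteq> RM p q \<longleftrightarrow> (p, q) \<in> A p0 q0))"
proof -
  have p0: "0 < p0" by (rule less_le_trans[OF _ assms(1)]) simp
  have q0: "0 < q0" by (rule less_le_trans[OF _ assms(2)]) simp
  have \<beta>: "recip p = recip p0 + recip q0 \<longleftrightarrow> p = p0 * q0 / (p0 + q0)" if fin: "p0 < \<infinity>" "q0 < \<infinity>"
  proof -
    obtain P0 where P0: "0 < P0" "p0 = ennreal P0" using p0 fin(1) by (auto elim: ennreal_cases_pos)
    obtain Q0 where Q0: "0 < Q0" "q0 = ennreal Q0" using q0 fin(2) by (auto elim: ennreal_cases_pos)
    define b where "b = P0 * Q0 / (P0 + Q0)"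
    have b: "0 < b" "1 / b = 1 / P0 + 1 / Q0" using P0 Q0 by (simp_all add: b_def field_simps)
    have "p0 * q0 / (p0 + q0) = ennreal b"
      using P0 Q0 by (simp add: b_def divide_ennreal add_pos_pos flip: ennreal_mult' ennreal_plus)
    moreover have "recip p0 + recip q0 = recip (ennreal b)" using b P0 Q0 by (simp add: recip_ennreal)
    ultimately show ?thesis using ennreal_eq_inverse_recip[OF assms(3), of "ennreal b"] b by auto
  qed
  show ?thesis
    using RM_subset_iff_mem_A[OF assms] \<beta> by auto
qed

end
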